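(* Let $n\in\mathbb{N}$ and consider the piecewise smooth perturbed system $$\begin{pmatrix}\dot x\\ \dot y\end{pmatrix}=\begin{cases}\begin{pmatrix}x^2(1-x-2y)+\varepsilon f^+(x,y)\\ xy(-2+3x+2y)+\varepsilon g^+(x,y)\end{pmatrix},& y\ge\frac12-\frac12x,\\[3mm] \begin{pmatrix}x^2(1-x-2y)+\varepsilon f^-(x,y)\\ xy(-2+3x+2y)+\varepsilon g^-(x,y)\end{pmatrix},& y<\frac12-\frac12x,\end{cases}$$ where $0<|\varepsilon|\ll1$ and $f^\pm(x,y)=\sum_{i+j=0}^n a^\pm_{i,j}x^iy^j$, $g^\pm(x,y)=\sum_{i+j=0}^n b^\pm_{i,j}x^iy^j$ with $a^\pm_{i,j},b^\pm_{i,j}\in\mathbb{R}$. Let $I(h)$, $h\in(0,\frac1{64})$, be the associated first order Melnikov function $$I(h)=\int_{\Gamma_h^+}g^+(x,y)\,dx-f^+(x,y)\,dy+\int_{\Gamma_h^-}g^-(x,y)\,dx-f^-(x,y)\,dy .$$ Then an upper bound for the number of zeros of $I(h)$ on $(0,\frac1{64})$, taking into account their multiplicities, is $\big[\frac{11n}{2}\big]+43$.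
   Context: For $\varepsilon=0$ the system is Hamiltonian with $H(x,y)=x^2y(1-x-y)$. It has a family of periodic orbits $\Gamma_h=\{(x,y): H(x,y)=h\}$, $h\in(0,\frac1{64})$ (the closed ovals lying inside the triangle with vertices $(0,0),(1,0),(0,1)$ and surrounding the center $(\frac12,\frac14)$). The line $y=\frac12-\frac12x$ divides $\Gamma_h$ into the upper arc $\Gamma_h^+=\Gamma_h\cap\{y\ge\frac12-\frac12x\}$ and the lower arc $\Gamma_h^-=\Gamma_h\cap\{y<\frac12-\frac12x\}$. The arcs are oriented by the flow of the unperturbed system (counterclockwise). $[\cdot]$ denotes the integer part. The number of zeros of a function means the number of its isolated zeros. *)

theory Defs
  imports "HOL-Analysis.Analysis"
begin

section \<open>The piecewise perturbed system\<close>

definition poly2 :: "nat \<Rightarrow> (nat \<Rightarrow> nat \<Rightarrow> real) \<Rightarrow> real \<Rightarrow> real \<Rightarrow> real" where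
  "poly2 n c x y = (\<Sum>i\<le>n. \<Sum>j\<le>n - i. c i j * x ^ i * y ^ j)"

text \<open>The functions \<open>f\<close> and \<open>g\<close> perturb the first and the second component;
  \<open>p\<close> and \<open>m\<close> stand for plus (on and above the switching line) and minus (below it).\<close>

definition perturbed_field ::
  "real \<Rightarrow> (real \<Rightarrow> real \<Rightarrow> real) \<Rightarrow> (real \<Rightarrow> real \<Rightarrow> real) \<Rightarrow>
   (real \<Rightarrow> real \<Rightarrow> real) \<Rightarrow> (real \<Rightarrow> real \<Rightarrow> real) \<Rightarrow> real \<times> real \<Rightarrow> real \<times> real" where
  "perturbed_field \<epsilon> fp gp fm gm = (\<lambda>(x, y).
     if y \<ge> 1/2 - 1/2 * x
     then (x^2 * (1 - x - 2*y) + \<epsilon> * fp x y, x * y * (-2 + 3*x + 2*y) + \<epsilon> * gp x y)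
     else (x^2 * (1 - x - 2*y) + \<epsilon> * fm x y, x * y * (-2 + 3*x + 2*y) + \<epsilon> * gm x y))"


section \<open>Periodic orbits of the unperturbed system\<close>

definition H :: "real \<Rightarrow> real \<Rightarrow> real" where
  "H x y = x^2 * y * (1 - x - y)"

text \<open>The full level set of \<open>H\<close> also has unbounded branches outside the triangle, whereas inside
  the open triangle it is, for \<open>0 < h < 1/64\<close>, exactly one closed oval around \<open>(1/2, 1/4)\<close>.\<close>

definition oval :: "real \<Rightarrow> (real \<times> real) set" where
  "oval h = {(x, y). x > 0 \<and> y > 0 \<and> x + y < 1 \<and> H x y = h}"

definition upper_arc :: "real \<Rightarrow> (real \<times> real) set" where
  "upper_arc h = oval h \<inter> {(x, y). y \<ge> 1/2 - 1/2 * x}"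

definition lower_arc :: "real \<Rightarrow> (real \<times> real) set" where
  "lower_arc h = oval h \<inter> {(x, y). y < 1/2 - 1/2 * x}"


section \<open>Line integrals over arcs oriented by a vector field\<close>

text \<open>The line integral of \<open>P dx + Q dy\<close> along \<open>\<gamma>\<close>.\<close>

definition line_integral ::
  "(real \<Rightarrow> real \<Rightarrow> real) \<Rightarrow> (real \<Rightarrow> real \<Rightarrow> real) \<Rightarrow> (real \<Rightarrow> real \<times> real) \<Rightarrow> real" where
  "line_integral P Q \<gamma> = integral {0..1} (\<lambda>t.
     P (fst (\<gamma> t)) (snd (\<gamma> t)) * fst (vector_derivative \<gamma> (at t within {0..1})) +
     Q (fst (\<gamma> t)) (snd (\<gamma> t)) * snd (vector_derivative \<gamma> (at t within {0..1})))"

text \<open>An injective piecewise C1 parametrization of the arc \<open>A\<close> whose velocity points in the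
  direction of the field \<open>V\<close>. The closure adds the end points that are missing from the half-open
  lower arc.\<close>

definition flow_parametrization ::
  "(real \<times> real \<Rightarrow> real \<times> real) \<Rightarrow> (real \<times> real) set \<Rightarrow> (real \<Rightarrow> real \<times> real) \<Rightarrow> bool" where
  "flow_parametrization V A \<gamma> \<longleftrightarrow>
     valid_path \<gamma> \<and> arc \<gamma> \<and> path_image \<gamma> = closure A \<and>
     (\<forall>t\<in>{0<..<1}. \<gamma> differentiable at t \<longrightarrow>
        (\<exists>c\<ge>0. vector_derivative \<gamma> (at t) = c *\<^sub>R V (\<gamma> t)))"

text \<open>The line integral does not depend on the chosen parametrization. For the arcs of the oval,
  with \<open>V\<close> the unperturbed field, a parametrization exists: with \<open>r = sqrt (1/4 - 2 * sqrt h)\<close> take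
  \<open>x = 1/2 + r * cos \<theta>\<close> and
  \<open>y = (1 - x)/2 + r * sin \<theta> * sqrt (x * (1 - x) + 2 * sqrt h) / (2 * x)\<close>,
  where \<open>\<theta>\<close> runs from \<open>0\<close> to \<open>pi\<close> on the upper and from \<open>pi\<close> to \<open>2 * pi\<close> on the lower arc.\<close>

definition arc_integral ::
  "(real \<times> real \<Rightarrow> real \<times> real) \<Rightarrow> (real \<Rightarrow> real \<Rightarrow> real) \<Rightarrow> (real \<Rightarrow> real \<Rightarrow> real) \<Rightarrow>
   (real \<times> real) set \<Rightarrow> real" where
  "arc_integral V P Q A = line_integral P Q (SOME \<gamma>. flow_parametrization V A \<gamma>)"

definition melnikov ::
  "(real \<Rightarrow> real \<Rightarrow> real) \<Rightarrow> (real \<Rightarrow> real \<Rightarrow> real) \<Rightarrow>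
   (real \<Rightarrow> real \<Rightarrow> real) \<Rightarrow> (real \<Rightarrow> real \<Rightarrow> real) \<Rightarrow> real \<Rightarrow> real" where
  "melnikov fp gp fm gm h =
     arc_integral (perturbed_field 0 fp gp fm gm) gp (\<lambda>x y. - fp x y) (upper_arc h) +
     arc_integral (perturbed_field 0 fp gp fm gm) gm (\<lambda>x y. - fm x y) (lower_arc h)"


section \<open>Counting isolated zeros with multiplicity\<close>

definition isolated_zeros :: "(real \<Rightarrow> real) \<Rightarrow> real set \<Rightarrow> real set" where
  "isolated_zeros f S = {x. x isolated_in {x \<in> S. f x = 0}}"

text \<open>The order of the first non-vanishing derivative; it is \<open>\<infinity>\<close> if all derivatives vanish.\<close>

definition zero_multiplicity :: "(real \<Rightarrow> real) \<Rightarrow> real \<Rightarrow> enat" where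
  "zero_multiplicity f x = (INF k\<in>{k. (deriv ^^ k) f x \<noteq> 0}. enat k)"

end

theory Submission
  imports Defs
begin

text \<open>Solving \<open>H(x, y) = h\<close> for \<open>y\<close> gives \<open>y = (1 - x)/2 \<plusminus> u\<close> with \<open>u\<^sup>2 = (1 - x)\<^sup>2/4 - h/x\<^sup>2\<close>, and
  integrating the terms with \<open>du\<close> by parts turns \<open>I(h)\<close> into a combination of the integrals of
  \<open>x\<^sup>i u\<^sup>j\<close>, \<open>i + j \<le> n\<close>, over an interval symmetric about \<open>1/2\<close>. Put \<open>a = 8 * sqrt h\<close>,
  \<open>\<sigma> = a/(4 x (1 - x))\<close>, \<open>N = n div 2\<close> and \<open>D = 2 N + 1\<close>. Symmetrizing in \<open>x\<close> and \<open>1 - x\<close> leaves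
  the Mellin convolutions \<open>Mf (m + 1) 0 0 (j + 1)\<close>, \<open>m \<le> N\<close>, \<open>j \<le> n\<close>, and recurrences with the
  operator \<open>\<theta> = a d/da\<close> express them all by the \<open>\<theta>\<^sup>i\<close>-derivatives, \<open>i \<le> D\<close>, of just two functions, one
  for even and one for odd \<open>j\<close>. Applying \<open>\<theta> (\<theta> - 2) \<dots> (\<theta> - 2 N)\<close> then leaves
  \<open>(1 - a) powr (-D/2) * E(a) + p(a) + (\<Sum>j\<le>D. c\<^sub>j X\<^sub>j(a))\<close>, where \<open>E\<close> and \<open>p\<close> are polynomials of degree
  at most \<open>D\<close> and \<open>X\<^sub>j\<close> is the integral of \<open>(t + a) powr (D/2 - j)\<close>, \<open>t = sin\<^sup>2 \<psi>\<close>, against a positive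
  weight. An operator of order \<open>3 D + 2\<close>, a composition of derivatives and multiplications by powers,
  kills the first two terms and maps the sum, up to a factor without zeros, to an integral of
  \<open>w(t) P(t) (t + a) powr -(5 D/2 + 2)\<close> with \<open>w \<ge> 0\<close> and \<open>degree P \<le> 2 D\<close>, which has at most \<open>2 D\<close>
  zeros. By Rolle's theorem \<open>I\<close> has at most \<open>(N + 1) + (3 D + 2) + 2 D = 11 N + 8\<close> zeros.\<close>

section \<open>Calculus on open sets and bounds for zeros counted with multiplicity\<close>

section \<open>Smooth functions on open sets of reals\<close>

text \<open>The variable \<open>a\<close>, proportional to \<open>sqrt h\<close>, is natural because
  the radicand under \<open>u\<close> splits into two factors linear in \<open>sqrt h\<close>. The
  obstacle is the number of integrals: there are about \<open>n\<^sup>2/2\<close> convolutions, so a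
  bound linear in \<open>n\<close> has to come from relations between them. Raising the exponent of
  \<open>1 - a/\<sigma>\<close> costs \<open>N + 1\<close> applications of \<theta>, raising that of
  \<open>1 - \<sigma>\<^sup>2\<close> at most \<open>N\<close> more, hence
  \<open>D = 2 N + 1\<close>; the latter exponent moves by whole steps, \<open>j\<close> by steps of
  2, hence one generator for each parity. The factors of the product in \<theta> strip the even
  generator down to a power of \<open>1 - a\<close> and the odd one down to a complete elliptic
  integral. The latter still has an endpoint moving with \<open>a\<close>; transport to the other
  cycle fixes the limits, so that operators in \<open>a\<close> act under the integral sign. The
  degree \<open>2 D\<close> is the same for every \<open>j\<close>: \<open>j\<close> integrations by
  parts add \<open>2 j\<close>, and \<open>D - j\<close> factors \<open>1 - t\<^sup>2\<close> are
  left over.\<close>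

primrec Ck :: "nat \<Rightarrow> real set \<Rightarrow> (real \<Rightarrow> real) \<Rightarrow> bool" where
  "Ck 0 S f \<longleftrightarrow> True"
| "Ck (Suc k) S f \<longleftrightarrow> (\<exists>f'. (\<forall>x\<in>S. (f has_real_derivative f' x) (at x)) \<and> Ck k S f')"

named_theorems smooth_intros

text \<open>Derivatives enter \<open>Ck\<close> as witnesses \<open>f'\<close>, so that
  \<open>deriv\<close> is never taken at a point where no derivative exists. On an open set the
  property is local, and values off the set are arbitrary.\<close>

definition smooth :: "real set \<Rightarrow> (real \<Rightarrow> real) \<Rightarrow> bool" where
  "smooth S f \<longleftrightarrow> (\<forall>k. Ck k S f)"

lemma DERIV_cong_open:
  fixes f g :: "real \<Rightarrow> real"
  assumes "open S" "x \<in> S" "\<And>y. y \<in> S \<Longrightarrow> f y = g y"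
  shows "(f has_real_derivative D) (at x) \<longleftrightarrow> (g has_real_derivative D) (at x)"
proof -
  have "\<forall>\<^sub>F y in nhds x. f y = g y"
    using assms eventually_nhds by blast
  then show ?thesis by (intro DERIV_cong_ev) auto
qed

lemma deriv_cong_open:
  fixes f g :: "real \<Rightarrow> real"
  assumes "open S" "x \<in> S" "\<And>y. y \<in> S \<Longrightarrow> f y = g y"
  shows "deriv f x = deriv g x"
  using DERIV_cong_open[OF assms] by (simp add: deriv_def)

lemma higher_deriv_cong_open:
  fixes f g :: "real \<Rightarrow> real"
  assumes "open S" "\<And>y. y \<in> S \<Longrightarrow> f y = g y" "x \<in> S"
  shows "(deriv ^^ k) f x = (deriv ^^ k) g x"
  using assms(3)
proof (induction k arbitrary: x)
  case (Suc k)
  then show ?case using deriv_cong_open[OF assms(1), of x "(deriv ^^ k) f" "(deriv ^^ k) g"] by simp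
qed (use assms in simp)

lemma Ck_cong:
  assumes "open S" "\<And>y. y \<in> S \<Longrightarrow> f y = g y"
  shows "Ck k S f \<longleftrightarrow> Ck k S g"
proof (cases k)
  case (Suc l)
  then show ?thesis using DERIV_cong_open[OF assms(1) _ assms(2)] by auto
qed simp

lemma smooth_cong:
  assumes "open S" "\<And>y. y \<in> S \<Longrightarrow> f y = g y"
  shows "smooth S f \<longleftrightarrow> smooth S g"
  using Ck_cong[OF assms] by (simp add: smooth_def)

lemma smooth_has_deriv:
  assumes "smooth S f" "x \<in> S"
  shows "(f has_real_derivative deriv f x) (at x)"
proof -
  have "Ck 1 S f" using assms by (simp add: smooth_def)
  then obtain f' where "(f has_real_derivative f' x) (at x)" using assms by auto
  then show ?thesis using DERIV_imp_deriv by fastforce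
qed

lemma smooth_deriv:
  assumes "open S" "smooth S f"
  shows "smooth S (deriv f)"
  unfolding smooth_def
proof
  fix k
  have "Ck (Suc k) S f" using assms by (simp only: smooth_def)
  then obtain f' where f': "\<forall>x\<in>S. (f has_real_derivative f' x) (at x)" "Ck k S f'" by auto
  have "Ck k S (deriv f) \<longleftrightarrow> Ck k S f'"
    using assms(1) f'(1) by (intro Ck_cong) (auto simp: DERIV_imp_deriv)
  then show "Ck k S (deriv f)" using f' by simp
qed

lemma smooth_higher_deriv:
  assumes "open S" "smooth S f"
  shows "smooth S ((deriv ^^ k) f)"
  by (induction k) (use assms smooth_deriv in auto)

lemma smooth_derivI:
  assumes "\<And>x. x \<in> S \<Longrightarrow> (f has_real_derivative g x) (at x)" "smooth S g"
  shows "smooth S f"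
  unfolding smooth_def
proof
  fix k show "Ck k S f"
    by (cases k) (use assms in \<open>auto simp: smooth_def\<close>)
qed

lemma Ck_Suc_imp: "Ck (Suc k) S f \<Longrightarrow> Ck k S f"
proof (induction k arbitrary: f)
  case (Suc k)
  then show ?case by (metis Ck.simps(2))
qed simp

lemma smooth_subset: "smooth T f \<Longrightarrow> S \<subseteq> T \<Longrightarrow> smooth S f"
proof -
  have "Ck k T f \<Longrightarrow> S \<subseteq> T \<Longrightarrow> Ck k S f" for k
  proof (induction k arbitrary: f)
    case (Suc k)
    then obtain f' where "\<forall>x\<in>T. (f has_real_derivative f' x) (at x)" "Ck k T f'" by auto
    then have "\<forall>x\<in>S. (f has_real_derivative f' x) (at x)" "Ck k S f'" using Suc by auto
    then show ?case by auto
  qed simp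
  then show "smooth T f \<Longrightarrow> S \<subseteq> T \<Longrightarrow> smooth S f" by (simp add: smooth_def)
qed

lemma smooth_continuous_on: "smooth S f \<Longrightarrow> continuous_on S f"
  by (meson DERIV_continuous_on DERIV_subset smooth_has_deriv top_greatest)

lemma smooth_const [smooth_intros]: "smooth S (\<lambda>x. c)"
proof -
  have "Ck k S (\<lambda>x. c)" for k
    by (induction k arbitrary: c) (auto intro!: exI[of _ "\<lambda>x. 0"])
  then show ?thesis by (simp add: smooth_def)
qed

lemma smooth_ident [smooth_intros]: "smooth S (\<lambda>x. x)"
  by (rule smooth_derivI[where g = "\<lambda>x. 1"]) (auto intro: smooth_intros)

lemma Ck_add:
  "Ck k S f \<Longrightarrow> Ck k S g \<Longrightarrow> Ck k S (\<lambda>x. f x + g x)"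
proof (induction k arbitrary: f g)
  case (Suc k)
  then obtain f' g' where "\<forall>x\<in>S. (f has_real_derivative f' x) (at x)" "Ck k S f'"
    "\<forall>x\<in>S. (g has_real_derivative g' x) (at x)" "Ck k S g'" by auto
  then show ?case using Suc.IH[of f' g']
    by (auto intro!: exI[of _ "\<lambda>x. f' x + g' x"] derivative_eq_intros)
qed simp

lemma smooth_add [smooth_intros]:
  "smooth S f \<Longrightarrow> smooth S g \<Longrightarrow> smooth S (\<lambda>x. f x + g x)"
  using Ck_add by (simp add: smooth_def)

lemma Ck_mult:
  "Ck k S f \<Longrightarrow> Ck k S g \<Longrightarrow> Ck k S (\<lambda>x. f x * g x)"
proof (induction k arbitrary: f g)
  case (Suc k)
  then obtain f' g' where *: "\<forall>x\<in>S. (f has_real_derivative f' x) (at x)" "Ck k S f'"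
    "\<forall>x\<in>S. (g has_real_derivative g' x) (at x)" "Ck k S g'" by auto
  have "Ck k S f" "Ck k S g" using Suc.prems Ck_Suc_imp by blast+
  then have "Ck k S (\<lambda>x. f' x * g x + g' x * f x)"
    using * Suc.IH Ck_add by presburger
  then show ?case using *
    by (auto intro!: exI[of _ "\<lambda>x. f' x * g x + g' x * f x"] DERIV_mult)
qed simp

lemma smooth_mult [smooth_intros]:
  "smooth S f \<Longrightarrow> smooth S g \<Longrightarrow> smooth S (\<lambda>x. f x * g x)"
  using Ck_mult by (simp add: smooth_def)

lemma smooth_cmult [smooth_intros]: "smooth S f \<Longrightarrow> smooth S (\<lambda>x. c * f x)"
  by (intro smooth_mult smooth_const)

lemma smooth_minus [smooth_intros]: "smooth S f \<Longrightarrow> smooth S (\<lambda>x. - f x)"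
  using smooth_cmult[of S f "-1"] by simp

lemma smooth_diff [smooth_intros]:
  "smooth S f \<Longrightarrow> smooth S g \<Longrightarrow> smooth S (\<lambda>x. f x - g x)"
  using smooth_add[of S f "\<lambda>x. - g x"] smooth_minus by auto

lemma smooth_sum [smooth_intros]:
  "(\<And>i. i \<in> A \<Longrightarrow> smooth S (f i)) \<Longrightarrow> smooth S (\<lambda>x. \<Sum>i\<in>A. f i x)"
  by (induction A rule: infinite_finite_induct) (auto intro: smooth_intros)

lemma smooth_power [smooth_intros]: "smooth S f \<Longrightarrow> smooth S (\<lambda>x. f x ^ n)"
  by (induction n) (auto intro: smooth_intros)

lemma smooth_poly [smooth_intros]: "smooth S (\<lambda>x. poly p x)"
  unfolding poly_altdef by (intro smooth_sum smooth_mult smooth_power smooth_const smooth_ident)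

lemma smooth_compose:
  assumes "smooth S f" "smooth T g" "\<And>x. x \<in> S \<Longrightarrow> f x \<in> T"
  shows "smooth S (\<lambda>x. g (f x))"
proof -
  have "Ck k S (\<lambda>x. g (f x))" if "Ck k T g" for k
    using that
  proof (induction k arbitrary: g)
    case (Suc k)
    then obtain g' where g': "\<forall>x\<in>T. (g has_real_derivative g' x) (at x)" "Ck k T g'" by auto
    have "Ck (Suc k) S f" using assms by (simp only: smooth_def)
    then obtain f' where f': "\<forall>x\<in>S. (f has_real_derivative f' x) (at x)" "Ck k S f'" by auto
    have "\<forall>x\<in>S. ((\<lambda>x. g (f x)) has_real_derivative g' (f x) * f' x) (at x)"
      using g' f' assms(3) by (intro ballI DERIV_chain2) auto
    then show ?case using Ck_mult[OF Suc.IH[OF g'(2)] f'(2)] by auto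
  qed simp
  then show ?thesis using assms by (simp add: smooth_def)
qed

lemma smooth_powr: "smooth {0<..} (\<lambda>x. x powr c)"
proof -
  have "Ck k {0<..} (\<lambda>x. x powr c)" for k
  proof (induction k arbitrary: c)
    case (Suc k)
    have "Ck k {0<..} (\<lambda>x. c * x powr (c - 1))"
      using smooth_const[of "{0<..}" c, unfolded smooth_def] by (intro Ck_mult Suc) blast
    then show ?case
      by (auto intro!: exI[of _ "\<lambda>x. c * x powr (c - 1)"] derivative_eq_intros)
  qed simp
  then show ?thesis by (simp add: smooth_def)
qed

lemma smooth_powr' [smooth_intros]:
  "smooth S f \<Longrightarrow> (\<And>x. x \<in> S \<Longrightarrow> f x > 0) \<Longrightarrow> smooth S (\<lambda>x. f x powr c)"
  by (rule smooth_compose[OF _ smooth_powr]) auto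

section \<open>Multiplicities and Rolle's theorem\<close>

text \<open>Only a lower bound \<open>m\<close> for the multiplicity: it is stable under sums,
  products and substitutions, and it makes sense at zeros of infinite order.\<close>

definition vanish :: "(real \<Rightarrow> real) \<Rightarrow> real \<Rightarrow> nat \<Rightarrow> bool" where
  "vanish f z m \<longleftrightarrow> (\<forall>i<m. (deriv ^^ i) f z = 0)"

lemma vanish_0 [simp]: "vanish f z 0"
  by (simp add: vanish_def)

lemma vanish_Suc: "vanish f z (Suc m) \<longleftrightarrow> f z = 0 \<and> vanish (deriv f) z m"
  unfolding vanish_def All_less_Suc2 by (simp add: funpow_Suc_right del: funpow.simps)

lemma vanish_mono: "vanish f z m \<Longrightarrow> k \<le> m \<Longrightarrow> vanish f z k"
  by (auto simp: vanish_def)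

lemma vanish_cong:
  assumes "open S" "\<And>y. y \<in> S \<Longrightarrow> f y = g y" "z \<in> S"
  shows "vanish f z m \<longleftrightarrow> vanish g z m"
  using higher_deriv_cong_open[OF assms] by (simp add: vanish_def)

lemma vanish_add:
  assumes "open S" "z \<in> S" "smooth S f" "smooth S g" "vanish f z m" "vanish g z m"
  shows "vanish (\<lambda>x. f x + g x) z m"
  using assms(3-)
proof (induction m arbitrary: f g)
  case (Suc m)
  have "vanish (\<lambda>x. deriv f x + deriv g x) z m"
    using Suc smooth_deriv[OF assms(1)] by (auto simp: vanish_Suc)
  moreover have "deriv (\<lambda>x. f x + g x) x = deriv f x + deriv g x" if "x \<in> S" for x
    using that Suc.prems smooth_has_deriv by (intro DERIV_imp_deriv DERIV_add) auto
  ultimately have "vanish (deriv (\<lambda>x. f x + g x)) z m"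
    by (subst vanish_cong[OF assms(1) _ assms(2)]) auto
  then show ?case using Suc.prems by (auto simp: vanish_Suc)
qed simp

lemma vanish_mult:
  assumes "open S" "z \<in> S" "smooth S f" "smooth S g" "vanish f z m"
  shows "vanish (\<lambda>x. g x * f x) z m"
  using assms(3-)
proof (induction m arbitrary: f g)
  case (Suc m)
  have "vanish (\<lambda>x. deriv g x * f x + g x * deriv f x) z m"
    using Suc smooth_deriv[OF assms(1)] vanish_mono[OF Suc.prems(3), of m]
    by (intro vanish_add[OF assms(1,2)] smooth_mult) (auto simp: vanish_Suc)
  moreover have "deriv (\<lambda>x. g x * f x) x = deriv g x * f x + g x * deriv f x" if "x \<in> S" for x
    using that Suc.prems smooth_has_deriv DERIV_mult[of g "deriv g x" x UNIV f "deriv f x"]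
    by (intro DERIV_imp_deriv) (auto simp: algebra_simps)
  ultimately have "vanish (deriv (\<lambda>x. g x * f x)) z m"
    by (subst vanish_cong[OF assms(1) _ assms(2)]) auto
  then show ?case using Suc.prems by (auto simp: vanish_Suc)
qed simp

lemma vanish_compose:
  assumes "open S" "z \<in> S" "smooth S g" "\<And>x. x \<in> S \<Longrightarrow> g x \<in> T" "open T" "smooth T f"
    and "vanish f (g z) m"
  shows "vanish (\<lambda>x. f (g x)) z m"
  using assms(6-)
proof (induction m arbitrary: f)
  case (Suc m)
  have "vanish (\<lambda>x. deriv g x * deriv f (g x)) z m"
    using Suc smooth_deriv assms(1-5) smooth_compose[of S g T "deriv f"]
    by (intro vanish_mult[OF assms(1,2)]) (auto simp: vanish_Suc)
  moreover have "deriv (\<lambda>x. f (g x)) x = deriv g x * deriv f (g x)" if "x \<in> S" for x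
    using that Suc.prems smooth_has_deriv assms 
      DERIV_chain2[of f "deriv f (g x)" g x "deriv g x" UNIV]
    by (intro DERIV_imp_deriv) (auto simp: algebra_simps)
  ultimately have "vanish (deriv (\<lambda>x. f (g x))) z m"
    by (subst vanish_cong[OF assms(1) _ assms(2)]) auto
  then show ?case using Suc.prems by (auto simp: vanish_Suc)
qed simp

definition zeros_le :: "real set \<Rightarrow> (real \<Rightarrow> real) \<Rightarrow> nat \<Rightarrow> bool" where
  "zeros_le S f k \<longleftrightarrow> (\<forall>x\<in>S. f x = 0) \<or>
     (\<forall>Z m. finite Z \<longrightarrow> Z \<subseteq> S \<longrightarrow> (\<forall>z\<in>Z. vanish f z (m z)) \<longrightarrow> sum m Z \<le> k)"

lemma zeros_le_mono: "zeros_le S f k \<Longrightarrow> k \<le> l \<Longrightarrow> zeros_le S f l"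
  unfolding zeros_le_def by (meson le_trans)

lemma zeros_le_cong:
  assumes "open S" "\<And>x. x \<in> S \<Longrightarrow> f x = g x"
  shows "zeros_le S f k \<longleftrightarrow> zeros_le S g k"
proof -
  have *: "zeros_le S g k" if "zeros_le S f k" "\<And>x. x \<in> S \<Longrightarrow> f x = g x" for f g
  proof (cases "\<forall>x\<in>S. f x = 0")
    case False
    have "sum m Z \<le> k" if Z: "finite Z" "Z \<subseteq> S" "\<forall>z\<in>Z. vanish g z (m z)" for Z m
    proof -
      have "vanish f z (m z)" if "z \<in> Z" for z
        using vanish_cong[OF assms(1), of f g z "m z"] that Z \<open>\<And>x. x \<in> S \<Longrightarrow> f x = g x\<close> by auto
      then show ?thesis using Z \<open>zeros_le S f k\<close> False unfolding zeros_le_def by blast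
    qed
    then show ?thesis unfolding zeros_le_def by blast
  qed (use that in \<open>simp add: zeros_le_def\<close>)
  show ?thesis using *[of f g] *[of g f] assms(2) by auto
qed

text \<open>Multiplication by \<open>g\<close> can only raise the order of vanishing, and as
  \<open>g\<close> has no zeros, the product vanishes identically only if \<open>f\<close>
  does.\<close>

lemma zeros_le_mult:
  assumes "open S" "smooth S f" "smooth S g" "\<And>x. x \<in> S \<Longrightarrow> g x \<noteq> 0"
    and "zeros_le S (\<lambda>x. g x * f x) k"
  shows "zeros_le S f k"
proof (cases "\<forall>x\<in>S. f x = 0")
  case False
  then have "\<not> (\<forall>x\<in>S. g x * f x = 0)" using assms(4) by auto
  then have *: "finite Z \<Longrightarrow> Z \<subseteq> S \<Longrightarrow> (\<forall>z\<in>Z. vanish (\<lambda>x. g x * f x) z (m z)) \<Longrightarrow> sum m Z \<le> k" for Z m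
    using assms(5) unfolding zeros_le_def by blast
  show ?thesis unfolding zeros_le_def
    using * vanish_mult[OF assms(1) _ assms(2,3)] by (meson subset_iff)
qed (simp add: zeros_le_def)

text \<open>The clause that each point of \<open>X\<close> lies to the left of a point of
  \<open>Z\<close> serves the induction, which adds a new maximum \<open>b\<close>: it keeps the old
  Rolle points below \<open>Max A\<close>, apart from the new one between \<open>Max A\<close> and
  \<open>b\<close>.\<close>

lemma Rolle_finite:
  fixes f :: "real \<Rightarrow> real"
  assumes "finite Z" "Z \<subseteq> S" "convex S" "\<And>z. z \<in> Z \<Longrightarrow> f z = 0"
    "\<And>x. x \<in> S \<Longrightarrow> (f has_real_derivative f' x) (at x)"
  shows "\<exists>X. finite X \<and> X \<subseteq> S \<and> X \<inter> Z = {} \<and> (\<forall>x\<in>X. f' x = 0 \<and> (\<exists>z\<in>Z. x < z)) \<and> card Z \<le> Suc (card X)"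
  using assms(1,2,4)
proof (induction Z rule: finite_linorder_max_induct)
  case empty
  show ?case by (rule exI[of _ "{}"]) simp
next
  case (insert b A)
  then obtain X where X: "finite X" "X \<subseteq> S" "X \<inter> A = {}" "\<forall>x\<in>X. f' x = 0 \<and> (\<exists>z\<in>A. x < z)"
    "card A \<le> Suc (card X)" using insert.IH insert.prems by (metis insert_iff subset_iff)
  show ?case
  proof (cases "A = {}")
    case True
    then show ?thesis by (intro exI[of _ "{}"] conjI) simp_all
  next
    case False
    define c where "c = Max A"
    have c: "c \<in> A" "c < b" using insert.hyps False by (auto simp: c_def)
    have sub: "{c..b} \<subseteq> S"
    proof -
      have "closed_segment c b \<subseteq> S"
        using c insert.prems assms(3) by (intro closed_segment_subset) auto
      then show ?thesis using c by (simp add: closed_segment_eq_real_ivl)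
    qed
    obtain w where w: "c < w" "w < b" "f' w = 0"
    proof -
      have "\<exists>w. c < w \<and> w < b \<and> f b - f c = (b - c) * f' w"
        using c(2) sub assms(5) by (intro MVT2) (auto simp: subset_iff)
      moreover have "f b = 0" "f c = 0" using c(1) insert.prems(2) by simp_all
      ultimately obtain w where "c < w" "w < b" "0 = (b - c) * f' w" by auto
      then show ?thesis using that[of w] c(2) by simp
    qed
    have lt: "x < c" if "x \<in> X" for x
    proof -
      obtain z where "z \<in> A" "x < z" using X(4) \<open>x \<in> X\<close> by blast
      then show ?thesis using Max_ge[OF insert.hyps(1), of z] by (simp add: c_def)
    qed
    have le: "x \<le> c" if "x \<in> A" for x using that insert.hyps(1) by (simp add: c_def)
    show ?thesis
    proof (intro exI[of _ "insert w X"] conjI ballI)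
      show "insert w X \<inter> insert b A = {}" 
      proof -
        have "w \<notin> A" "w \<noteq> b" "b \<notin> X" using w c le[of w] lt[of b] by auto
        then show ?thesis using X(3) by blast
      qed
      have "w \<notin> X" using lt[of w] w by auto
      moreover have "b \<notin> A" using c le[of b] by auto
      ultimately show "card (insert b A) \<le> Suc (card (insert w X))"
        using X(1,5) insert.hyps(1) by simp
    next
      fix x assume "x \<in> insert w X"
      then show "\<exists>z\<in>insert b A. x < z" "f' x = 0" using w X(4) by blast+
    next
      have "w \<in> S" using w sub by auto
      then show "insert w X \<subseteq> S" using X by blast
    qed (use X(1) in simp)
  qed
qed

text \<open>Each zero of \<open>f\<close> loses one from its multiplicity, and Rolle's theorem
  returns one new zero for each gap between neighbours, so the total drops by at most one.\<close>

lemma zeros_le_deriv: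
  assumes "open S" "convex S" "smooth S f" "zeros_le S (deriv f) k"
  shows "zeros_le S f (Suc k)"
proof (cases "\<forall>x\<in>S. deriv f x = 0")
  \<comment> \<open>The bound \<open>k\<close> carries no information here, but then
    \<open>f\<close> is constant on the convex set: it vanishes identically or has no zeros.\<close>
  case True
  have "(f has_real_derivative 0) (at x within S)" if "x \<in> S" for x
    using smooth_has_deriv[OF assms(3) that] True that has_field_derivative_at_within by auto
  then have "\<exists>c. \<forall>x\<in>S. f x = c"
    by (rule has_field_derivative_zero_constant[OF assms(2)])
  then obtain c where c: "\<And>x. x \<in> S \<Longrightarrow> f x = c" by blast
  show ?thesis
  proof (cases "c = 0")
    case False
    have "sum m Z \<le> Suc k" if "Z \<subseteq> S" "\<forall>z\<in>Z. vanish f z (m z)" for Z m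
    proof -
      have "m z = 0" if "z \<in> Z" for z
      proof (rule ccontr)
        assume "m z \<noteq> 0"
        then have "vanish f z (Suc 0)"
          using \<open>\<forall>z\<in>Z. vanish f z (m z)\<close> that vanish_mono[of f z "m z" 1] by auto
        then show False using c[of z] False \<open>Z \<subseteq> S\<close> that by (auto simp: vanish_Suc)
      qed
      then show ?thesis by simp
    qed
    then show ?thesis unfolding zeros_le_def by blast
  qed (use c in \<open>simp add: zeros_le_def\<close>)
next
  case False
  then have *: "finite Z \<Longrightarrow> Z \<subseteq> S \<Longrightarrow> (\<forall>z\<in>Z. vanish (deriv f) z (m z)) \<Longrightarrow> sum m Z \<le> k" for Z m
    using assms(4) unfolding zeros_le_def by blast
  have "sum m Z \<le> Suc k" if Z: "finite Z" "Z \<subseteq> S" "\<forall>z\<in>Z. vanish f z (m z)" for Z m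
  proof -
    define Y where "Y = {z\<in>Z. m z > 0}"
    have Y: "finite Y" "Y \<subseteq> S" using Z by (auto simp: Y_def)
    have "f z = 0" if "z \<in> Y" for z
      using that Z(3) vanish_mono[of f z "m z" 1] by (auto simp: Y_def vanish_Suc)
    then obtain X where X: "finite X" "X \<subseteq> S" "X \<inter> Y = {}" "\<forall>x\<in>X. deriv f x = 0" "card Y \<le> Suc (card X)"
      using Rolle_finite[OF Y assms(2), of f "deriv f"] smooth_has_deriv[OF assms(3)] by blast
    \<comment> \<open>Points of \<open>Y\<close> keep their reduced multiplicity; a Rolle point
      counts once and is distinct from them because \<open>X \<inter> Y = {}\<close>.\<close>
    define m' where "m' z = (if z \<in> Y then m z - 1 else 1)" for z
    have "vanish (deriv f) z (m' z)" if "z \<in> X \<union> Y" for z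
    proof (cases "z \<in> Y")
      case True
      then have "vanish f z (Suc (m z - 1))" using Z(3) by (auto simp: Y_def)
      then show ?thesis using True by (simp add: m'_def vanish_Suc)
    next
      case False
      then show ?thesis using that X(4) by (auto simp: m'_def vanish_def)
    qed
    then have "sum m' (X \<union> Y) \<le> k" using * X Y by simp
    moreover have "sum m' (X \<union> Y) = card X + sum m' Y"
    proof -
      have "sum m' X = (\<Sum>z\<in>X. 1)" using X(3) by (intro sum.cong) (auto simp: m'_def)
      then show ?thesis using X Y by (simp add: sum.union_disjoint)
    qed
    moreover have "sum m Y = sum m' Y + card Y"
    proof -
      have "sum m Y = (\<Sum>z\<in>Y. m' z + 1)" by (intro sum.cong) (auto simp: m'_def Y_def)
      then show ?thesis by (simp add: sum_Suc)
    qed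
    moreover have "sum m Z = sum m Y"
      unfolding Y_def using Z(1) by (intro sum.mono_neutral_right) auto
    ultimately show ?thesis using X(5) by linarith
  qed
  then show ?thesis unfolding zeros_le_def by blast
qed

lemma zeros_le_higher_deriv:
  assumes "open S" "convex S" "smooth S f" "zeros_le S ((deriv ^^ d) f) k"
  shows "zeros_le S f (k + d)"
  using assms(3,4)
proof (induction d arbitrary: f)
  case (Suc d)
  have "zeros_le S (deriv f) (k + d)"
    using Suc smooth_deriv[OF assms(1)] by (simp add: funpow_Suc_right del: funpow.simps)
  then show ?case using zeros_le_deriv assms Suc.prems by simp
qed simp

lemma zeros_le_nonzero:
  assumes "\<And>x. x \<in> S \<Longrightarrow> f x \<noteq> 0"
  shows "zeros_le S f k"
proof -
  have "sum m Z \<le> k" if "Z \<subseteq> S" "\<forall>z\<in>Z. vanish f z (m z)" for Z m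
  proof -
    have "m z = 0" if "z \<in> Z" for z
    proof (rule ccontr)
      assume "m z \<noteq> 0"
      then have "vanish f z (Suc 0)"
        using \<open>\<forall>z\<in>Z. vanish f z (m z)\<close> that vanish_mono[of f z "m z" 1] by auto
      then show False using assms[of z] \<open>Z \<subseteq> S\<close> that by (auto simp: vanish_Suc)
    qed
    then show ?thesis by simp
  qed
  then show ?thesis unfolding zeros_le_def by blast
qed

text \<open>For the change of variable between \<open>h\<close> and \<open>a\<close>: zeros pulled
  back along the bijection \<open>g\<close> vanish to at least the same order.\<close>

lemma zeros_le_compose:
  assumes "open S" "smooth S g" "g ` S = T" "inj_on g S" "open T" "smooth T f"
    and "zeros_le S (\<lambda>x. f (g x)) k"
  shows "zeros_le T f k"
proof (cases "\<forall>x\<in>T. f x = 0")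
  case False
  then have "\<not> (\<forall>x\<in>S. f (g x) = 0)" using assms(3) by auto
  then have *: "finite Z \<Longrightarrow> Z \<subseteq> S \<Longrightarrow> (\<forall>z\<in>Z. vanish (\<lambda>x. f (g x)) z (m z)) \<Longrightarrow> sum m Z \<le> k" for Z m
    using assms(7) unfolding zeros_le_def by blast
  have "sum m Z \<le> k" if Z: "finite Z" "Z \<subseteq> T" "\<forall>z\<in>Z. vanish f z (m z)" for Z m
  proof -
    define Y where "Y = the_inv_into S g ` Z"
    have inv: "the_inv_into S g z \<in> S" "g (the_inv_into S g z) = z" if "z \<in> Z" for z
      using that Z(2) assms(3,4) the_inv_into_into[of g S z S] f_the_inv_into_f[of g S z] by auto
    have Y: "finite Y" "Y \<subseteq> S" using Z inv by (auto simp: Y_def)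
    have gY: "g ` Y = Z" using inv by (force simp: Y_def)
    have "vanish (\<lambda>x. f (g x)) y (m (g y))" if "y \<in> Y" for y
      using that Y gY Z(3) assms by (intro vanish_compose[of S y g T f]) auto
    then have "sum (\<lambda>y. m (g y)) Y \<le> k" using * Y by simp
    moreover have "sum (\<lambda>y. m (g y)) Y = sum m Z"
      using sum.reindex[of g Y m] inj_on_subset[OF assms(4) Y(2)] gY by simp
    ultimately show ?thesis by simp
  qed
  then show ?thesis unfolding zeros_le_def by blast
qed (simp add: zeros_le_def)

text \<open>The link to the count in the theorem: if \<open>f\<close> is not identically zero, then
  \<open>k + 1\<close> zeros, or a single zero at which all derivatives vanish, would already exceed
  the bound \<open>k\<close>.\<close>

lemma zero_multiplicity_bound:
  assumes "open S" "zeros_le S f k"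
  shows "finite (isolated_zeros f S) \<and> (\<Sum>x\<in>isolated_zeros f S. zero_multiplicity f x) \<le> enat k"
proof (cases "\<forall>x\<in>S. f x = 0")
  case True
  have "isolated_zeros f S = {}"
  proof -
    have "\<not> x isolated_in {x \<in> S. f x = 0}" for x
    proof
      assume "x isolated_in {x \<in> S. f x = 0}"
      then obtain T where T: "open T" "T \<inter> {x \<in> S. f x = 0} = {x}" unfolding isolated_in_def by blast
      have "T \<inter> {x \<in> S. f x = 0} = T \<inter> S" using True by auto
      then have "open {x}" using T assms(1) by (metis open_Int)
      then show False using not_open_singleton by blast
    qed
    then show ?thesis by (simp add: isolated_zeros_def)
  qed
  then show ?thesis by (simp add: zero_enat_def)
next
  case False
  then have *: "finite Z \<Longrightarrow> Z \<subseteq> S \<Longrightarrow> (\<forall>z\<in>Z. vanish f z (m z)) \<Longrightarrow> sum m Z \<le> k" for Z m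
    using assms(2) unfolding zeros_le_def by blast
  let ?Z = "isolated_zeros f S"
  have Z: "x \<in> S" "f x = 0" if "x \<in> ?Z" for x using that by (auto simp: isolated_zeros_def isolated_in_def)
  have fin: "finite ?Z"
  proof (rule ccontr)
    assume "infinite ?Z"
    then obtain Y where Y: "Y \<subseteq> ?Z" "finite Y" "card Y = Suc k" using infinite_arbitrarily_large by blast
    then have "sum (\<lambda>_. 1::nat) Y \<le> k" using Z by (intro *) (auto simp: vanish_def)
    then show False using Y by simp
  qed
  have ex: "\<exists>i. (deriv ^^ i) f x \<noteq> 0" if "x \<in> ?Z" for x
  proof (rule ccontr)
    assume "\<nexists>i. (deriv ^^ i) f x \<noteq> 0"
    then have "sum (\<lambda>_. Suc k) {x} \<le> k" using Z that by (intro *) (auto simp: vanish_def)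
    then show False by simp
  qed
  define m where "m x = (LEAST i. (deriv ^^ i) f x \<noteq> 0)" for x
  have "zero_multiplicity f x = enat (m x)" if "x \<in> ?Z" for x
  proof -
    have "(deriv ^^ m x) f x \<noteq> 0" unfolding m_def using ex[OF that] LeastI_ex by fast
    then have "(INF k\<in>{k. (deriv ^^ k) f x \<noteq> 0}. enat k) = enat (m x)"
      unfolding m_def by (intro antisym INF_lower INF_greatest) (simp_all add: Least_le)
    then show ?thesis by (simp add: zero_multiplicity_def)
  qed
  then have "(\<Sum>x\<in>?Z. zero_multiplicity f x) = (\<Sum>x\<in>?Z. enat (m x))" by simp
  also have "\<dots> = enat (sum m ?Z)"
    by (induction rule: finite_induct[OF fin]) (auto simp: zero_enat_def)
  also have "sum m ?Z \<le> k"
  proof (intro *[rule_format])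
    show "vanish f z (m z)" if "z \<in> ?Z" for z
      unfolding vanish_def m_def using not_less_Least by blast
  qed (use fin Z in auto)
  finally show ?thesis using fin by simp
qed

section \<open>Differential operators and integrals of powers of \<open>t + a\<close>\<close>

section \<open>Falling factorials and derivatives of powers\<close>

definition ff :: "real \<Rightarrow> nat \<Rightarrow> real" where
  "ff z k = (\<Prod>i<k. z - real i)"

lemma ff_0 [simp]: "ff z 0 = 1"
  by (simp add: ff_def)

lemma ff_Suc: "ff z (Suc k) = ff z k * (z - real k)"
  by (simp add: ff_def)

lemma ff_add: "ff z (k + l) = ff z k * ff (z - real k) l"
  by (induction l) (simp_all add: ff_Suc algebra_simps)

lemma higher_deriv_Suc_cong:
  fixes f g :: "real \<Rightarrow> real"
  assumes "open S" "\<And>x. x \<in> S \<Longrightarrow> (deriv ^^ k) f x = g x" "a \<in> S"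
  shows "(deriv ^^ Suc k) f a = deriv g a"
  using deriv_cong_open[OF assms(1,3), of "(deriv ^^ k) f" g] assms(2) by simp

lemma powr_step: "x > 0 \<Longrightarrow> x powr y = x * x powr (y - 1)" for x y :: real
  by (simp add: powr_mult_base)

lemma higher_deriv_powr:
  assumes "t + a > 0"
  shows "(deriv ^^ k) (\<lambda>x. (t + x) powr z) a = ff z k * (t + a) powr (z - real k)"
  using assms
proof (induction k arbitrary: a)
  case (Suc k)
  have "(deriv ^^ Suc k) (\<lambda>x. (t + x) powr z) a = deriv (\<lambda>a. ff z k * (t + a) powr (z - real k)) a"
    using Suc by (intro higher_deriv_Suc_cong[of "{-t<..}"]) auto
  also have "\<dots> = ff z (Suc k) * (t + a) powr (z - real (Suc k))"
    using Suc.prems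
    by (intro DERIV_imp_deriv) (auto intro!: derivative_eq_intros simp: ff_Suc algebra_simps)
  finally show ?case .
qed simp

lemma higher_deriv_linear_mult:
  assumes "open S" "smooth S g" "a \<in> S"
  shows "(deriv ^^ Suc k) (\<lambda>x. (q + v * x) * g x) a =
           (q + v * a) * (deriv ^^ Suc k) g a + real (Suc k) * v * (deriv ^^ k) g a"
  using assms(3)
proof (induction k arbitrary: a)
  case 0
  then show ?case using smooth_has_deriv[OF assms(2)]
    by (auto intro!: DERIV_imp_deriv derivative_eq_intros)
next
  case (Suc k)
  note sm = smooth_has_deriv[OF smooth_higher_deriv[OF assms(1,2)] Suc.prems]
  have "(deriv ^^ Suc (Suc k)) (\<lambda>x. (q + v * x) * g x) a =
        deriv (\<lambda>a. (q + v * a) * (deriv ^^ Suc k) g a + real (Suc k) * v * (deriv ^^ k) g a) a"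
    by (rule higher_deriv_Suc_cong[OF assms(1) Suc.IH Suc.prems])
  also have "\<dots> = (q + v * a) * (deriv ^^ Suc (Suc k)) g a + real (Suc (Suc k)) * v * (deriv ^^ Suc k) g a"
    using sm[of k] sm[of "Suc k"]
    by (intro DERIV_imp_deriv) (auto intro!: derivative_eq_intros simp: algebra_simps)
  finally show ?case .
qed

text \<open>The weights are those for which derivatives of order \<open>K\<close> are covariant under Moebius
  transformations (Bol's lemma), which is why only one term survives.\<close>

lemma higher_deriv_powr_mult_powr:
  assumes "open S" "\<And>x. x \<in> S \<Longrightarrow> p + u * x > 0" "\<And>x. x \<in> S \<Longrightarrow> q + v * x > 0"
    and "b + c = real K - 1" "a \<in> S"
  shows "(deriv ^^ K) (\<lambda>x. (p + u * x) powr b * (q + v * x) powr c) a =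
           ff b K * (u * q - v * p) ^ K * ((p + u * a) powr (b - real K) * (q + v * a) powr (c - real K))"
  using assms(4,5)
proof (induction K arbitrary: a c)
  case (Suc K)
  define g where "g x = (p + u * x) powr b * (q + v * x) powr (c - 1)" for x
  define C where "C = ff b K * (u * q - v * p) ^ K"
  have sm: "smooth S g" unfolding g_def using assms(2,3) by (intro smooth_intros) auto
  have IH: "(deriv ^^ K) g x = C * ((p + u * x) powr (b - real K) * (q + v * x) powr (c - real (Suc K)))"
    if "x \<in> S" for x
    using Suc.IH[of "c - 1" x] Suc.prems(1) that by (simp add: g_def[abs_def] C_def algebra_simps)
  let ?X = "p + u * a" and ?Y = "q + v * a"
  have pos: "?X > 0" "?Y > 0" using assms(2,3) Suc.prems(2) by auto
  have "(deriv ^^ Suc K) g a = deriv (\<lambda>x. C * ((p + u * x) powr (b - real K) * (q + v * x) powr (c - real (Suc K)))) a"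
    by (rule higher_deriv_Suc_cong[OF assms(1) IH Suc.prems(2)])
  also have "\<dots> = C * ((b - real K) * u * ?X powr (b - real K - 1) * ?Y powr (c - real (Suc K)) +
      (c - real (Suc K)) * v * ?X powr (b - real K) * ?Y powr (c - real (Suc K) - 1))"
    using pos by (intro DERIV_imp_deriv) (auto intro!: derivative_eq_intros simp: algebra_simps)
  also have "\<dots> = C * (((b - real K) * u * ?Y + (c - real (Suc K)) * v * ?X) *
      (?X powr (b - real (Suc K)) * ?Y powr (c - real (Suc K) - 1)))"
  proof -
    have "?X powr (b - real K) = ?X * ?X powr (b - real (Suc K))"
      "?Y powr (c - real (Suc K)) = ?Y * ?Y powr (c - real (Suc K) - 1)"
      using powr_step[OF pos(1), of "b - real K"] powr_step[OF pos(2), of "c - real (Suc K)"]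
      by (simp_all add: diff_diff_eq add.commute)
    moreover have "b - real K - 1 = b - real (Suc K)" by simp
    ultimately show ?thesis by (simp only: ) (simp add: algebra_simps)
  qed
  finally have d1: "(deriv ^^ Suc K) g a = C * (((b - real K) * u * ?Y + (c - real (Suc K)) * v * ?X) *
      (?X powr (b - real (Suc K)) * ?Y powr (c - real (Suc K) - 1)))" .
  \<comment> \<open>Splitting off one linear factor puts \<open>g\<close> under the induction
    hypothesis, with \<open>c - 1\<close> in place of \<open>c\<close>, and leaves only two terms in
    Leibniz' rule.\<close>
  have "(deriv ^^ Suc K) (\<lambda>x. (p + u * x) powr b * (q + v * x) powr c) a =
        (deriv ^^ Suc K) (\<lambda>x. (q + v * x) * g x) a"
  proof (rule higher_deriv_cong_open[OF assms(1) _ Suc.prems(2)])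
    fix x assume "x \<in> S"
    then have "(q + v * x) powr c = (q + v * x) * (q + v * x) powr (c - 1)"
      using assms(3)[of x] by (simp add: powr_mult_base)
    then show "(p + u * x) powr b * (q + v * x) powr c = (q + v * x) * g x"
      by (simp only: g_def mult_ac)
  qed
  also have "\<dots> = ?Y * (deriv ^^ Suc K) g a + real (Suc K) * v * (deriv ^^ K) g a"
    by (rule higher_deriv_linear_mult[OF assms(1) sm Suc.prems(2)])
  also have "(deriv ^^ K) g a = C * (?X * ?Y * (?X powr (b - real (Suc K)) * ?Y powr (c - real (Suc K) - 1)))"
  proof -
    have "?X powr (b - real K) = ?X * ?X powr (b - real (Suc K))"
      "?Y powr (c - real (Suc K)) = ?Y * ?Y powr (c - real (Suc K) - 1)"
      using powr_step[OF pos(1), of "b - real K"] powr_step[OF pos(2), of "c - real (Suc K)"]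
      by (simp_all add: diff_diff_eq add.commute)
    then show ?thesis using IH[OF Suc.prems(2)] by simp
  qed
  also have "?Y * (deriv ^^ Suc K) g a + real (Suc K) * v *
        (C * (?X * ?Y * (?X powr (b - real (Suc K)) * ?Y powr (c - real (Suc K) - 1)))) =
      C * ((b - real K) * u * ?Y + c * v * ?X) *
      (?X powr (b - real (Suc K)) * (?Y * ?Y powr (c - real (Suc K) - 1)))"
    unfolding d1 by (simp add: algebra_simps)
  \<comment> \<open>The weight condition now reads \<open>b + c = K\<close>; it cancels the terms in
    \<open>a\<close> and leaves the determinant \<open>u * q - v * p\<close>.\<close>
  also have "(b - real K) * u * ?Y + c * v * ?X = (b - real K) * (u * q - v * p)"
  proof -
    have "c = - (b - real K)" using Suc.prems(1) by simp
    then show ?thesis by (simp only:) (simp add: algebra_simps)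
  qed
  also have "?Y * ?Y powr (c - real (Suc K) - 1) = ?Y powr (c - real (Suc K))"
    by (rule powr_step[symmetric]) (rule pos)
  finally show ?case by (simp add: C_def ff_Suc mult_ac)
qed simp

text \<open>A derivative lowers the exponent by one; the linear factor set free in this way makes up
  for the degree lost by differentiating the polynomial, so \<open>d\<close> stays the same for all
  \<open>K\<close>.\<close>

lemma higher_deriv_powr_mult_poly:
  assumes "open S" "\<And>x. x \<in> S \<Longrightarrow> p + u * x > 0" "degree P \<le> d"
  shows "\<exists>Q. degree Q \<le> d \<and> (\<forall>a\<in>S. (deriv ^^ K) (\<lambda>x. (p + u * x) powr b * poly P x) a =
           (p + u * a) powr (b - real K) * poly Q a)"
proof (induction K)
  case 0
  then show ?case using assms by auto
next
  case (Suc K)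
  then obtain Q where Q: "degree Q \<le> d" "\<And>a. a \<in> S \<Longrightarrow> (deriv ^^ K) (\<lambda>x. (p + u * x) powr b * poly P x) a =
           (p + u * a) powr (b - real K) * poly Q a" by auto
  define R where "R = smult ((b - real K) * u) Q + [:p, u:] * pderiv Q"
  have "(deriv ^^ Suc K) (\<lambda>x. (p + u * x) powr b * poly P x) a =
           (p + u * a) powr (b - real (Suc K)) * poly R a" if a: "a \<in> S" for a
  proof -
    have pos: "p + u * a > 0" using assms(2) a by simp
    have "(deriv ^^ Suc K) (\<lambda>x. (p + u * x) powr b * poly P x) a =
          deriv (\<lambda>a. (p + u * a) powr (b - real K) * poly Q a) a"
      by (rule higher_deriv_Suc_cong[OF assms(1) Q(2) a])
    also have "\<dots> = (b - real K) * u * (p + u * a) powr (b - real K - 1) * poly Q a +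
        (p + u * a) powr (b - real K) * poly (pderiv Q) a"
      using pos by (intro DERIV_imp_deriv) (auto intro!: derivative_eq_intros simp: algebra_simps)
    also have "(p + u * a) powr (b - real K) = (p + u * a) * (p + u * a) powr (b - real (Suc K))"
      using pos by (simp add: powr_mult_base)
    also have "b - real K - 1 = b - real (Suc K)" by simp
    finally show ?thesis by (simp add: R_def algebra_simps)
  qed
  moreover have "degree R \<le> d"
  proof -
    have "degree ([:p, u:] * pderiv Q) \<le> d"
    proof (cases "pderiv Q = 0")
      case False
      then have "degree Q \<noteq> 0" using pderiv_eq_0_iff by blast
      have "degree ([:p, u:] * pderiv Q) \<le> degree [:p, u:] + degree (pderiv Q)" by (rule degree_mult_le)
      also have "\<dots> \<le> 1 + (degree Q - 1)" by (intro add_mono) (simp_all add: degree_pderiv)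
      finally show ?thesis using \<open>degree Q \<noteq> 0\<close> Q(1) by simp
    qed simp
    then show ?thesis unfolding R_def using Q(1) degree_smult_le[of _ Q]
      by (intro degree_add_le) (auto intro: le_trans)
  qed
  ultimately show ?case by blast
qed

lemma higher_deriv_poly: "(deriv ^^ k) (poly P) = poly ((pderiv ^^ k) P)"
  for P :: "real poly"
proof (induction k)
  case (Suc k)
  have "deriv (poly Q) = poly (pderiv Q)" for Q :: "real poly"
    by (rule ext) (intro DERIV_imp_deriv poly_DERIV)
  then show ?case by (simp add: Suc)
qed simp

lemma higher_deriv_poly_eq_0:
  fixes P :: "real poly"
  assumes "degree P < k"
  shows "(deriv ^^ k) (poly P) x = 0"
proof -
  have "degree P < k \<Longrightarrow> (pderiv ^^ k) P = 0" for k and P :: "real poly"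
  proof (induction k arbitrary: P)
    case (Suc k)
    show ?case
    proof (cases "degree P = 0")
      case True
      then have "pderiv P = 0" by (simp add: pderiv_eq_0_iff)
      then show ?thesis by (simp add: funpow_Suc_right higher_pderiv_0 del: funpow.simps)
    next
      case False
      then show ?thesis using Suc by (simp add: funpow_Suc_right degree_pderiv del: funpow.simps)
    qed
  qed simp
  then show ?thesis using assms by (simp add: higher_deriv_poly)
qed

section \<open>Linear differential operators\<close>

text \<open>A linear operator of finite order with coefficients smooth on \<open>S\<close>. The
  formula is demanded on every open \<open>T \<subseteq> S\<close> because operators will be applied
  to \<open>(t + x) powr z\<close> with \<open>t < 0\<close>, which is smooth only on a part of
  \<open>S\<close>.\<close>

definition diff_op :: "real set \<Rightarrow> ((real \<Rightarrow> real) \<Rightarrow> real \<Rightarrow> real) \<Rightarrow> bool" where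
  "diff_op S L \<longleftrightarrow> (\<exists>R w. (\<forall>i. smooth S (w i)) \<and>
     (\<forall>T f a. open T \<longrightarrow> T \<subseteq> S \<longrightarrow> smooth T f \<longrightarrow> a \<in> T \<longrightarrow>
        L f a = (\<Sum>i\<le>R. w i a * (deriv ^^ i) f a)))"

lemma diff_op_ident: "diff_op S (\<lambda>f. f)"
  unfolding diff_op_def
  by (rule exI[of _ 0], rule exI[of _ "\<lambda>i x. 1"]) (simp add: smooth_const)

lemma diff_op_mult:
  assumes "diff_op S L" "smooth S g"
  shows "diff_op S (\<lambda>f x. g x * L f x)"
proof -
  obtain R w where w: "\<And>i. smooth S (w i)"
    and L: "\<And>T f a. open T \<Longrightarrow> T \<subseteq> S \<Longrightarrow> smooth T f \<Longrightarrow> a \<in> T \<Longrightarrow>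
        L f a = (\<Sum>i\<le>R. w i a * (deriv ^^ i) f a)"
    using assms(1) unfolding diff_op_def by blast
  show ?thesis unfolding diff_op_def
    by (rule exI[of _ R], rule exI[of _ "\<lambda>i x. g x * w i x"])
       (auto simp: L sum_distrib_left mult.assoc intro!: smooth_mult assms w sum.cong)
qed

lemma diff_op_deriv:
  assumes "open S" "diff_op S L"
  shows "diff_op S (\<lambda>f. deriv (L f))"
proof -
  obtain R w where w: "\<And>i. smooth S (w i)"
    and L: "\<And>T f a. open T \<Longrightarrow> T \<subseteq> S \<Longrightarrow> smooth T f \<Longrightarrow> a \<in> T \<Longrightarrow>
        L f a = (\<Sum>i\<le>R. w i a * (deriv ^^ i) f a)"
    using assms(2) unfolding diff_op_def by blast
  define w' where "w' i x = (if i \<le> R then deriv (w i) x else 0) + (if i = 0 then 0 else w (i - 1) x)" for i x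
  have "deriv (L f) a = (\<Sum>i\<le>Suc R. w' i a * (deriv ^^ i) f a)"
    if T: "open T" "T \<subseteq> S" "smooth T f" "a \<in> T" for T f a
  proof -
    have "deriv (L f) a = deriv (\<lambda>a. \<Sum>i\<le>R. w i a * (deriv ^^ i) f a) a"
      using T L by (intro deriv_cong_open[of T]) auto
    also have "\<dots> = (\<Sum>i\<le>R. deriv (w i) a * (deriv ^^ i) f a + deriv ((deriv ^^ i) f) a * w i a)"
      using T smooth_has_deriv[OF w] smooth_has_deriv[OF smooth_higher_deriv[OF T(1,3)]]
      by (intro DERIV_imp_deriv DERIV_sum DERIV_mult) auto
    also have "\<dots> = (\<Sum>i\<le>R. deriv (w i) a * (deriv ^^ i) f a) + (\<Sum>i\<le>R. w i a * (deriv ^^ Suc i) f a)"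
      by (simp add: sum.distrib mult.commute)
    also have "(\<Sum>i\<le>R. w i a * (deriv ^^ Suc i) f a) =
        (\<Sum>i\<le>Suc R. (if i = 0 then 0 else w (i - 1) a) * (deriv ^^ i) f a)"
      by (subst sum.atMost_Suc_shift) simp
    also have "(\<Sum>i\<le>R. deriv (w i) a * (deriv ^^ i) f a) =
        (\<Sum>i\<le>Suc R. (if i \<le> R then deriv (w i) a else 0) * (deriv ^^ i) f a)"
      by simp
    finally show ?thesis by (simp only: w'_def sum.distrib distrib_right)
  qed
  moreover have "smooth S (w' i)" for i
    unfolding w'_def using w smooth_deriv[OF assms(1)]
    by (cases "i \<le> R"; cases i) (auto intro!: smooth_add simp: smooth_const)
  ultimately show ?thesis unfolding diff_op_def by blast
qed

lemma diff_op_higher_deriv: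
  assumes "open S" "diff_op S L"
  shows "diff_op S (\<lambda>f. (deriv ^^ k) (L f))"
  by (induction k) (use assms diff_op_deriv in auto)

lemma diff_op_smooth:
  assumes "open S" "diff_op S L" "smooth S f"
  shows "smooth S (L f)"
proof -
  obtain R w where w: "\<And>i. smooth S (w i)"
    and L: "\<And>T f a. open T \<Longrightarrow> T \<subseteq> S \<Longrightarrow> smooth T f \<Longrightarrow> a \<in> T \<Longrightarrow>
        L f a = (\<Sum>i\<le>R. w i a * (deriv ^^ i) f a)"
    using assms(2) unfolding diff_op_def by blast
  have "smooth S (\<lambda>a. \<Sum>i\<le>R. w i a * (deriv ^^ i) f a)"
    by (intro smooth_sum smooth_mult w smooth_higher_deriv assms)
  then show ?thesis
    by (subst smooth_cong[OF assms(1)]) (use L[OF assms(1) order_refl assms(3)] in auto)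
qed

lemma diff_op_cong:
  assumes "open S" "diff_op S L" "smooth S f" "\<And>x. x \<in> S \<Longrightarrow> f x = g x" "a \<in> S"
  shows "L f a = L g a"
proof -
  obtain R w where L: "\<And>T f a. open T \<Longrightarrow> T \<subseteq> S \<Longrightarrow> smooth T f \<Longrightarrow> a \<in> T \<Longrightarrow>
        L f a = (\<Sum>i\<le>R. w i a * (deriv ^^ i) f a)"
    using assms(2) unfolding diff_op_def by blast
  have "smooth S g" using assms(3) smooth_cong[OF assms(1), of f g] assms(4) by simp
  then show ?thesis
    using L[OF assms(1) order_refl _ assms(5)] assms(3) higher_deriv_cong_open[OF assms(1,4,5)] by simp
qed

lemma higher_deriv_add:
  assumes "open S" "smooth S f" "smooth S g" "x \<in> S"
  shows "(deriv ^^ k) (\<lambda>x. f x + g x) x = (deriv ^^ k) f x + (deriv ^^ k) g x"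
  using assms(4)
proof (induction k arbitrary: x)
  case (Suc k)
  have "(deriv ^^ Suc k) (\<lambda>x. f x + g x) x = deriv (\<lambda>x. (deriv ^^ k) f x + (deriv ^^ k) g x) x"
    by (rule higher_deriv_Suc_cong[OF assms(1) Suc.IH Suc.prems])
  then show ?case
    using smooth_has_deriv[OF smooth_higher_deriv[OF assms(1)] Suc.prems] assms(2,3)
    by (auto intro!: DERIV_imp_deriv DERIV_add)
qed simp

lemma higher_deriv_cmult:
  assumes "open S" "smooth S f" "x \<in> S"
  shows "(deriv ^^ k) (\<lambda>x. c * f x) x = c * (deriv ^^ k) f x"
  using assms(3)
proof (induction k arbitrary: x)
  case (Suc k)
  have "(deriv ^^ Suc k) (\<lambda>x. c * f x) x = deriv (\<lambda>x. c * (deriv ^^ k) f x) x"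
    by (rule higher_deriv_Suc_cong[OF assms(1) Suc.IH Suc.prems])
  then show ?case
    using smooth_has_deriv[OF smooth_higher_deriv[OF assms(1)] Suc.prems] assms(2)
    by (auto intro!: DERIV_imp_deriv DERIV_cmult)
qed simp

lemma diff_op_add:
  assumes "open S" "diff_op S L" "smooth S f" "smooth S g" "a \<in> S"
  shows "L (\<lambda>x. f x + g x) a = L f a + L g a"
proof -
  obtain R w where L: "\<And>T f a. open T \<Longrightarrow> T \<subseteq> S \<Longrightarrow> smooth T f \<Longrightarrow> a \<in> T \<Longrightarrow>
        L f a = (\<Sum>i\<le>R. w i a * (deriv ^^ i) f a)"
    using assms(2) unfolding diff_op_def by blast
  note L' = L[OF assms(1) order_refl _ assms(5)]
  show ?thesis
    using assms L' smooth_add[OF assms(3,4)]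
    by (simp add: higher_deriv_add[OF assms(1,3,4,5)] distrib_left sum.distrib)
qed

lemma diff_op_cmult:
  assumes "open S" "diff_op S L" "smooth S f" "a \<in> S"
  shows "L (\<lambda>x. c * f x) a = c * L f a"
proof -
  obtain R w where L: "\<And>T f a. open T \<Longrightarrow> T \<subseteq> S \<Longrightarrow> smooth T f \<Longrightarrow> a \<in> T \<Longrightarrow>
        L f a = (\<Sum>i\<le>R. w i a * (deriv ^^ i) f a)"
    using assms(2) unfolding diff_op_def by blast
  note L' = L[OF assms(1) order_refl _ assms(4)]
  show ?thesis
    using assms L' smooth_cmult[OF assms(3)]
    by (simp add: higher_deriv_cmult[OF assms(1,3,4)] sum_distrib_left mult_ac)
qed

lemma diff_op_sum:
  assumes "open S" "diff_op S L" "\<And>i. i \<in> A \<Longrightarrow> smooth S (f i)" "a \<in> S" "finite A"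
  shows "L (\<lambda>x. \<Sum>i\<in>A. f i x) a = (\<Sum>i\<in>A. L (f i) a)"
  using assms(5,3)
proof (induction A)
  case empty
  then show ?case using diff_op_cmult[OF assms(1,2) smooth_const[of S 0] assms(4), of 0] by simp
next
  case (insert i A)
  then show ?case using diff_op_add[OF assms(1,2) _ _ assms(4), of "f i" "\<lambda>x. \<Sum>i\<in>A. f i x"]
    by (simp add: smooth_sum)
qed

section \<open>Integrals of a kernel with a power singularity\<close>

text \<open>An integral in \<open>t = sin\<^sup>2 \<psi>\<close>: the measure is
  \<open>dt / (2 * sqrt (t * (1 - t)))\<close>, and the angle removes its endpoint
  singularities.\<close>

definition kint :: "(real \<Rightarrow> real) \<Rightarrow> real \<Rightarrow> real \<Rightarrow> real" where
  "kint w z a = integral {0..pi/2} (\<lambda>\<psi>. w \<psi> * (sin \<psi> ^ 2 + a) powr z)"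

lemma sin2_pos: "a > 0 \<Longrightarrow> sin \<psi> ^ 2 + a > (0::real)"
  by (simp add: add_nonneg_pos)

lemma kint_has_deriv:
  assumes w: "continuous_on {0..pi/2} w" and a: "a > 0"
  shows "(kint w z has_real_derivative z * kint w (z - 1) a) (at a)"
proof -
  have "((\<lambda>x. integral (cbox 0 (pi/2)) (\<lambda>\<psi>. w \<psi> * (sin \<psi> ^ 2 + x) powr z)) has_field_derivative
     integral (cbox 0 (pi/2)) (\<lambda>\<psi>. w \<psi> * (z * (sin \<psi> ^ 2 + a) powr (z - 1)))) (at a within {0<..})"
  proof (rule leibniz_rule_field_derivative[where fx = "\<lambda>a \<psi>. w \<psi> * (z * (sin \<psi> ^ 2 + a) powr (z - 1))"])
    show "((\<lambda>x. w \<psi> * (sin \<psi> ^ 2 + x) powr z) has_field_derivative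
        w \<psi> * (z * (sin \<psi> ^ 2 + x) powr (z - 1))) (at x within {0<..})" if "x \<in> {0<..}" for x \<psi>
      using that sin2_pos[of x \<psi>] by (auto intro!: derivative_eq_intros)
    show "(\<lambda>\<psi>. w \<psi> * (sin \<psi> ^ 2 + x) powr z) integrable_on cbox 0 (pi/2)" if "x \<in> {0<..}" for x
      using that sin2_pos[of x] w
      by (intro integrable_continuous) (auto intro!: continuous_intros simp: less_imp_neq[symmetric])
    have w': "continuous_on ({0<..} \<times> {0..pi/2}) (\<lambda>x. w (snd x))"
      by (rule continuous_on_compose2[OF w]) (auto intro: continuous_intros)
    show "continuous_on ({0<..} \<times> cbox 0 (pi/2)) (\<lambda>(x, t). w t * (z * (sin t ^ 2 + x) powr (z - 1)))"
      using sin2_pos w' unfolding split_beta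
      by (auto intro!: continuous_intros simp: less_imp_neq[symmetric])
  qed (use a in auto)
  then have "(kint w z has_field_derivative integral {0..pi/2} (\<lambda>\<psi>. w \<psi> * (z * (sin \<psi> ^ 2 + a) powr (z - 1)))) (at a)"
    using a at_within_open[of a "{0<..}"] by (simp add: kint_def[abs_def])
  also have "integral {0..pi/2} (\<lambda>\<psi>. w \<psi> * (z * (sin \<psi> ^ 2 + a) powr (z - 1))) = z * kint w (z - 1) a"
    unfolding kint_def by (simp add: mult_ac flip: integral_mult_right)
  finally show ?thesis .
qed

lemma smooth_kint:
  assumes w: "continuous_on {0..pi/2} w"
  shows "smooth {0<..} (kint w z)"
proof -
  have "Ck k {0<..} (kint w z)" for k
  proof (induction k arbitrary: z)
    case (Suc k)
    have "Ck k {0<..} (\<lambda>x. z * kint w (z - 1) x)"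
      using smooth_const[of "{0<..}" z, unfolded smooth_def] by (intro Ck_mult Suc) blast
    then show ?case using kint_has_deriv[OF w]
      by (auto intro!: exI[of _ "\<lambda>x. z * kint w (z - 1) x"])
  qed simp
  then show ?thesis by (simp add: smooth_def)
qed

lemma higher_deriv_kint:
  assumes w: "continuous_on {0..pi/2} w" and "a > 0"
  shows "(deriv ^^ k) (kint w z) a = ff z k * kint w (z - real k) a"
  using assms(2)
proof (induction k arbitrary: a)
  case (Suc k)
  have "(deriv ^^ Suc k) (kint w z) a = deriv (\<lambda>a. ff z k * kint w (z - real k) a) a"
    using Suc by (intro higher_deriv_Suc_cong[of "{0<..}"]) auto
  also have "\<dots> = ff z k * ((z - real k) * kint w (z - real k - 1) a)"
    using Suc.prems w by (intro DERIV_imp_deriv DERIV_cmult kint_has_deriv) auto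
  finally show ?case by (simp add: ff_Suc algebra_simps)
qed simp

lemma kint_integrable:
  assumes w: "continuous_on {0..pi/2} w" and a: "a > 0"
  shows "(\<lambda>\<psi>. w \<psi> * (sin \<psi> ^ 2 + a) powr z) integrable_on {0..pi/2}"
  using sin2_pos[OF a] w
  by (intro integrable_continuous_real) (auto intro!: continuous_intros simp: less_imp_neq[symmetric])

lemma diff_op_kint:
  assumes "open S" "diff_op S L" "S \<subseteq> {0<..}" "a \<in> S" and w: "continuous_on {0..pi/2} w"
  shows "L (kint w z) a = integral {0..pi/2} (\<lambda>\<psi>. w \<psi> * L (\<lambda>x. (sin \<psi> ^ 2 + x) powr z) a)"
proof -
  obtain R v where L: "\<And>T f a. open T \<Longrightarrow> T \<subseteq> S \<Longrightarrow> smooth T f \<Longrightarrow> a \<in> T \<Longrightarrow>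
        L f a = (\<Sum>i\<le>R. v i a * (deriv ^^ i) f a)"
    using assms(2) unfolding diff_op_def by blast
  note L' = L[OF assms(1) order_refl _ assms(4)]
  have a: "a > 0" using assms by auto
  have "L (kint w z) a = (\<Sum>i\<le>R. v i a * (ff z i * kint w (z - real i) a))"
    using L' smooth_subset[OF smooth_kint[OF w] assms(3)] higher_deriv_kint[OF w a] by simp
  also have "\<dots> = (\<Sum>i\<le>R. integral {0..pi/2} (\<lambda>\<psi>. v i a * ff z i * (w \<psi> * (sin \<psi> ^ 2 + a) powr (z - real i))))"
    by (simp add: kint_def mult.assoc)
  also have "\<dots> = integral {0..pi/2} (\<lambda>\<psi>. \<Sum>i\<le>R. v i a * ff z i * (w \<psi> * (sin \<psi> ^ 2 + a) powr (z - real i)))"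
    by (rule integral_sum[symmetric]) (simp, intro integrable_on_mult_right kint_integrable w a)
  also have "\<dots> = integral {0..pi/2} (\<lambda>\<psi>. w \<psi> * L (\<lambda>x. (sin \<psi> ^ 2 + x) powr z) a)"
  proof (rule integral_cong)
    fix \<psi> :: real
    have "smooth S (\<lambda>x. (sin \<psi> ^ 2 + x) powr z)"
      using assms(3) sin2_pos by (intro smooth_intros) auto
    then show "(\<Sum>i\<le>R. v i a * ff z i * (w \<psi> * (sin \<psi> ^ 2 + a) powr (z - real i))) =
        w \<psi> * L (\<lambda>x. (sin \<psi> ^ 2 + x) powr z) a"
      using L' higher_deriv_powr[OF sin2_pos[OF a]] by (simp add: sum_distrib_left mult_ac)
  qed
  finally show ?thesis .
qed

text \<open>Differentiation in \<open>a\<close> and in \<open>t\<close> act in the same way on a function of \<open>t + a\<close>.\<close>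

lemma diff_op_powr_shift:
  assumes "open S" "diff_op S L" "a \<in> S" "t + a > 0"
  shows "(deriv ^^ j) (\<lambda>t. L (\<lambda>x. (t + x) powr z) a) t = ff z j * L (\<lambda>x. (t + x) powr (z - real j)) a"
proof -
  obtain R v where L: "\<And>T f a. open T \<Longrightarrow> T \<subseteq> S \<Longrightarrow> smooth T f \<Longrightarrow> a \<in> T \<Longrightarrow>
        L f a = (\<Sum>i\<le>R. v i a * (deriv ^^ i) f a)"
    using assms(2) unfolding diff_op_def by blast
  have eq: "L (\<lambda>x. (t + x) powr z) a = (\<Sum>i\<le>R. v i a * (ff z i * (t + a) powr (z - real i)))"
    if "t + a > 0" for t z
  proof -
    have "L (\<lambda>x. (t + x) powr z) a = (\<Sum>i\<le>R. v i a * (deriv ^^ i) (\<lambda>x. (t + x) powr z) a)"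
    proof (rule L[of "S \<inter> {-t<..}"])
      show "smooth (S \<inter> {-t<..}) (\<lambda>x. (t + x) powr z)" by (intro smooth_intros) auto
    qed (use assms that in auto)
    then show ?thesis using higher_deriv_powr[OF that] by simp
  qed
  have sm: "smooth {-a<..} (\<lambda>t. (t + a) powr y)" for y by (intro smooth_intros) auto
  have hd: "(deriv ^^ j) (\<lambda>t. (t + a) powr y) t = ff y j * (t + a) powr (y - real j)" for y
    using higher_deriv_powr[of a t j y] assms(4) by (simp add: add.commute)
  have ho: "(deriv ^^ j) (\<lambda>x. f1 x + f2 x) t = (deriv ^^ j) f1 t + (deriv ^^ j) f2 t"
    if "smooth {-a<..} f1" "smooth {-a<..} f2" for f1 f2
    using that assms(4) by (intro higher_deriv_add[of "{-a<..}"]) auto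
  have hc: "(deriv ^^ j) (\<lambda>x. c * f1 x) t = c * (deriv ^^ j) f1 t"
    if "smooth {-a<..} f1" for f1 c
    using that assms(4) by (intro higher_deriv_cmult[of "{-a<..}"]) auto
  have "(deriv ^^ j) (\<lambda>t. L (\<lambda>x. (t + x) powr z) a) t =
      (deriv ^^ j) (\<lambda>t. \<Sum>i\<le>R. v i a * ff z i * (t + a) powr (z - real i)) t"
    using eq assms(4) by (intro higher_deriv_cong_open[of "{-a<..}"]) (auto simp: mult.assoc)
  also have "\<dots> = (\<Sum>i\<le>R. v i a * ff z i * (ff (z - real i) j * (t + a) powr (z - real i - real j)))"
  proof (induction R)
    case (Suc R)
    then show ?case
      by (simp add: ho[OF smooth_sum[OF smooth_cmult[OF sm]] smooth_cmult[OF sm]] hc[OF sm] hd)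
  qed (simp add: hc[OF sm] hd)
  also have "\<dots> = ff z j * (\<Sum>i\<le>R. v i a * (ff (z - real j) i * (t + a) powr (z - real j - real i)))"
  proof -
    \<comment> \<open>Both sides are \<open>ff z (i + j)\<close>: it does not matter whether the
      \<open>i\<close> derivatives in \<open>a\<close> or the \<open>j\<close> derivatives in
      \<open>t\<close> are taken first.\<close>
    have "ff z i * ff (z - real i) j = ff z j * ff (z - real j) i" for i
      by (metis add.commute ff_add)
    moreover have "z - real i - real j = z - real j - real i" for i by simp
    ultimately have "v i a * (ff z i * ff (z - real i) j) * (t + a) powr (z - real i - real j) =
        v i a * (ff z j * ff (z - real j) i) * (t + a) powr (z - real j - real i)" for i
      by (simp only:)
    then have "v i a * ff z i * (ff (z - real i) j * (t + a) powr (z - real i - real j)) =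
        ff z j * (v i a * (ff (z - real j) i * (t + a) powr (z - real j - real i)))" for i
      by (simp only: mult_ac)
    then show ?thesis unfolding sum_distrib_left by (intro sum.cong refl)
  qed
  also have "\<dots> = ff z j * L (\<lambda>x. (t + x) powr (z - real j)) a"
    using eq[OF assms(4)] by simp
  finally show ?thesis .
qed

text \<open>For a root \<open>\<alpha>\<close> of \<open>P\<close>, multiplication by \<open>(\<alpha> + a) powr -z\<close> followed by differentiation multiplies
  the integrand by \<open>t - \<alpha>\<close>, up to powers; the factor \<open>t - \<alpha>\<close> of \<open>P\<close> becomes a square and is moved into the weight.\<close>

lemma kint_zeros_le:
  assumes "continuous_on {0..pi/2} w" "\<And>\<psi>. \<psi> \<in> {0..pi/2} \<Longrightarrow> w \<psi> \<ge> 0"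
    and "finite {\<psi>\<in>{0..pi/2}. w \<psi> = 0}" "z < 0"
  shows "zeros_le {0<..} (kint (\<lambda>\<psi>. w \<psi> * poly P (sin \<psi> ^ 2)) z) (degree P)"
  using assms
proof (induction "degree P" arbitrary: P w z rule: less_induct)
  case less
  let ?k = "kint (\<lambda>\<psi>. w \<psi> * poly P (sin \<psi> ^ 2)) z"
  have cont: "continuous_on {0..pi/2} (\<lambda>\<psi>. w \<psi> * poly Q (sin \<psi> ^ 2))" for Q
    using less.prems(1) by (intro continuous_intros)
  show ?case
  proof (cases "P = 0")
    case True
    then show ?thesis by (simp add: zeros_le_def kint_def)
  next
    case P: False
    show ?thesis
    proof (cases "\<exists>\<alpha>\<in>{0..1}. poly P \<alpha> = 0")
      case True
      then obtain \<alpha> where \<alpha>: "0 \<le> \<alpha>" "\<alpha> \<le> 1" "poly P \<alpha> = 0" by auto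
      then obtain Q where Q: "P = [:-\<alpha>, 1:] * Q" using poly_eq_0_iff_dvd by blast
      have "Q \<noteq> 0" using P Q by auto
      then have deg: "degree P = Suc (degree Q)" unfolding Q by (subst degree_mult_eq) auto
      define w' where "w' \<psi> = w \<psi> * (sin \<psi> ^ 2 - \<alpha>) ^ 2" for \<psi>
      have "zeros_le {0<..} (kint (\<lambda>\<psi>. w' \<psi> * poly Q (sin \<psi> ^ 2)) (z - 1)) (degree Q)"
      proof (rule less.hyps)
        show "degree Q < degree P" using deg by simp
        show "continuous_on {0..pi/2} w'"
          unfolding w'_def using less.prems(1) by (intro continuous_intros)
        show "w' \<psi> \<ge> 0" if "\<psi> \<in> {0..pi/2}" for \<psi>
          unfolding w'_def using less.prems(2)[OF that] by simp
        \<comment> \<open>The square adds a single zero to the weight, as \<open>sin\<^sup>2\<close>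
          is injective on the interval; finitely many zeros of the weight are what the case without
          roots relies on.\<close>
        have "{\<psi>\<in>{0..pi/2}. w' \<psi> = 0} \<subseteq> {\<psi>\<in>{0..pi/2}. w \<psi> = 0} \<union> {arcsin (sqrt \<alpha>)}"
        proof -
          have "\<psi> = arcsin (sqrt \<alpha>)" if "\<psi> \<in> {0..pi/2}" "sin \<psi> ^ 2 = \<alpha>" for \<psi>
          proof -
            have "sin \<psi> \<ge> 0" using that pi_gt_zero by (intro sin_ge_zero) (auto simp: field_simps)
            then have "sqrt \<alpha> = sin \<psi>" using that(2) by (metis real_sqrt_abs abs_of_nonneg)
            then show ?thesis using that arcsin_sin[of \<psi>] pi_gt_zero by auto
          qed
          then show ?thesis by (auto simp: w'_def)
        qed
        then show "finite {\<psi>\<in>{0..pi/2}. w' \<psi> = 0}"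
          by (rule finite_subset) (use less.prems(3) in auto)
      qed (use less.prems in simp)
      also have "(\<lambda>\<psi>. w' \<psi> * poly Q (sin \<psi> ^ 2)) = (\<lambda>\<psi>. w \<psi> * poly P (sin \<psi> ^ 2) * (sin \<psi> ^ 2 - \<alpha>))"
        by (auto simp: Q w'_def power2_eq_square algebra_simps)
      finally have IH: "zeros_le {0<..} (kint (\<lambda>\<psi>. w \<psi> * poly P (sin \<psi> ^ 2) * (sin \<psi> ^ 2 - \<alpha>)) (z - 1)) (degree Q)" .
      let ?h = "kint (\<lambda>\<psi>. w \<psi> * poly P (sin \<psi> ^ 2) * (sin \<psi> ^ 2 - \<alpha>)) (z - 1)"
      let ?g = "\<lambda>x. (\<alpha> + x) powr (- z) * ?k x"
      have sm: "smooth {0<..} ?k" by (rule smooth_kint[OF cont])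
      have sma: "smooth {0<..} (\<lambda>x. (\<alpha> + x) powr y)" for y
        using \<alpha> by (intro smooth_intros) auto
      have smh: "smooth {0<..} ?h"
        using less.prems(1) by (intro smooth_kint continuous_intros)
      have d: "deriv ?g x = (- z) * (\<alpha> + x) powr (- z - 1) * ?h x" if x: "x \<in> {0<..}" for x
      proof -
        let ?k1 = "kint (\<lambda>\<psi>. w \<psi> * poly P (sin \<psi> ^ 2)) (z - 1)"
        have x0: "x > 0" using x by simp
        have ax: "\<alpha> + x > 0" using \<alpha> x by simp
        have 1: "(?g has_real_derivative (- z * (\<alpha> + x) powr (- z - 1)) * ?k x + (z * ?k1 x) * (\<alpha> + x) powr (- z)) (at x)"
          using ax x by (intro DERIV_mult kint_has_deriv[OF cont]) (auto intro!: derivative_eq_intros)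
        have 2: "(\<alpha> + x) powr (- z) = (\<alpha> + x) * (\<alpha> + x) powr (- z - 1)"
          using ax by (simp add: powr_mult_base)
        \<comment> \<open>This is \<open>t - \<alpha> = (t + x) - (\<alpha> + x)\<close> under the
          integral; the right side is the derivative of \<open>?g\<close> up to a factor without
          zeros.\<close>
        have 3: "?h x = ?k x - (\<alpha> + x) * ?k1 x"
        proof -
          have "?k x - (\<alpha> + x) * ?k1 x = integral {0..pi/2} (\<lambda>\<psi>. w \<psi> * poly P (sin \<psi> ^ 2) * (sin \<psi> ^ 2 + x) powr z
              - (\<alpha> + x) * (w \<psi> * poly P (sin \<psi> ^ 2) * (sin \<psi> ^ 2 + x) powr (z - 1)))"
            unfolding kint_def
            by (subst Henstock_Kurzweil_Integration.integral_diff)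
               (simp | intro integrable_on_mult_right kint_integrable[OF cont x0])+
          also have "\<dots> = ?h x" unfolding kint_def
          proof (rule integral_cong)
            fix \<psi> :: real
            have "(sin \<psi> ^ 2 + x) powr z = (sin \<psi> ^ 2 + x) * (sin \<psi> ^ 2 + x) powr (z - 1)"
              using sin2_pos[OF x0, of \<psi>] by (simp add: powr_mult_base)
            then show "w \<psi> * poly P (sin \<psi> ^ 2) * (sin \<psi> ^ 2 + x) powr z
                - (\<alpha> + x) * (w \<psi> * poly P (sin \<psi> ^ 2) * (sin \<psi> ^ 2 + x) powr (z - 1)) =
              w \<psi> * poly P (sin \<psi> ^ 2) * (sin \<psi> ^ 2 - \<alpha>) * (sin \<psi> ^ 2 + x) powr (z - 1)"
              by (simp only:) (simp add: algebra_simps)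
          qed
          finally show ?thesis by simp
        qed
        show ?thesis using DERIV_imp_deriv[OF 1] unfolding 2 3 by (simp only:) (simp only: algebra_simps)
      qed
      have "zeros_le {0<..} (\<lambda>x. (1 / (- z)) * (\<alpha> + x) powr (z + 1) * ((- z) * (\<alpha> + x) powr (- z - 1) * ?h x)) (degree Q)"
      proof (subst zeros_le_cong[of _ _ ?h])
        fix x :: real assume "x \<in> {0<..}"
        then have "(\<alpha> + x) powr (z + 1) * (\<alpha> + x) powr (- z - 1) = 1"
          using \<alpha> by (simp flip: powr_add)
        then show "(1 / (- z)) * (\<alpha> + x) powr (z + 1) * ((- z) * (\<alpha> + x) powr (- z - 1) * ?h x) = ?h x"
          using less.prems(4) by (simp add: mult_ac)
      qed (use IH in simp_all)
      then have "zeros_le {0<..} (\<lambda>x. (- z) * (\<alpha> + x) powr (- z - 1) * ?h x) (degree Q)"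
      proof (rule zeros_le_mult[rotated -1])
        show "smooth {0<..} (\<lambda>x. (- z) * (\<alpha> + x) powr (- z - 1) * ?h x)"
          "smooth {0<..} (\<lambda>x. (1 / (- z)) * (\<alpha> + x) powr (z + 1))"
          by (intro smooth_mult smooth_const sma smh)+
      qed (use less.prems(4) \<alpha> in auto)
      then have "zeros_le {0<..} (deriv ?g) (degree Q)"
        by (subst zeros_le_cong[OF _ d]) auto
      then have "zeros_le {0<..} ?g (Suc (degree Q))"
        by (rule zeros_le_deriv[rotated -1]) (auto intro!: smooth_mult sma sm)
      then show ?thesis unfolding deg
        by (rule zeros_le_mult[rotated -1]) (use \<alpha> in \<open>auto intro!: sma sm\<close>)
    next
      \<comment> \<open>\<open>{0..1}\<close> is the range of \<open>sin\<^sup>2\<close>. Without a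
        root there the integrand keeps one sign and has finitely many zeros, so the integral cannot
        vanish.\<close>
      case False
      have nz: "poly P t \<noteq> 0" if "t \<in> {0..1}" for t using False that by blast
      have "?k x \<noteq> 0" if "x \<in> {0<..}" for x
      proof
        assume "?k x = 0"
        have x0: "x > 0" using that by simp
        obtain s where s: "\<bar>s\<bar> = 1" "\<And>t. t \<in> {0..1} \<Longrightarrow> s * poly P t > 0"
        proof (cases "poly P 0 > 0")
          case True
          have "poly P t > 0" if "t \<in> {0..1}" for t
          proof (rule ccontr)
            assume "\<not> poly P t > 0"
            then have "\<exists>c. 0 \<le> c \<and> c \<le> t \<and> poly P c = 0"
              using True that by (intro IVT2') (auto intro: continuous_intros)
            then show False using nz that by force
          qed
          then show ?thesis using that[of 1] by simp
        next
          case F: False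
          have "poly P t < 0" if "t \<in> {0..1}" for t
          proof (rule ccontr)
            assume "\<not> poly P t < 0"
            then have "\<exists>c. 0 \<le> c \<and> c \<le> t \<and> poly P c = 0"
              using F that by (intro IVT') (auto intro: continuous_intros)
            then show False using nz that by force
          qed
          then show ?thesis using that[of "-1"] by simp
        qed
        let ?f = "\<lambda>\<psi>. s * (w \<psi> * poly P (sin \<psi> ^ 2) * (sin \<psi> ^ 2 + x) powr z)"
        have sin2: "sin \<psi> ^ 2 \<in> {0..1::real}" for \<psi> by (simp add: abs_square_le_1)
        have "continuous_on {0..pi/2} ?f"
          using cont[of P] sin2_pos[OF x0] by (auto intro!: continuous_intros simp: less_imp_neq[symmetric])
        moreover have "integral {0..pi/2} ?f = 0"
          using \<open>?k x = 0\<close> by (simp add: kint_def)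
        moreover have "?f \<psi> \<ge> 0" if "\<psi> \<in> {0..pi/2}" for \<psi>
        proof -
          have "?f \<psi> = w \<psi> * (s * poly P (sin \<psi> ^ 2)) * (sin \<psi> ^ 2 + x) powr z" by simp
          moreover have "\<dots> \<ge> 0"
            by (rule mult_nonneg_nonneg[OF mult_nonneg_nonneg[OF less.prems(2)[OF that] less_imp_le[OF s(2)[OF sin2]]] powr_ge_zero])
          ultimately show ?thesis by (simp only:)
        qed
        ultimately have z: "\<forall>\<psi>\<in>{0..pi/2}. ?f \<psi> = 0"
          using integral_eq_0_iff[of 0 "pi/2" ?f] by auto
        have "w \<psi> = 0" if "\<psi> \<in> {0..pi/2}" for \<psi>
          using bspec[OF z that] s(1) s(2)[OF sin2, of \<psi>] sin2_pos[OF x0, of \<psi>] by auto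
        then have "{\<psi>\<in>{0..pi/2}. w \<psi> = 0} = {0..pi/2}" by auto
        then show False using less.prems(3) infinite_Icc[of 0 "pi/2"] by simp
      qed
      then show ?thesis by (rule zeros_le_nonzero)
    qed
  qed
qed

section \<open>Integration by parts\<close>

text \<open>The integrand is the derivative of
  \<open>sin \<psi> * cos \<psi> * F (sin \<psi> ^ 2)\<close>, which is zero at both ends. In the
  variable \<open>t\<close> this is integration by parts against
  \<open>dt / sqrt (t * (1 - t))\<close> without boundary terms.\<close>

lemma integral_sin2_deriv_eq_0:
  assumes "open U" "{0..1} \<subseteq> U" "smooth U F"
  shows "integral {0..pi/2} (\<lambda>\<psi>. (1 - 2 * sin \<psi> ^ 2) * F (sin \<psi> ^ 2) +
           2 * sin \<psi> ^ 2 * (1 - sin \<psi> ^ 2) * deriv F (sin \<psi> ^ 2)) = 0"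
proof -
  have "((\<lambda>\<psi>. (1 - 2 * sin \<psi> ^ 2) * F (sin \<psi> ^ 2) +
           2 * sin \<psi> ^ 2 * (1 - sin \<psi> ^ 2) * deriv F (sin \<psi> ^ 2)) has_integral
        (sin (pi/2) * cos (pi/2) * F (sin (pi/2) ^ 2) - sin 0 * cos 0 * F (sin 0 ^ 2))) {0..pi/2}"
  proof (rule fundamental_theorem_of_calculus)
    fix \<psi> :: real
    have "sin \<psi> ^ 2 \<in> {0..1}" by (simp add: abs_square_le_1)
    then have "(F has_real_derivative deriv F (sin \<psi> ^ 2)) (at (sin \<psi> ^ 2))"
      using assms smooth_has_deriv by blast
    then have "((\<lambda>\<psi>. F (sin \<psi> ^ 2)) has_real_derivative deriv F (sin \<psi> ^ 2) * (2 * sin \<psi> * cos \<psi>)) (at \<psi>)"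
      by (rule DERIV_chain2) (auto intro!: derivative_eq_intros)
    then have "((\<lambda>\<psi>. sin \<psi> * cos \<psi> * F (sin \<psi> ^ 2)) has_real_derivative
        (cos \<psi> * cos \<psi> - sin \<psi> * sin \<psi>) * F (sin \<psi> ^ 2) +
        deriv F (sin \<psi> ^ 2) * (2 * sin \<psi> * cos \<psi>) * (sin \<psi> * cos \<psi>)) (at \<psi>)"
      by (intro DERIV_mult) (auto intro!: derivative_eq_intros)
    also have "(cos \<psi> * cos \<psi> - sin \<psi> * sin \<psi>) * F (sin \<psi> ^ 2) +
        deriv F (sin \<psi> ^ 2) * (2 * sin \<psi> * cos \<psi>) * (sin \<psi> * cos \<psi>) =
        (1 - 2 * sin \<psi> ^ 2) * F (sin \<psi> ^ 2) +
           2 * sin \<psi> ^ 2 * (1 - sin \<psi> ^ 2) * deriv F (sin \<psi> ^ 2)"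
    proof -
      have "cos \<psi> * cos \<psi> = 1 - sin \<psi> ^ 2" by (simp add: cos_squared_eq power2_eq_square[symmetric])
      moreover have "deriv F (sin \<psi> ^ 2) * (2 * sin \<psi> * cos \<psi>) * (sin \<psi> * cos \<psi>) =
          2 * sin \<psi> ^ 2 * (cos \<psi> * cos \<psi>) * deriv F (sin \<psi> ^ 2)"
        by (simp add: power2_eq_square)
      moreover have "sin \<psi> * sin \<psi> = sin \<psi> ^ 2" by (simp add: power2_eq_square)
      ultimately show ?thesis by (simp only:) simp
    qed
    finally show "((\<lambda>\<psi>. sin \<psi> * cos \<psi> * F (sin \<psi> ^ 2)) has_vector_derivative
        (1 - 2 * sin \<psi> ^ 2) * F (sin \<psi> ^ 2) +
           2 * sin \<psi> ^ 2 * (1 - sin \<psi> ^ 2) * deriv F (sin \<psi> ^ 2)) (at \<psi> within {0..pi/2})"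
      using has_real_derivative_iff_has_vector_derivative has_vector_derivative_at_within by blast
  qed (simp add: pi_ge_zero)
  then show ?thesis by (simp add: integral_unique)
qed

text \<open>The polynomial identity behind one integration by parts, with \<open>x\<close>,
  \<open>y\<close>, \<open>s\<close> for \<open>(1 - t ^ 2) ^ m\<close>, \<open>t ^ k\<close>,
  \<open>(1 + t) powr (-1/2)\<close> and \<open>P\<close> for the derivative of \<open>V\<close>.
  \<open>Am\<close> and \<open>Bk\<close> stand for the powers with exponents \<open>m - 1\<close>
  and \<open>k - 1\<close>; at 0 the truncated subtraction is right only after multiplication by
  \<open>m\<close> and \<open>k\<close>.\<close>

lemma integral_parts_algebra:
  fixes t m j Am y k Bk x s V P G G' :: real
  assumes "m * Am * ((1 - t) * (1 + t)) = m * x" "k * Bk * t = k * y"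
  shows "x * ((1 - t ^ 2) * G' - 2 * (m + j + 1) * t * G) * (t * y * s * V)
     - ((1 - 2 * t) * (1/2 * (x * y * ((1 + t) * s) * V * G)) + 2 * t * (1 - t) *
        (1/2 * ((((((m * Am * (- 2 * t)) * y + (k * Bk) * x) * ((1 + t) * s)
            + 1/2 * s * (x * y)) * V + P * (x * y * ((1 + t) * s))) * G
            + G' * (x * y * ((1 + t) * s) * V))))) =
     x * G * (y * s * ((- 2 * (m + j + 1) * t ^ 2 - (1/2 - t) * (1 + t)
     + 2 * m * t ^ 2 - 1/2 * t * (1 - t) - k * (1 - t ^ 2)) * V - (t - t ^ 3) * P))"
proof -
  have e: "2 * t * (1 - t) * (1/2 * ((((((m * Am * (- 2 * t)) * y + (k * Bk) * x) * ((1 + t) * s)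
            + 1/2 * s * (x * y)) * V + P * (x * y * ((1 + t) * s))) * G
            + G' * (x * y * ((1 + t) * s) * V)))) =
            (m * Am * ((1 - t) * (1 + t))) * (- 2 * t * t) * (y * s * V * G) +
            (k * Bk * t) * (1 - t) * (x * ((1 + t) * s) * V * G) +
            t * (1 - t) * ((1/2 * s) * (x * y * V * G) +
            P * (x * y * ((1 + t) * s) * G) +
            G' * (x * y * ((1 + t) * s) * V))"
    by algebra
  show ?thesis unfolding e assms by algebra
qed

text \<open>The derivatives fall on the weight without boundary terms because of the factor
  \<open>(1 - t\<^sup>2) ^ (m + j)\<close>.\<close>

lemma integral_higher_deriv_parts:
  "\<exists>V'. degree V' \<le> degree V + 2 * j \<and>
    (\<forall>U G. open U \<longrightarrow> {0..1} \<subseteq> U \<longrightarrow> U \<subseteq> {-1<..} \<longrightarrow> smooth U G \<longrightarrow>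
      integral {0..pi/2} (\<lambda>\<psi>. (deriv ^^ j) (\<lambda>t. (1 - t ^ 2) ^ (m + j) * G t) (sin \<psi> ^ 2) *
         ((sin \<psi> ^ 2) ^ (k + j) * (1 + sin \<psi> ^ 2) powr (-1/2) * poly V (sin \<psi> ^ 2))) =
      integral {0..pi/2} (\<lambda>\<psi>. (1 - (sin \<psi> ^ 2) ^ 2) ^ m * G (sin \<psi> ^ 2) *
         ((sin \<psi> ^ 2) ^ k * (1 + sin \<psi> ^ 2) powr (-1/2) * poly V' (sin \<psi> ^ 2))))"
proof (induction j arbitrary: k)
  case 0
  show ?case by (intro exI[of _ V]) simp
next
  case (Suc j)
  obtain V' where V': "degree V' \<le> degree V + 2 * j"
    "\<forall>U G. open U \<longrightarrow> {0..1} \<subseteq> U \<longrightarrow> U \<subseteq> {-1<..} \<longrightarrow> smooth U G \<longrightarrow>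
      integral {0..pi/2} (\<lambda>\<psi>. (deriv ^^ j) (\<lambda>t. (1 - t ^ 2) ^ (m + j) * G t) (sin \<psi> ^ 2) *
         ((sin \<psi> ^ 2) ^ (Suc k + j) * (1 + sin \<psi> ^ 2) powr (-1/2) * poly V (sin \<psi> ^ 2))) =
      integral {0..pi/2} (\<lambda>\<psi>. (1 - (sin \<psi> ^ 2) ^ 2) ^ m * G (sin \<psi> ^ 2) *
         ((sin \<psi> ^ 2) ^ Suc k * (1 + sin \<psi> ^ 2) powr (-1/2) * poly V' (sin \<psi> ^ 2)))"
    using Suc.IH[of "Suc k"] by (elim exE conjE) (rule that)
  \<comment> \<open>\<open>A\<close> collects what multiplies \<open>V'\<close> once the exact
    derivative built from \<open>F\<close> below is subtracted. It is quadratic, and the other term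
    has the factor \<open>t - t ^ 3\<close>, so each step adds at most 2 to the degree.\<close>
  define A where "A = [:-1/2 - real k, 0, 2 * real m + real k + 3/2 - 2 * real (m + j + 1):]"
  define W where "W = A * V' - [:0, 1, 0, -1:] * pderiv V'"
  have polyA: "poly A t = - 2 * real (m + j + 1) * t ^ 2 - (1/2 - t) * (1 + t)
     + 2 * real m * t ^ 2 - 1/2 * t * (1 - t) - real k * (1 - t ^ 2)" for t
    by (simp add: A_def power2_eq_square field_simps)
  have degW: "degree W \<le> degree V + 2 * Suc j"
  proof -
    have "degree A \<le> 2" unfolding A_def by (simp add: degree_pCons_eq_if)
    then have "degree (A * V') \<le> degree V' + 2" using degree_mult_le[of A V'] by simp
    moreover have "degree ([:0, 1, 0, -1:] * pderiv V') \<le> degree V' + 2"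
    proof (cases "pderiv V' = 0")
      case False
      then have "degree V' \<noteq> 0" using pderiv_eq_0_iff by blast
      moreover have "degree ([:0, 1, 0, -1:] * pderiv V') \<le> degree [:0, 1, 0, -1::real:] + degree (pderiv V')"
        by (rule degree_mult_le)
      ultimately show ?thesis by (simp add: degree_pderiv)
    qed simp
    ultimately have "degree W \<le> degree V' + 2" unfolding W_def by (rule degree_diff_le)
    then show ?thesis using V'(1) by simp
  qed
  have "integral {0..pi/2} (\<lambda>\<psi>. (deriv ^^ Suc j) (\<lambda>t. (1 - t ^ 2) ^ (m + Suc j) * G t) (sin \<psi> ^ 2) *
         ((sin \<psi> ^ 2) ^ (k + Suc j) * (1 + sin \<psi> ^ 2) powr (-1/2) * poly V (sin \<psi> ^ 2))) =
      integral {0..pi/2} (\<lambda>\<psi>. (1 - (sin \<psi> ^ 2) ^ 2) ^ m * G (sin \<psi> ^ 2) *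
         ((sin \<psi> ^ 2) ^ k * (1 + sin \<psi> ^ 2) powr (-1/2) * poly W (sin \<psi> ^ 2)))"
    if U: "open U" "{0..1} \<subseteq> U" "U \<subseteq> {-1<..}" "smooth U G" for U G
  proof -
    have sin2: "sin \<psi> ^ 2 \<in> U" for \<psi> :: real
      using U(2) by (auto simp: abs_square_le_1 subset_iff)
    \<comment> \<open>One of the \<open>j + 1\<close> derivatives is carried out and consumes one
      factor \<open>1 - t ^ 2\<close>; the induction hypothesis for \<open>j\<close> then applies to
      \<open>G1\<close>.\<close>
    define G1 where "G1 t = (1 - t ^ 2) * deriv G t - 2 * real (m + j + 1) * t * G t" for t
    have G1: "smooth U G1"
      unfolding G1_def using smooth_deriv[OF U(1,4)] U(4) by (intro smooth_intros)
    have d: "deriv (\<lambda>t. (1 - t ^ 2) ^ (m + Suc j) * G t) t = (1 - t ^ 2) ^ (m + j) * G1 t" if "t \<in> U" for t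
    proof -
      have "((\<lambda>t. (1 - t ^ 2) ^ (m + Suc j) * G t) has_real_derivative
         (real (m + Suc j) * (1 - t ^ 2) ^ (m + j) * (- 2 * t)) * G t + deriv G t * (1 - t ^ 2) ^ (m + Suc j)) (at t)"
      proof (intro DERIV_mult smooth_has_deriv[OF U(4) that])
        have "((\<lambda>t. 1 - t ^ 2) has_real_derivative - 2 * t) (at t)"
          by (auto intro!: derivative_eq_intros)
        from DERIV_power_Suc[OF this, of "m + j"]
        show "((\<lambda>t. (1 - t ^ 2) ^ (m + Suc j)) has_real_derivative
            real (m + Suc j) * (1 - t ^ 2) ^ (m + j) * (- 2 * t)) (at t)"
          by (simp add: mult_ac)
      qed
      then have "deriv (\<lambda>t. (1 - t ^ 2) ^ (m + Suc j) * G t) t =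
         (real (m + Suc j) * (1 - t ^ 2) ^ (m + j) * (- 2 * t)) * G t + deriv G t * (1 - t ^ 2) ^ (m + Suc j)"
        by (rule DERIV_imp_deriv)
      then show ?thesis by (simp add: G1_def algebra_simps)
    qed
    have e: "(deriv ^^ Suc j) (\<lambda>t. (1 - t ^ 2) ^ (m + Suc j) * G t) (sin \<psi> ^ 2) =
        (deriv ^^ j) (\<lambda>t. (1 - t ^ 2) ^ (m + j) * G1 t) (sin \<psi> ^ 2)" for \<psi> :: real
      unfolding funpow_Suc_right o_apply by (rule higher_deriv_cong_open[OF U(1) d sin2])
    have "integral {0..pi/2} (\<lambda>\<psi>. (deriv ^^ Suc j) (\<lambda>t. (1 - t ^ 2) ^ (m + Suc j) * G t) (sin \<psi> ^ 2) *
         ((sin \<psi> ^ 2) ^ (k + Suc j) * (1 + sin \<psi> ^ 2) powr (-1/2) * poly V (sin \<psi> ^ 2))) =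
      integral {0..pi/2} (\<lambda>\<psi>. (deriv ^^ j) (\<lambda>t. (1 - t ^ 2) ^ (m + j) * G1 t) (sin \<psi> ^ 2) *
         ((sin \<psi> ^ 2) ^ (Suc k + j) * (1 + sin \<psi> ^ 2) powr (-1/2) * poly V (sin \<psi> ^ 2)))"
      unfolding add_Suc_right add_Suc e[unfolded add_Suc_right] by (rule refl)
    also have "\<dots> = integral {0..pi/2} (\<lambda>\<psi>. (1 - (sin \<psi> ^ 2) ^ 2) ^ m * G1 (sin \<psi> ^ 2) *
         ((sin \<psi> ^ 2) ^ Suc k * (1 + sin \<psi> ^ 2) powr (-1/2) * poly V' (sin \<psi> ^ 2)))"
      using V'(2)[rule_format, OF U(1-3) G1] by this
    also have "\<dots> = integral {0..pi/2} (\<lambda>\<psi>. (1 - (sin \<psi> ^ 2) ^ 2) ^ m * G (sin \<psi> ^ 2) *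
         ((sin \<psi> ^ 2) ^ k * (1 + sin \<psi> ^ 2) powr (-1/2) * poly W (sin \<psi> ^ 2)))"
    proof -
      \<comment> \<open>Chosen so that \<open>2 * t * (1 - t) * deriv F t\<close> reproduces the
        term of the integrand that contains \<open>deriv G\<close>:
        \<open>(1 - t) * sqrt (1 + t)\<close> is \<open>(1 - t ^ 2) / sqrt (1 + t)\<close>.\<close>
      define F where "F t = 1/2 * ((1 - t ^ 2) ^ m * t ^ k * (1 + t) powr (1/2) * poly V' t * G t)" for t
      have "smooth U (\<lambda>t. 1 + t)" by (intro smooth_intros)
      then have smF: "smooth U F"
        unfolding F_def using U(3,4) by (intro smooth_intros) auto
      have key: "(1 - t ^ 2) ^ m * G1 t * (t ^ Suc k * (1 + t) powr (-1/2) * poly V' t)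
          - ((1 - 2 * t) * F t + 2 * t * (1 - t) * deriv F t) =
          (1 - t ^ 2) ^ m * G t * (t ^ k * (1 + t) powr (-1/2) * poly W t)" if t: "t \<in> {0..1}" for t
      proof -
        have tU: "t \<in> U" using t U by auto
        let ?s = "(1 + t) powr (-1/2)"
        have s: "(1 + t) powr (1/2) = (1 + t) * ?s"
          using t powr_step[of "1 + t" "1/2"] by simp
        define x where "x = (1 - t ^ 2) ^ m"
        define y where "y = t ^ k"
        define Am where "Am = (1 - t ^ 2) ^ (m - 1)"
        define Bk where "Bk = t ^ (k - 1)"
        have "((\<lambda>t. 1 - t ^ 2) has_real_derivative - 2 * t) (at t)"
          by (auto intro!: derivative_eq_intros)
        from DERIV_power[OF this, of m]
        have dA: "((\<lambda>t. (1 - t ^ 2) ^ m) has_real_derivative real m * Am * (- 2 * t)) (at t)"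
          by (simp add: mult_ac Am_def)
        have dB: "((\<lambda>t. t ^ k) has_real_derivative real k * Bk) (at t)"
          unfolding Bk_def by (auto intro!: derivative_eq_intros)
        have dC: "((\<lambda>t. (1 + t) powr (1/2)) has_real_derivative 1/2 * ?s) (at t)"
          using t by (auto intro!: derivative_eq_intros)
        have "(F has_real_derivative 1/2 * ((((((real m * Am * (- 2 * t)) * y + (real k * Bk) * x) * ((1 + t) * ?s)
            + 1/2 * ?s * (x * y)) * poly V' t + poly (pderiv V') t * (x * y * ((1 + t) * ?s))) * G t
            + deriv G t * (x * y * ((1 + t) * ?s) * poly V' t)))) (at t)"
          using DERIV_cmult[OF DERIV_mult[OF DERIV_mult[OF DERIV_mult[OF DERIV_mult[OF dA dB] dC] poly_DERIV]
              smooth_has_deriv[OF U(4) tU]], of "1/2" V']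
          unfolding F_def[symmetric] x_def[symmetric] y_def[symmetric] s by this
        note dF = DERIV_imp_deriv[OF this]
        have m1: "real m * Am * ((1 - t) * (1 + t)) = real m * x"
          unfolding x_def Am_def by (cases m) (simp_all add: algebra_simps power2_eq_square)
        have k1: "real k * Bk * t = real k * y"
          unfolding y_def Bk_def by (cases k) simp_all
        have F': "F t = 1/2 * (x * y * ((1 + t) * ?s) * poly V' t * G t)"
          by (simp only: F_def s x_def y_def)
        have W': "poly W t = poly A t * poly V' t - (t - t ^ 3) * poly (pderiv V') t"
          by (simp add: W_def algebra_simps power3_eq_cube)
        have "real (m + j + 1) = real m + real j + 1" by simp
        then show ?thesis
          using integral_parts_algebra[OF m1 k1, of "deriv G t" "real j" "G t" ?s "poly V' t" "poly (pderiv V') t"]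
          unfolding dF F' W' polyA G1_def x_def[symmetric] y_def[symmetric] power_Suc by (simp only:)
      qed
      have contF: "continuous_on {0..pi/2} (\<lambda>\<psi>. f (sin \<psi> ^ 2))" if "smooth U f" for f
        by (rule continuous_on_compose2[OF smooth_continuous_on[OF that]])
           (use sin2 in \<open>auto intro!: continuous_intros\<close>)
      have p: "1 + sin \<psi> ^ 2 \<noteq> (0::real)" for \<psi>
        using sin2_pos[of 1 \<psi>] by (simp add: add.commute)
      have i1: "(\<lambda>\<psi>. (1 - (sin \<psi> ^ 2) ^ 2) ^ m * G1 (sin \<psi> ^ 2) *
         ((sin \<psi> ^ 2) ^ Suc k * (1 + sin \<psi> ^ 2) powr (-1/2) * poly V' (sin \<psi> ^ 2))) integrable_on {0..pi/2}"
        using p by (intro integrable_continuous_real continuous_intros contF[OF G1]) auto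
      have i2: "(\<lambda>\<psi>. (1 - 2 * sin \<psi> ^ 2) * F (sin \<psi> ^ 2) +
           2 * sin \<psi> ^ 2 * (1 - sin \<psi> ^ 2) * deriv F (sin \<psi> ^ 2)) integrable_on {0..pi/2}"
        by (intro integrable_continuous_real continuous_intros contF[OF smF] contF[OF smooth_deriv[OF U(1) smF]])
      have "integral {0..pi/2} (\<lambda>\<psi>. (1 - (sin \<psi> ^ 2) ^ 2) ^ m * G1 (sin \<psi> ^ 2) *
         ((sin \<psi> ^ 2) ^ Suc k * (1 + sin \<psi> ^ 2) powr (-1/2) * poly V' (sin \<psi> ^ 2))) =
        integral {0..pi/2} (\<lambda>\<psi>. (1 - (sin \<psi> ^ 2) ^ 2) ^ m * G1 (sin \<psi> ^ 2) *
         ((sin \<psi> ^ 2) ^ Suc k * (1 + sin \<psi> ^ 2) powr (-1/2) * poly V' (sin \<psi> ^ 2)) -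
         ((1 - 2 * sin \<psi> ^ 2) * F (sin \<psi> ^ 2) +
           2 * sin \<psi> ^ 2 * (1 - sin \<psi> ^ 2) * deriv F (sin \<psi> ^ 2)))"
        unfolding Henstock_Kurzweil_Integration.integral_diff[OF i1 i2]
          integral_sin2_deriv_eq_0[OF U(1,2) smF] by (rule diff_zero[symmetric])
      also have "\<dots> = integral {0..pi/2} (\<lambda>\<psi>. (1 - (sin \<psi> ^ 2) ^ 2) ^ m * G (sin \<psi> ^ 2) *
         ((sin \<psi> ^ 2) ^ k * (1 + sin \<psi> ^ 2) powr (-1/2) * poly W (sin \<psi> ^ 2)))"
        by (intro integral_cong key) (simp add: abs_square_le_1)
      finally show ?thesis .
    qed
    finally show ?thesis .
  qed
  with degW show ?case by (intro exI[of _ W] conjI allI impI)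
qed

section \<open>Recurrences for the Mellin convolutions under \<open>a d/da\<close>\<close>

section \<open>The operator \<open>a d/da\<close>\<close>

definition theta :: "(real \<Rightarrow> real) \<Rightarrow> real \<Rightarrow> real" where
  "theta f = (\<lambda>a. a * deriv f a)"

abbreviation U01 :: "real set" where "U01 \<equiv> {0<..<1}"

lemma smooth_theta: "smooth U01 f \<Longrightarrow> smooth U01 (theta f)"
  unfolding theta_def by (intro smooth_mult smooth_ident smooth_deriv) auto

lemma smooth_theta_pow: "smooth U01 f \<Longrightarrow> smooth U01 ((theta ^^ k) f)"
  by (induction k) (auto intro: smooth_theta)

lemma theta_cong:
  assumes "\<And>x. x \<in> U01 \<Longrightarrow> f x = g x" "a \<in> U01"
  shows "theta f a = theta g a"
  using deriv_cong_open[of U01 a f g] assms by (simp add: theta_def)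

lemma theta_lincomb:
  assumes "smooth U01 f" "smooth U01 g" "a \<in> U01"
  shows "theta (\<lambda>x. \<alpha> * f x + \<beta> * g x) a = \<alpha> * theta f a + \<beta> * theta g a"
proof -
  have "deriv (\<lambda>x. \<alpha> * f x + \<beta> * g x) a = \<alpha> * deriv f a + \<beta> * deriv g a"
    using assms smooth_has_deriv by (intro DERIV_imp_deriv DERIV_add DERIV_cmult) auto
  then show ?thesis by (simp add: theta_def algebra_simps)
qed

lemma theta_sum:
  assumes "\<And>i. i \<in> A \<Longrightarrow> smooth U01 (f i)" "a \<in> U01"
  shows "theta (\<lambda>x. \<Sum>i\<in>A. c i * f i x) a = (\<Sum>i\<in>A. c i * theta (f i) a)"
proof -
  have "deriv (\<lambda>x. \<Sum>i\<in>A. c i * f i x) a = (\<Sum>i\<in>A. c i * deriv (f i) a)"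
    using assms(1) by (intro DERIV_imp_deriv DERIV_sum DERIV_cmult smooth_has_deriv[OF _ assms(2)])
  then show ?thesis by (simp add: theta_def sum_distrib_left mult_ac)
qed

lemma theta_pow_lincomb:
  assumes "smooth U01 f" "smooth U01 g" "a \<in> U01"
  shows "(theta ^^ k) (\<lambda>x. \<alpha> * f x + \<beta> * g x) a = \<alpha> * (theta ^^ k) f a + \<beta> * (theta ^^ k) g a"
  using assms(3)
proof (induction k arbitrary: a)
  case (Suc k)
  have "(theta ^^ Suc k) (\<lambda>x. \<alpha> * f x + \<beta> * g x) a =
      theta (\<lambda>x. \<alpha> * (theta ^^ k) f x + \<beta> * (theta ^^ k) g x) a"
    using theta_cong[OF Suc.IH Suc.prems] by simp
  then show ?case using theta_lincomb[OF smooth_theta_pow smooth_theta_pow Suc.prems] assms by simp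
qed simp

text \<open>The coefficients are constants, so the span is compatible with every other
  constant-coefficient operator in \<open>theta\<close>.\<close>

definition theta_span :: "nat \<Rightarrow> (real \<Rightarrow> real) \<Rightarrow> (real \<Rightarrow> real) \<Rightarrow> bool" where
  "theta_span d F f \<longleftrightarrow> (\<exists>c. \<forall>a\<in>U01. f a = (\<Sum>i\<le>d. c i * (theta ^^ i) F a))"

lemma theta_spanI:
  "(\<And>a. a \<in> U01 \<Longrightarrow> f a = (\<Sum>i\<le>d. c i * (theta ^^ i) F a)) \<Longrightarrow> theta_span d F f"
  unfolding theta_span_def by (intro exI ballI)

lemma theta_spanE:
  assumes "theta_span d F f"
  obtains c where "\<And>a. a \<in> U01 \<Longrightarrow> f a = (\<Sum>i\<le>d. c i * (theta ^^ i) F a)"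
  using assms unfolding theta_span_def by (elim exE) (rule that, rule bspec)

lemma theta_span_refl: "theta_span 0 F F"
  unfolding theta_span_def by (rule exI[of _ "\<lambda>_. 1"]) simp

lemma theta_span_mono:
  assumes "theta_span d F f" "d \<le> d'"
  shows "theta_span d' F f"
proof -
  obtain c where c: "\<And>a. a \<in> U01 \<Longrightarrow> f a = (\<Sum>i\<le>d. c i * (theta ^^ i) F a)"
    using theta_spanE[OF assms(1)] by blast
  have "(\<Sum>i\<le>d. c i * (theta ^^ i) F a) = (\<Sum>i\<le>d'. (if i \<le> d then c i else 0) * (theta ^^ i) F a)" for a
    using assms(2) by (intro sum.mono_neutral_cong_left) auto
  then show ?thesis using c by (intro theta_spanI[where c = "\<lambda>i. if i \<le> d then c i else 0"]) simp
qed

lemma theta_span_cong: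
  assumes "theta_span d F f" "\<And>a. a \<in> U01 \<Longrightarrow> g a = f a"
  shows "theta_span d F g"
proof -
  obtain c where "\<And>a. a \<in> U01 \<Longrightarrow> f a = (\<Sum>i\<le>d. c i * (theta ^^ i) F a)"
    using theta_spanE[OF assms(1)] by blast
  then show ?thesis using assms(2) by (intro theta_spanI[where c = c]) simp
qed

lemma theta_span_lincomb:
  assumes "theta_span d F f" "theta_span d F g"
  shows "theta_span d F (\<lambda>a. \<alpha> * f a + \<beta> * g a)"
proof -
  obtain c where c: "\<And>a. a \<in> U01 \<Longrightarrow> f a = (\<Sum>i\<le>d. c i * (theta ^^ i) F a)"
    using theta_spanE[OF assms(1)] by blast
  obtain c' where c': "\<And>a. a \<in> U01 \<Longrightarrow> g a = (\<Sum>i\<le>d. c' i * (theta ^^ i) F a)"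
    using theta_spanE[OF assms(2)] by blast
  show ?thesis
    by (rule theta_spanI[where c = "\<lambda>i. \<alpha> * c i + \<beta> * c' i"])
       (simp add: c c' sum_distrib_left sum.distrib algebra_simps)
qed

lemma theta_span_sum:
  assumes "\<And>i. i \<in> A \<Longrightarrow> theta_span d F (f i)"
  shows "theta_span d F (\<lambda>a. \<Sum>i\<in>A. \<alpha> i * f i a)"
  using assms
proof (induction A rule: infinite_finite_induct)
  case (insert i A)
  then show ?case using theta_span_lincomb[of d F "f i" "\<lambda>a. \<Sum>i\<in>A. \<alpha> i * f i a" "\<alpha> i" 1] by simp
qed (auto simp: theta_span_def intro!: exI[of _ "\<lambda>_. 0"])

lemma theta_span_theta:
  assumes "smooth U01 F" "theta_span d F f"
  shows "theta_span (Suc d) F (theta f)"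
proof -
  obtain c where c: "\<And>a. a \<in> U01 \<Longrightarrow> f a = (\<Sum>i\<le>d. c i * (theta ^^ i) F a)"
    using theta_spanE[OF assms(2)] by blast
  have "theta f a = (\<Sum>i\<le>Suc d. (if i = 0 then 0 else c (i - 1)) * (theta ^^ i) F a)" if "a \<in> U01" for a
  proof -
    have "theta f a = (\<Sum>i\<le>d. c i * theta ((theta ^^ i) F) a)"
      using theta_cong[OF c that] theta_sum[of "{..d}" "\<lambda>i. (theta ^^ i) F" a c, OF smooth_theta_pow[OF assms(1)] that] by simp
    also have "\<dots> = (\<Sum>i\<le>Suc d. (if i = 0 then 0 else c (i - 1)) * (theta ^^ i) F a)"
      by (subst sum.atMost_Suc_shift) simp
    finally show ?thesis .
  qed
  then show ?thesis by (rule theta_spanI)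
qed

lemma theta_span_smooth:
  assumes "smooth U01 F" "theta_span d F f"
  shows "smooth U01 f"
proof -
  obtain c where c: "\<And>a. a \<in> U01 \<Longrightarrow> f a = (\<Sum>i\<le>d. c i * (theta ^^ i) F a)"
    using theta_spanE[OF assms(2)] by blast
  have "smooth U01 (\<lambda>a. \<Sum>i\<le>d. c i * (theta ^^ i) F a)"
    by (intro smooth_sum smooth_cmult smooth_theta_pow assms)
  then show ?thesis using smooth_cong[of U01 f] c by auto
qed

lemma theta_span_trans:
  assumes "smooth U01 F" "theta_span d F G" "theta_span d' G h"
  shows "theta_span (d + d') F h"
proof -
  obtain c where c: "\<And>a. a \<in> U01 \<Longrightarrow> h a = (\<Sum>i\<le>d'. c i * (theta ^^ i) G a)"
    using theta_spanE[OF assms(3)] by blast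
  have *: "theta_span (d + i) F ((theta ^^ i) G)" for i
    by (induction i) (use assms theta_span_theta in auto)
  have "theta_span (d + d') F (\<lambda>a. \<Sum>i\<le>d'. c i * (theta ^^ i) G a)"
    by (intro theta_span_sum theta_span_mono[OF *]) auto
  then show ?thesis by (rule theta_span_cong) (use c in auto)
qed

text \<open>The last factor is \<open>theta - 2 (k - 1)\<close>, so the product needed for
  \<open>N\<close> has \<open>N + 1\<close> factors.\<close>

primrec theta_prod :: "nat \<Rightarrow> (real \<Rightarrow> real) \<Rightarrow> real \<Rightarrow> real" where
  "theta_prod 0 f = f"
| "theta_prod (Suc k) f = (\<lambda>a. theta (theta_prod k f) a - 2 * real k * theta_prod k f a)"

lemma smooth_theta_prod: "smooth U01 f \<Longrightarrow> smooth U01 (theta_prod k f)"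
  by (induction k) (auto intro!: smooth_diff smooth_cmult smooth_theta)

lemma theta_prod_cong:
  assumes "\<And>x. x \<in> U01 \<Longrightarrow> f x = g x" "a \<in> U01"
  shows "theta_prod k f a = theta_prod k g a"
  using assms(2)
proof (induction k arbitrary: a)
  case (Suc k)
  then show ?case using theta_cong[OF Suc.IH Suc.prems] by simp
qed (use assms in simp)

lemma theta_prod_lincomb:
  assumes "smooth U01 f" "smooth U01 g" "a \<in> U01"
  shows "theta_prod k (\<lambda>x. \<alpha> * f x + \<beta> * g x) a = \<alpha> * theta_prod k f a + \<beta> * theta_prod k g a"
  using assms(3)
proof (induction k arbitrary: a)
  case (Suc k)
  then show ?case
    using theta_cong[OF Suc.IH Suc.prems] theta_lincomb[OF smooth_theta_prod smooth_theta_prod Suc.prems, of f g \<alpha> k \<beta> k] assms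
    by (simp add: algebra_simps)
qed simp

text \<open>Constant-coefficient operators in \<open>theta\<close> commute; hence \<open>d\<close>
  does not grow and only the generator changes.\<close>

lemma theta_span_theta_prod:
  assumes "smooth U01 F" "theta_span d F f"
  shows "theta_span d (theta_prod k F) (theta_prod k f)"
proof (induction k)
  case (Suc k)
  define G where "G = theta_prod k F"
  define g where "g = theta_prod k f"
  have smG: "smooth U01 G" unfolding G_def by (rule smooth_theta_prod[OF assms(1)])
  obtain c where c: "\<And>a. a \<in> U01 \<Longrightarrow> g a = (\<Sum>i\<le>d. c i * (theta ^^ i) G a)"
    using theta_spanE[OF Suc.IH[folded g_def G_def]] by blast
  have "theta g a - 2 * real k * g a = (\<Sum>i\<le>d. c i * (theta ^^ i) (\<lambda>x. theta G x - 2 * real k * G x) a)"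
    if "a \<in> U01" for a
  proof -
    have "(theta ^^ i) (\<lambda>x. theta G x - 2 * real k * G x) a =
        theta ((theta ^^ i) G) a - 2 * real k * (theta ^^ i) G a" for i
      using theta_pow_lincomb[OF smooth_theta[OF smG] smG that, of i 1 "- 2 * real k"]
      by (simp add: funpow_swap1)
    moreover have "theta g a = (\<Sum>i\<le>d. c i * theta ((theta ^^ i) G) a)"
      using theta_cong[OF c that] theta_sum[of "{..d}" "\<lambda>i. (theta ^^ i) G" a c, OF smooth_theta_pow[OF smG] that] by simp
    ultimately show ?thesis
      by (simp add: c[OF that] right_diff_distrib sum_subtractf sum_distrib_left mult_ac)
  qed
  then show ?case unfolding G_def[symmetric] g_def[symmetric] theta_prod.simps by (rule theta_spanI)
qed (use assms in simp)

text \<open>\<open>theta f - c * f\<close> is \<open>a powr (c + 1)\<close> times the derivative of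
  \<open>a powr (- c) * f\<close>, so Rolle's theorem costs one zero.\<close>

lemma zeros_le_theta:
  assumes "smooth U01 f" "zeros_le U01 (\<lambda>a. theta f a - c * f a) k"
  shows "zeros_le U01 f (Suc k)"
proof -
  have sp: "smooth U01 (\<lambda>a. a powr y)" for y by (intro smooth_intros) auto
  have d: "deriv (\<lambda>a. a powr (- c) * f a) a = a powr (- c - 1) * (theta f a - c * f a)" if "a \<in> U01" for a
  proof -
    have "deriv (\<lambda>a. a powr (- c) * f a) a = (- c) * a powr (- c - 1) * f a + deriv f a * a powr (- c)"
      using that by (intro DERIV_imp_deriv DERIV_mult smooth_has_deriv[OF assms(1)])
        (auto intro!: derivative_eq_intros)
    also have "a powr (- c) = a * a powr (- c - 1)" using that by (intro powr_step) auto
    finally show ?thesis by (simp add: theta_def algebra_simps)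
  qed
  have "zeros_le U01 (\<lambda>a. a powr (c + 1) * deriv (\<lambda>a. a powr (- c) * f a) a) k"
  proof (subst zeros_le_cong[of U01 _ "\<lambda>a. theta f a - c * f a"])
    fix a assume a: "a \<in> U01"
    have "a powr (c + 1) * a powr (- c - 1) = 1" using a by (simp flip: powr_add)
    then show "a powr (c + 1) * deriv (\<lambda>a. a powr (- c) * f a) a = theta f a - c * f a"
      unfolding d[OF a] mult.assoc[symmetric] by simp
  qed (use assms in simp_all)
  then have "zeros_le U01 (deriv (\<lambda>a. a powr (- c) * f a)) k"
    by (rule zeros_le_mult[rotated -1])
       (auto intro!: smooth_deriv smooth_mult sp assms simp: less_imp_neq[symmetric])
  then have "zeros_le U01 (\<lambda>a. a powr (- c) * f a) (Suc k)"
    by (rule zeros_le_deriv[rotated -1]) (auto intro!: smooth_mult sp assms)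
  then show ?thesis
    by (rule zeros_le_mult[rotated -1]) (auto intro!: sp assms simp: less_imp_neq[symmetric])
qed

lemma zeros_le_theta_prod:
  assumes "smooth U01 f" "zeros_le U01 (theta_prod k f) b"
  shows "zeros_le U01 f (b + k)"
  using assms(2)
proof (induction k arbitrary: b)
  case (Suc k)
  have "zeros_le U01 (theta_prod k f) (Suc b)"
    using Suc.prems by (intro zeros_le_theta[OF smooth_theta_prod[OF assms(1)]]) simp
  then show ?case using Suc.IH by fastforce
qed simp

section \<open>A family of Mellin convolutions\<close>

definition sg :: "real \<Rightarrow> real \<Rightarrow> real" where
  "sg a \<phi> = a + (1 - a) * sin \<phi> ^ 2"

lemma sg_pos: "a \<in> U01 \<Longrightarrow> sg a \<phi> > 0"
  by (simp add: sg_def add_pos_nonneg)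

text \<open>With \<open>\<sigma> = sg a \<phi>\<close> one has
  \<open>\<sigma> - a = (1 - a) sin\<^sup>2 \<phi>\<close> and
  \<open>1 - \<sigma> = (1 - a) cos\<^sup>2 \<phi>\<close>. Natural powers of sine and cosine thus
  stand for half-integral powers of \<open>\<sigma> - a\<close> and \<open>1 - \<sigma>\<close>, and
  the integrand is continuous even where the one in \<open>\<sigma>\<close> is singular.\<close>

definition FnI :: "nat \<Rightarrow> nat \<Rightarrow> real \<Rightarrow> real \<Rightarrow> real \<Rightarrow> real" where
  "FnI p e y z a = integral {0..pi/2} (\<lambda>\<phi>. sin \<phi> ^ p * cos \<phi> ^ e * (sg a \<phi> powr y * (1 + sg a \<phi>) powr z))"

text \<open>The power of \<open>1 - a\<close> restores the true powers: this is half the integral of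
  \<open>(\<sigma> - a) powr ((p - 1)/2) * (1 - \<sigma>) powr ((e - 1)/2) * \<sigma> powr y * (1 +
  \<sigma>) powr z\<close> over \<open>a < \<sigma> < 1\<close>.\<close>

definition Fn :: "nat \<Rightarrow> nat \<Rightarrow> real \<Rightarrow> real \<Rightarrow> real \<Rightarrow> real" where
  "Fn p e y z a = (1 - a) powr ((real p + real e) / 2) * FnI p e y z a"

text \<open>The substitution \<open>\<sigma> = a + (1 - a) sin\<^sup>2 \<phi>\<close> turns \<open>Mf i p k e\<close> into the Mellin convolution
  \<open>\<integral> (a/\<sigma>)\<^sup>i (1 - a/\<sigma>) powr ((p - 1)/2) \<sigma>\<^sup>k (1 - \<sigma>\<^sup>2) powr ((e - 1)/2) d\<sigma>/\<sigma>\<close> over \<open>a < \<sigma> < 1\<close>.\<close>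

definition Mf :: "nat \<Rightarrow> nat \<Rightarrow> nat \<Rightarrow> nat \<Rightarrow> real \<Rightarrow> real" where
  "Mf i p k e a = 2 * a ^ i * Fn p e (real k - real i - (real p + 1) / 2) ((real e - 1) / 2) a"

lemma FnI_cont:
  assumes "a \<in> U01"
  shows "continuous_on A (\<lambda>\<phi>. sin \<phi> ^ p * cos \<phi> ^ e * (sg a \<phi> powr y * (1 + sg a \<phi>) powr z))"
proof -
  have "sg a \<phi> \<noteq> 0" "1 + sg a \<phi> \<noteq> 0" for \<phi> using sg_pos[OF assms, of \<phi>] by auto
  then show ?thesis unfolding sg_def by (intro continuous_intros) auto
qed

lemma FnI_integrable:
  assumes "a \<in> U01"
  shows "(\<lambda>\<phi>. sin \<phi> ^ p * cos \<phi> ^ e * (sg a \<phi> powr y * (1 + sg a \<phi>) powr z)) integrable_on {0..pi/2}"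
  by (intro integrable_continuous_real FnI_cont assms)

lemma FnI_lincomb:
  assumes "a \<in> U01"
    and "\<And>\<phi>. sin \<phi> ^ p * cos \<phi> ^ e * (sg a \<phi> powr y * (1 + sg a \<phi>) powr z) =
       \<alpha> * (sin \<phi> ^ p1 * cos \<phi> ^ e1 * (sg a \<phi> powr y1 * (1 + sg a \<phi>) powr z1)) +
       \<beta> * (sin \<phi> ^ p2 * cos \<phi> ^ e2 * (sg a \<phi> powr y2 * (1 + sg a \<phi>) powr z2))"
  shows "FnI p e y z a = \<alpha> * FnI p1 e1 y1 z1 a + \<beta> * FnI p2 e2 y2 z2 a"
proof -
  have "((\<lambda>\<phi>. \<alpha> * (sin \<phi> ^ p1 * cos \<phi> ^ e1 * (sg a \<phi> powr y1 * (1 + sg a \<phi>) powr z1)) +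
       \<beta> * (sin \<phi> ^ p2 * cos \<phi> ^ e2 * (sg a \<phi> powr y2 * (1 + sg a \<phi>) powr z2))) has_integral
       \<alpha> * FnI p1 e1 y1 z1 a + \<beta> * FnI p2 e2 y2 z2 a) {0..pi/2}"
    unfolding FnI_def by (intro has_integral_add has_integral_mult_right integrable_integral FnI_integrable assms)
  then show ?thesis unfolding assms(2)[symmetric] by (simp add: FnI_def integral_unique)
qed

lemma FnI_has_deriv:
  assumes a: "a \<in> U01"
  shows "(FnI p e y z has_real_derivative y * FnI p (e + 2) (y - 1) z a + z * FnI p (e + 2) y (z - 1) a) (at a)"
proof -
  let ?f = "\<lambda>a \<phi>. sin \<phi> ^ p * cos \<phi> ^ e * (sg a \<phi> powr y * (1 + sg a \<phi>) powr z)"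
  let ?f' = "\<lambda>a \<phi>. y * (sin \<phi> ^ p * cos \<phi> ^ (e + 2) * (sg a \<phi> powr (y - 1) * (1 + sg a \<phi>) powr z))
     + z * (sin \<phi> ^ p * cos \<phi> ^ (e + 2) * (sg a \<phi> powr y * (1 + sg a \<phi>) powr (z - 1)))"
  have "((\<lambda>a. integral (cbox 0 (pi/2)) (?f a)) has_field_derivative
     integral (cbox 0 (pi/2)) (?f' a)) (at a within U01)"
  proof (rule leibniz_rule_field_derivative)
    show "((\<lambda>a. ?f a \<phi>) has_field_derivative ?f' x \<phi>) (at x within U01)" if "x \<in> U01" for x \<phi>
    proof -
      have c2: "1 - sin \<phi> ^ 2 = cos \<phi> ^ 2" by (simp add: cos_squared_eq)
      have s: "((\<lambda>a. sg a \<phi>) has_real_derivative cos \<phi> ^ 2) (at x within U01)"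
        unfolding sg_def by (auto intro!: derivative_eq_intros simp: c2)
      have 1: "((\<lambda>a. sg a \<phi> powr y) has_real_derivative y * sg x \<phi> powr (y - 1) * cos \<phi> ^ 2) (at x within U01)"
        using sg_pos[OF that, of \<phi>] by (auto intro!: derivative_eq_intros s)
      have 2: "((\<lambda>a. (1 + sg a \<phi>) powr z) has_real_derivative z * (1 + sg x \<phi>) powr (z - 1) * cos \<phi> ^ 2) (at x within U01)"
        using sg_pos[OF that, of \<phi>] by (auto intro!: derivative_eq_intros s)
      show ?thesis
        by (rule DERIV_cong[OF DERIV_cmult[OF DERIV_mult[OF 1 2]]])
           (simp add: algebra_simps power2_eq_square)
    qed
    show "?f x integrable_on cbox 0 (pi/2)" if "x \<in> U01" for x
      using FnI_integrable[OF that] by simp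
    have "sg (fst x) (snd x) \<noteq> 0" "1 + sg (fst x) (snd x) \<noteq> 0" if "x \<in> U01 \<times> cbox 0 (pi/2)" for x
      using sg_pos[of "fst x" "snd x"] that by auto
    then show "continuous_on (U01 \<times> cbox 0 (pi/2)) (\<lambda>(x, t). ?f' x t)"
      unfolding split_beta sg_def by (intro continuous_intros) auto
  qed (use a in auto)
  moreover have "integral (cbox 0 (pi/2)) (?f' a) = y * FnI p (e + 2) (y - 1) z a + z * FnI p (e + 2) y (z - 1) a"
  proof (rule integral_unique)
    show "(?f' a has_integral y * FnI p (e + 2) (y - 1) z a + z * FnI p (e + 2) y (z - 1) a) (cbox 0 (pi/2))"
      unfolding FnI_def cbox_interval
      by (intro has_integral_add has_integral_mult_right integrable_integral FnI_integrable a)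
  qed
  ultimately show ?thesis
    using a at_within_open[of a U01] by (simp add: FnI_def[abs_def])
qed

lemma smooth_FnI: "smooth U01 (FnI p e y z)"
proof -
  have "Ck k U01 (FnI p e y z)" for k
  proof (induction k arbitrary: p e y z)
    case (Suc k)
    have c: "Ck k U01 (\<lambda>x. c)" for c using smooth_const[of U01 c] unfolding smooth_def by blast
    have "Ck k U01 (\<lambda>a. y * FnI p (e + 2) (y - 1) z a + z * FnI p (e + 2) y (z - 1) a)"
    proof (cases k)
      case (Suc l)
      have *: "Ck k U01 (\<lambda>a. y * FnI p (e + 2) (y - 1) z a)" "Ck k U01 (\<lambda>a. z * FnI p (e + 2) y (z - 1) a)"
        by (intro Ck_mult c Suc.IH)+
      show ?thesis using Ck_add[OF *] .
    qed simp
    then show ?case unfolding Ck.simps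
      by (intro exI[of _ "\<lambda>a. y * FnI p (e + 2) (y - 1) z a + z * FnI p (e + 2) y (z - 1) a"]
          conjI ballI FnI_has_deriv)
  qed simp
  then show ?thesis by (simp add: smooth_def)
qed

lemma smooth_Mf: "smooth U01 (Mf i p k e)"
  unfolding Mf_def Fn_def by (intro smooth_mult smooth_intros smooth_FnI) auto

text \<open>The fundamental theorem for \<open>sin \<phi> ^ (p + 1) * cos \<phi> ^ e * sg a \<phi>
  powr y * (1 + sg a \<phi>) powr z\<close>. It vanishes at 0, and at \<open>pi/2\<close>, where
  \<open>sg\<close> is 1, unless \<open>e = 0\<close>.\<close>

lemma FnI_boundary:
  assumes a: "a \<in> U01"
  shows "real (p + 1) * FnI p (e + 1) y z a - real e * FnI (p + 2) (e - 1) y z a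
     + 2 * (1 - a) * (y * FnI (p + 2) (e + 1) (y - 1) z a + z * FnI (p + 2) (e + 1) y (z - 1) a)
     = (if e = 0 then 2 powr z else 0)"
proof -
  let ?g = "\<lambda>\<phi>. sin \<phi> ^ (p + 1) * cos \<phi> ^ e * (sg a \<phi> powr y * (1 + sg a \<phi>) powr z)"
  let ?f = "\<lambda>p e y z \<phi>. sin \<phi> ^ p * cos \<phi> ^ e * (sg a \<phi> powr y * (1 + sg a \<phi>) powr z)"
  let ?g' = "\<lambda>\<phi>. real (p + 1) * ?f p (e + 1) y z \<phi> - real e * ?f (p + 2) (e - 1) y z \<phi>
     + 2 * (1 - a) * (y * ?f (p + 2) (e + 1) (y - 1) z \<phi> + z * ?f (p + 2) (e + 1) y (z - 1) \<phi>)"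
  have h1: "(?g' has_integral ?g (pi/2) - ?g 0) {0..pi/2}"
  proof (rule fundamental_theorem_of_calculus)
    fix \<phi> :: real
    have s: "(sg a has_real_derivative 2 * (1 - a) * (sin \<phi> * cos \<phi>)) (at \<phi>)"
      unfolding sg_def by (auto intro!: derivative_eq_intros)
    have 1: "((\<lambda>\<phi>. sg a \<phi> powr y) has_real_derivative y * sg a \<phi> powr (y - 1) * (2 * (1 - a) * (sin \<phi> * cos \<phi>))) (at \<phi>)"
      using sg_pos[OF a, of \<phi>] by (auto intro!: derivative_eq_intros s)
    have 2: "((\<lambda>\<phi>. (1 + sg a \<phi>) powr z) has_real_derivative z * (1 + sg a \<phi>) powr (z - 1) * (2 * (1 - a) * (sin \<phi> * cos \<phi>))) (at \<phi>)"
      using sg_pos[OF a, of \<phi>] by (auto intro!: derivative_eq_intros s)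
    have 3: "((\<lambda>\<phi>. sin \<phi> ^ (p + 1)) has_real_derivative real (p + 1) * (sin \<phi> ^ p * cos \<phi>)) (at \<phi>)"
      using DERIV_power_Suc[OF DERIV_sin, of p \<phi>] by (simp add: mult_ac)
    have 4: "((\<lambda>\<phi>. cos \<phi> ^ e) has_real_derivative - real e * (cos \<phi> ^ (e - 1) * sin \<phi>)) (at \<phi>)"
      using DERIV_power[OF DERIV_cos, of e \<phi>] by (simp add: mult_ac)
    have "(?g has_real_derivative ?g' \<phi>) (at \<phi>)"
      by (rule DERIV_cong[OF DERIV_mult[OF DERIV_mult[OF 3 4] DERIV_mult[OF 1 2]]])
         (simp add: algebra_simps power2_eq_square)
    then show "(?g has_vector_derivative ?g' \<phi>) (at \<phi> within {0..pi/2})"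
      using has_real_derivative_iff_has_vector_derivative has_vector_derivative_at_within by blast
  qed (simp add: pi_ge_zero)
  have h2: "?g (pi/2) - ?g 0 = (if e = 0 then 2 powr z else 0)"
    by (simp add: sg_def)
  have h3: "(?g' has_integral real (p + 1) * FnI p (e + 1) y z a - real e * FnI (p + 2) (e - 1) y z a
     + 2 * (1 - a) * (y * FnI (p + 2) (e + 1) (y - 1) z a + z * FnI (p + 2) (e + 1) y (z - 1) a)) {0..pi/2}"
    unfolding FnI_def
    by (intro has_integral_add has_integral_diff has_integral_mult_right integrable_integral FnI_integrable a)
  show ?thesis using has_integral_unique[OF h3 h1] unfolding h2 .
qed

text \<open>As an integral over \<open>\<sigma>\<close> this differentiates
  \<open>(\<sigma> - a) powr ((p + 1)/2)\<close>, which vanishes at the moving endpoint. With the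
  fixed limits in \<open>\<phi>\<close> the same result comes from the boundary identity.\<close>

lemma Fn_has_deriv:
  assumes a: "a \<in> U01"
  shows "(Fn (p + 2) e y z has_real_derivative - (real p + 1) / 2 * Fn p e y z a) (at a)"
proof -
  define w where "w = (real (p + 2) + real e) / 2"
  let ?I1 = "FnI (p + 2) (e + 2) (y - 1) z a" and ?I2 = "FnI (p + 2) (e + 2) y (z - 1) a"
  let ?I0 = "FnI (p + 2) e y z a"
  have b: "real (p + 1) * FnI p (e + 2) y z a - real (e + 1) * ?I0 + 2 * (1 - a) * (y * ?I1 + z * ?I2) = 0"
    using FnI_boundary[OF a, of p "e + 1" y z] by simp
  have s: "FnI p e y z a = ?I0 + FnI p (e + 2) y z a"
  proof -
    have "sin \<phi> ^ p * cos \<phi> ^ e * X = 1 * (sin \<phi> ^ (p + 2) * cos \<phi> ^ e * X) + 1 * (sin \<phi> ^ p * cos \<phi> ^ (e + 2) * X)"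
      for \<phi> X :: real
    proof -
      have "sin \<phi> ^ p * cos \<phi> ^ e * X = sin \<phi> ^ p * cos \<phi> ^ e * X * (sin \<phi> ^ 2 + cos \<phi> ^ 2)" by simp
      also have "\<dots> = 1 * (sin \<phi> ^ (p + 2) * cos \<phi> ^ e * X) + 1 * (sin \<phi> ^ p * cos \<phi> ^ (e + 2) * X)"
        unfolding power_add by algebra
      finally show ?thesis .
    qed
    then show ?thesis using FnI_lincomb[OF a, of p e y z 1 "p + 2" e y z 1 p "e + 2" y z] by simp
  qed
  have "(Fn (p + 2) e y z has_real_derivative
      (- w * (1 - a) powr (w - 1)) * ?I0 + (y * ?I1 + z * ?I2) * (1 - a) powr w) (at a)"
    unfolding Fn_def w_def[symmetric] using a
    by (intro DERIV_mult FnI_has_deriv) (auto intro!: derivative_eq_intros)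
  also have "(1 - a) powr w = (1 - a) * (1 - a) powr (w - 1)" using a by (intro powr_step) auto
  also have "(- w * (1 - a) powr (w - 1)) * ?I0 + (y * ?I1 + z * ?I2) * ((1 - a) * (1 - a) powr (w - 1)) =
     (1 - a) powr (w - 1) * (- w * ?I0 + (1 - a) * (y * ?I1 + z * ?I2))" by (simp add: algebra_simps)
  also have "- w * ?I0 + (1 - a) * (y * ?I1 + z * ?I2) = - (real p + 1) / 2 * FnI p e y z a"
  proof -
    have "2 * ((1 - a) * (y * ?I1 + z * ?I2)) = real (e + 1) * ?I0 - real (p + 1) * FnI p (e + 2) y z a"
      using b unfolding mult.assoc by linarith
    then have "2 * (- w * ?I0 + (1 - a) * (y * ?I1 + z * ?I2)) = - (real p + 1) * FnI p e y z a"
      unfolding s by (simp add: w_def field_simps)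
    then show ?thesis by simp
  qed
  also have "w - 1 = (real p + real e) / 2" by (simp add: w_def field_simps)
  finally show ?thesis unfolding Fn_def[of p e y z a] by (simp add: mult_ac)
qed

lemma Fn_raise_p:
  assumes a: "a \<in> U01"
  shows "Fn p e (y + 1) z a = a * Fn p e y z a + Fn (p + 2) e y z a"
proof -
  have eq: "FnI p e (y + 1) z a = a * FnI p e y z a + (1 - a) * FnI (p + 2) e y z a"
  proof (rule FnI_lincomb[OF a])
    fix \<phi>
    have 1: "sg a \<phi> powr (y + 1) = sg a \<phi> * sg a \<phi> powr y"
      using powr_step[OF sg_pos[OF a], of \<phi> "y + 1"] by simp
    define X where "X = sg a \<phi> powr y"
    show "sin \<phi> ^ p * cos \<phi> ^ e * (sg a \<phi> powr (y + 1) * (1 + sg a \<phi>) powr z) =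
       a * (sin \<phi> ^ p * cos \<phi> ^ e * (sg a \<phi> powr y * (1 + sg a \<phi>) powr z)) +
       (1 - a) * (sin \<phi> ^ (p + 2) * cos \<phi> ^ e * (sg a \<phi> powr y * (1 + sg a \<phi>) powr z))"
      unfolding 1 X_def[symmetric] power_add
      by (simp add: sg_def algebra_simps)
  qed
  have pw: "(1 - a) powr ((real (p + 2) + real e) / 2) = (1 - a) * (1 - a) powr ((real p + real e) / 2)"
    using powr_step[of "1 - a" "(real (p + 2) + real e) / 2"] a by (simp add: add_divide_distrib)
  show ?thesis unfolding Fn_def eq pw by algebra
qed

lemma Fn_raise_e:
  assumes a: "a \<in> U01"
  shows "Fn p (e + 2) y (z + 1) a = Fn p e y z a - Fn p e (y + 2) z a"
proof -
  have eq: "(1 - a) * FnI p (e + 2) y (z + 1) a = FnI p e y z a - FnI p e (y + 2) z a"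
  proof -
    have "FnI p e y z a = 1 * FnI p e (y + 2) z a + (1 - a) * FnI p (e + 2) y (z + 1) a"
    proof (rule FnI_lincomb[OF a])
      fix \<phi>
      have 1: "sg a \<phi> powr (y + 2) = sg a \<phi> ^ 2 * sg a \<phi> powr y"
        using sg_pos[OF a, of \<phi>] by (simp add: powr_add powr_numeral)
      have 2: "(1 + sg a \<phi>) powr (z + 1) = (1 + sg a \<phi>) * (1 + sg a \<phi>) powr z"
        using powr_step[of "1 + sg a \<phi>" "z + 1"] sg_pos[OF a, of \<phi>] by simp
      have 3: "(1 - a) * cos \<phi> ^ (e + 2) = cos \<phi> ^ e * (1 - sg a \<phi>)"
        unfolding power_add cos_squared_eq sg_def by (simp add: algebra_simps)
      define X where "X = sg a \<phi> powr y"
      define Y where "Y = (1 + sg a \<phi>) powr z"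
      have "(1 - a) * (sin \<phi> ^ p * cos \<phi> ^ (e + 2) * (X * ((1 + sg a \<phi>) * Y))) =
          sin \<phi> ^ p * ((1 - a) * cos \<phi> ^ (e + 2)) * (X * ((1 + sg a \<phi>) * Y))"
        by (simp only: mult_ac)
      also have "\<dots> = sin \<phi> ^ p * (cos \<phi> ^ e * (1 - sg a \<phi>)) * (X * ((1 + sg a \<phi>) * Y))"
        unfolding 3 ..
      finally have h: "(1 - a) * (sin \<phi> ^ p * cos \<phi> ^ (e + 2) * (X * ((1 + sg a \<phi>) * Y))) = \<dots>" .
      show "sin \<phi> ^ p * cos \<phi> ^ e * (sg a \<phi> powr y * (1 + sg a \<phi>) powr z) =
         1 * (sin \<phi> ^ p * cos \<phi> ^ e * (sg a \<phi> powr (y + 2) * (1 + sg a \<phi>) powr z)) +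
         (1 - a) * (sin \<phi> ^ p * cos \<phi> ^ (e + 2) * (sg a \<phi> powr y * (1 + sg a \<phi>) powr (z + 1)))"
        unfolding 1 2 X_def[symmetric] Y_def[symmetric] unfolding h by algebra
    qed
    then show ?thesis by simp
  qed
  have pw: "(1 - a) powr ((real p + real (e + 2)) / 2) = (1 - a) * (1 - a) powr ((real p + real e) / 2)"
    using powr_step[of "1 - a" "(real p + real (e + 2)) / 2"] a by (simp add: add_divide_distrib)
  define q where "q = (1 - a) powr ((real p + real e) / 2)"
  have "(1 - a) * q * FnI p (e + 2) y (z + 1) a = q * ((1 - a) * FnI p (e + 2) y (z + 1) a)"
    by (simp only: mult_ac)
  then show ?thesis unfolding Fn_def pw q_def[symmetric] eq by algebra
qed

text \<open>The product rule for
  \<open>(a/\<sigma>) ^ i * (1 - a/\<sigma>) powr ((p + 1)/2)\<close>, the factor of the convolution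
  that contains \<open>a\<close>.\<close>

lemma theta_Mf:
  assumes a: "a \<in> U01"
  shows "theta (Mf i (p + 2) k e) a = real i * Mf i (p + 2) k e a - (real p + 1) / 2 * Mf (i + 1) p k e a"
proof -
  let ?y = "real k - real i - (real (p + 2) + 1) / 2" and ?z = "(real e - 1) / 2"
  have "((\<lambda>a. 2 * a ^ i * Fn (p + 2) e ?y ?z a) has_real_derivative
     (2 * (real i * a ^ (i - 1))) * Fn (p + 2) e ?y ?z a + (- (real p + 1) / 2 * Fn p e ?y ?z a) * (2 * a ^ i)) (at a)"
    by (intro DERIV_mult Fn_has_deriv a DERIV_cmult) (auto intro!: derivative_eq_intros)
  then have "deriv (Mf i (p + 2) k e) a = (2 * (real i * a ^ (i - 1))) * Fn (p + 2) e ?y ?z a +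
      (- (real p + 1) / 2 * Fn p e ?y ?z a) * (2 * a ^ i)"
    unfolding Mf_def[abs_def] by (rule DERIV_imp_deriv)
  moreover have M1: "Mf (i + 1) p k e a = 2 * (a * a ^ i) * Fn p e ?y ?z a"
  proof -
    have "real k - real (i + 1) - (real p + 1) / 2 = ?y" by (simp add: field_simps)
    then show ?thesis by (simp only: Mf_def) simp
  qed
  moreover have "a * ((2 * (real i * a ^ (i - 1))) * F + (- (real p + 1) / 2 * F') * (2 * a ^ i)) =
      real i * (2 * a ^ i * F) - (real p + 1) / 2 * (2 * (a * a ^ i) * F')" for F F'
  proof -
    have "a * ((2 * (real i * a ^ (i - 1))) * F + (- (real p + 1) / 2 * F') * (2 * a ^ i)) =
      2 * (real i * a ^ (i - 1) * a) * F - (real p + 1) * (a * a ^ i) * F'" by (simp add: field_simps)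
    also have "real i * a ^ (i - 1) * a = real i * a ^ i" by (cases i) simp_all
    finally show ?thesis by simp
  qed
  ultimately show ?thesis unfolding theta_def M1 by (simp only:) (simp only: Mf_def)
qed

text \<open>\<open>1 = a/\<sigma> + (1 - a/\<sigma>)\<close> under the integral.\<close>

lemma Mf_lower:
  assumes a: "a \<in> U01"
  shows "Mf i p k e a = Mf (i + 1) p k e a + Mf i (p + 2) k e a"
proof -
  define y where "y = real k - real i - (real (p + 2) + 1) / 2"
  have y: "real k - real (i + 1) - (real p + 1) / 2 = y" "real k - real i - (real p + 1) / 2 = y + 1"
    by (simp_all add: y_def field_simps)
  show ?thesis
    unfolding Mf_def y y_def[symmetric] Fn_raise_p[OF a] by (simp add: distrib_left)
qed

lemma Mf_raise_k:
  assumes a: "a \<in> U01"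
  shows "Mf 0 p k (e + 2) a = Mf 0 p k e a - Mf 0 p (k + 2) e a"
proof -
  define y where "y = real k - real 0 - (real p + 1) / 2"
  define z where "z = (real e - 1) / 2"
  have y: "real (k + 2) - real 0 - (real p + 1) / 2 = y + 2" "(real (e + 2) - 1) / 2 = z + 1"
    by (simp_all add: y_def z_def field_simps)
  show ?thesis
    unfolding Mf_def y y_def[symmetric] z_def[symmetric] Fn_raise_e[OF a] by (simp add: right_diff_distrib)
qed

text \<open>In a Mellin convolution \<open>theta\<close> can be passed to the other factor: it acts
  on \<open>\<sigma> ^ k * (1 - \<sigma>\<^sup>2) powr (e/2)\<close> as
  \<open>\<sigma> d/d\<sigma>\<close>, with a boundary term at \<open>\<sigma> = 1\<close> that
  survives only for \<open>e = 0\<close>.\<close>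

lemma theta_Mf_boundary:
  assumes a: "a \<in> U01"
  shows "theta (Mf 0 (p + 2) k (e + 1)) a = real k * Mf 0 (p + 2) k (e + 1) a
      - (if e = 0 then (1 - a) powr ((real p + 1) / 2) else real e * Mf 0 (p + 2) (k + 2) (e - 1) a)"
proof -
  define y where "y = real k - (real p + 1) / 2"
  define z where "z = real e / 2"
  define q where "q = (1 - a) powr ((real p + 1 + real e) / 2)"
  have y1: "real k - real 0 - (real (p + 2) + 1) / 2 = y - 1" "real k - real (0 + 1) - (real p + 1) / 2 = y - 1"
    by (simp_all add: y_def field_simps)
  have z1: "(real (e + 1) - 1) / 2 = z" by (simp add: z_def)
  let ?A = "Fn (p + 2) (e + 1) (y - 1) z a"
  have th: "theta (Mf 0 (p + 2) k (e + 1)) a = - (real p + 1) * (a * Fn p (e + 1) (y - 1) z a)"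
    using theta_Mf[OF a, of 0 p k "e + 1"] unfolding Mf_def y1 z1 by (simp add: algebra_simps)
  have q2: "(1 - a) powr ((real (p + 2) + real (e + 1)) / 2) = (1 - a) * q"
  proof -
    have "(1 - a) powr ((real (p + 2) + real (e + 1)) / 2) =
        (1 - a) * (1 - a) powr ((real (p + 2) + real (e + 1)) / 2 - 1)"
      using a by (intro powr_step) auto
    also have "(real (p + 2) + real (e + 1)) / 2 - 1 = (real p + 1 + real e) / 2" by (simp add: field_simps)
    finally show ?thesis by (simp add: q_def)
  qed
  have b: "(real p + 1) * Fn p (e + 1) y z a - real e * (q * FnI (p + 2) (e - 1) y z a)
      + 2 * (y * ?A + z * Fn (p + 2) (e + 1) y (z - 1) a) = q * (if e = 0 then 2 powr z else 0)"
  proof -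
    have "q * (real (p + 1) * FnI p (e + 1) y z a - real e * FnI (p + 2) (e - 1) y z a
     + 2 * (1 - a) * (y * FnI (p + 2) (e + 1) (y - 1) z a + z * FnI (p + 2) (e + 1) y (z - 1) a)) = 
       q * (if e = 0 then 2 powr z else 0)"
      using FnI_boundary[OF a, of p e y z] by simp
    moreover have "(1 - a) powr ((real p + real (e + 1)) / 2) = q" by (simp add: q_def add_ac)
    ultimately show ?thesis unfolding Fn_def q2 by (simp add: algebra_simps)
  qed
  have r: "Fn p (e + 1) y z a = a * Fn p (e + 1) (y - 1) z a + ?A"
    using Fn_raise_p[OF a, of p "e + 1" "y - 1" z] by simp
  have main: "theta (Mf 0 (p + 2) k (e + 1)) a = real k * (2 * ?A) +
      2 * z * Fn (p + 2) (e + 1) y (z - 1) a - real e * (q * FnI (p + 2) (e - 1) y z a)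
      - q * (if e = 0 then 2 powr z else 0)"
  proof -
    have "(real p + 1) * (a * Fn p (e + 1) (y - 1) z a) = q * (if e = 0 then 2 powr z else 0) +
        real e * (q * FnI (p + 2) (e - 1) y z a) - 2 * (y * ?A + z * Fn (p + 2) (e + 1) y (z - 1) a) - (real p + 1) * ?A"
      using b unfolding r distrib_left by argo
    moreover have "2 * y + (real p + 1) = 2 * real k" by (simp add: y_def field_simps)
    then have "2 * (y * ?A) + (real p + 1) * ?A = real k * (2 * ?A)" by algebra
    ultimately show ?thesis unfolding th by argo
  qed
  have A: "Mf 0 (p + 2) k (e + 1) a = 2 * ?A" unfolding Mf_def y1 z1 by simp
  show ?thesis
  proof (cases e)
    case 0
    then show ?thesis unfolding main A by (simp add: z_def q_def)
  next
    case (Suc l)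
    \<comment> \<open>One factor \<open>1 + \<sigma>\<close> is written as
      \<open>2 * \<sigma> + (1 - \<sigma>)\<close>; the second part cancels against the term
      \<open>C\<close> below.\<close>
    have f: "FnI (p + 2) l y z a = 2 * FnI (p + 2) l (y + 1) (z - 1) a + (1 - a) * FnI (p + 2) (l + 2) y (z - 1) a"
    proof (rule FnI_lincomb[OF a])
      fix \<phi>
      have 1: "sg a \<phi> powr (y + 1) = sg a \<phi> * sg a \<phi> powr y"
        using powr_step[OF sg_pos[OF a], of \<phi> "y + 1"] by simp
      have 2: "(1 + sg a \<phi>) powr z = (1 + sg a \<phi>) * (1 + sg a \<phi>) powr (z - 1)"
        using powr_step[of "1 + sg a \<phi>" z] sg_pos[OF a, of \<phi>] by simp
      have 3: "(1 - a) * cos \<phi> ^ (l + 2) = cos \<phi> ^ l * (1 - sg a \<phi>)"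
        unfolding power_add cos_squared_eq sg_def by (simp add: algebra_simps)
      define X where "X = sg a \<phi> powr y"
      define Y where "Y = (1 + sg a \<phi>) powr (z - 1)"
      have "(1 - a) * (sin \<phi> ^ (p + 2) * cos \<phi> ^ (l + 2) * (X * Y)) =
          sin \<phi> ^ (p + 2) * ((1 - a) * cos \<phi> ^ (l + 2)) * (X * Y)"
        by (simp only: mult_ac)
      also have "\<dots> = sin \<phi> ^ (p + 2) * (cos \<phi> ^ l * (1 - sg a \<phi>)) * (X * Y)"
        unfolding 3 ..
      finally have h: "(1 - a) * (sin \<phi> ^ (p + 2) * cos \<phi> ^ (l + 2) * (X * Y)) = \<dots>" .
      show "sin \<phi> ^ (p + 2) * cos \<phi> ^ l * (sg a \<phi> powr y * (1 + sg a \<phi>) powr z) =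
         2 * (sin \<phi> ^ (p + 2) * cos \<phi> ^ l * (sg a \<phi> powr (y + 1) * (1 + sg a \<phi>) powr (z - 1))) +
         (1 - a) * (sin \<phi> ^ (p + 2) * cos \<phi> ^ (l + 2) * (sg a \<phi> powr y * (1 + sg a \<phi>) powr (z - 1)))"
        unfolding 1 2 X_def[symmetric] Y_def[symmetric] unfolding h by algebra
    qed
    have y2: "real (k + 2) - real 0 - (real (p + 2) + 1) / 2 = y + 1" by (simp add: y_def field_simps)
    have z2: "(real l - 1) / 2 = z - 1" using Suc by (simp add: z_def field_simps)
    have ql: "(1 - a) powr ((real (p + 2) + real l) / 2) = q" using Suc by (simp add: q_def add_ac)
    have B: "Mf 0 (p + 2) (k + 2) l a = 2 * (q * FnI (p + 2) l (y + 1) (z - 1) a)"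
      unfolding Mf_def y2 z2 Fn_def ql by simp
    have C: "Fn (p + 2) (e + 1) y (z - 1) a = (1 - a) * q * FnI (p + 2) (l + 2) y (z - 1) a"
      unfolding Fn_def q2 using Suc by simp
    have "2 * z = real e" by (simp add: z_def)
    moreover have "e \<noteq> 0" "e - 1 = l" using Suc by simp_all
    moreover have "real k * A + w * ((1 - a) * q * G2) - w * (q * (2 * G1 + (1 - a) * G2)) - q * 0
        = real k * A - w * (2 * (q * G1))" for A G1 G2 w :: real
      by (simp add: algebra_simps)
    ultimately show ?thesis unfolding main A C by (simp only: f B if_False)
  qed
qed

text \<open>Solving the formula for \<open>theta\<close> yields the power \<open>i + 1\<close> of
  \<open>a/\<sigma>\<close> from the power \<open>i\<close> at the price of one \<open>theta\<close>
  and of \<open>p + 2\<close> for \<open>p\<close>; splitting \<open>1\<close> into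
  \<open>a/\<sigma>\<close> and \<open>1 - a/\<sigma>\<close> then yields the power \<open>i\<close>
  itself.\<close>

lemma theta_span_Mf: "i \<le> n \<Longrightarrow> theta_span n (Mf 0 (p + 2 * n) k e) (Mf i p k e)"
proof (induction n arbitrary: i p)
  case 0
  then show ?case using theta_span_refl by simp
next
  case (Suc n)
  have eq: "p + 2 * Suc n = (p + 2) + 2 * n" by simp
  have raise: "theta_span (Suc n) (Mf 0 (p + 2 * Suc n) k e) (Mf (j + 1) p k e)" if "j \<le> n" for j
  proof -
    have IH: "theta_span n (Mf 0 (p + 2 * Suc n) k e) (Mf j (p + 2) k e)"
      unfolding eq using Suc.IH[OF that] .
    have "theta_span (Suc n) (Mf 0 (p + 2 * Suc n) k e)
       (\<lambda>a. (- 2 / (real p + 1)) * theta (Mf j (p + 2) k e) a + (2 * real j / (real p + 1)) * Mf j (p + 2) k e a)"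
      by (intro theta_span_lincomb theta_span_theta smooth_Mf IH theta_span_mono[OF IH]) simp
    then show ?thesis
    proof (rule theta_span_cong)
      fix a assume "a \<in> U01"
      then show "Mf (j + 1) p k e a = (- 2 / (real p + 1)) * theta (Mf j (p + 2) k e) a
          + (2 * real j / (real p + 1)) * Mf j (p + 2) k e a"
        unfolding theta_Mf[OF \<open>a \<in> U01\<close>] by (simp add: divide_simps) (simp add: algebra_simps)
    qed
  qed
  show ?case
  proof (cases "i \<le> n")
    case True
    have "theta_span (Suc n) (Mf 0 (p + 2 * Suc n) k e) (Mf i (p + 2) k e)"
      unfolding eq using Suc.IH[OF True] by (rule theta_span_mono) simp
    from theta_span_lincomb[OF raise[OF True] this, of 1 1] show ?thesis
      by (rule theta_span_cong) (simp add: Mf_lower[of _ i p])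
  next
    case False
    then have "i = n + 1" using Suc.prems by simp
    then show ?thesis using raise[of n] by simp
  qed
qed

text \<open>At \<open>k = 0\<close> the eigenvalue term disappears: \<open>theta\<close> of the
  integral with \<open>e + 2\<close> is a multiple of the one with the extra factor
  \<open>\<sigma>\<^sup>2\<close>, and \<open>1 = \<sigma>\<^sup>2 + (1 - \<sigma>\<^sup>2)\<close>
  recovers \<open>e\<close>.\<close>

lemma theta_span_Mf_e: "theta_span l (Mf 0 (p + 2) 0 (e + 2 * l)) (Mf 0 (p + 2) 0 e)"
proof (induction l arbitrary: e)
  case 0
  then show ?case using theta_span_refl by simp
next
  case (Suc l)
  have eq: "e + 2 * Suc l = (e + 2) + 2 * l" by simp
  have IH: "theta_span l (Mf 0 (p + 2) 0 (e + 2 * Suc l)) (Mf 0 (p + 2) 0 (e + 2))"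
    unfolding eq using Suc.IH .
  have "theta_span (Suc l) (Mf 0 (p + 2) 0 (e + 2 * Suc l))
       (\<lambda>a. (- 1 / (real e + 1)) * theta (Mf 0 (p + 2) 0 (e + 2)) a + 1 * Mf 0 (p + 2) 0 (e + 2) a)"
    by (intro theta_span_lincomb theta_span_theta smooth_Mf IH theta_span_mono[OF IH]) simp
  then show ?case
  proof (rule theta_span_cong)
    fix a assume a: "a \<in> U01"
    have t: "theta (Mf 0 (p + 2) 0 (e + 2)) a = - (real e + 1) * Mf 0 (p + 2) 2 e a"
      using theta_Mf_boundary[OF a, of p 0 "e + 1"] by (simp add: algebra_simps eval_nat_numeral)
    have r: "Mf 0 (p + 2) 0 (e + 2) a = Mf 0 (p + 2) 0 e a - Mf 0 (p + 2) 2 e a"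
      using Mf_raise_k[OF a, of "p + 2" 0 e] by (simp only: add_0)
    show "Mf 0 (p + 2) 0 e a = (- 1 / (real e + 1)) * theta (Mf 0 (p + 2) 0 (e + 2)) a + 1 * Mf 0 (p + 2) 0 (e + 2) a"
      unfolding t r by (simp add: field_simps)
  qed
qed

text \<open>At exponent \<open>2 * k\<close> of \<open>\<sigma>\<close> the factor
  \<open>theta - 2 * k\<close> cancels the eigenvalue term; what remains has exponent
  \<open>2 * k + 2\<close> and \<open>e\<close> lowered by 2. This is the origin of the even
  integers in \<open>theta_prod\<close>.\<close>

lemma theta_prod_Mf:
  "\<exists>c. \<forall>a\<in>U01. theta_prod k (Mf 0 (p + 2) 0 (e + 2 * k)) a = c * Mf 0 (p + 2) (2 * k) e a"
proof (induction k arbitrary: e)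
  case 0
  show ?case by (rule exI[of _ 1]) simp
next
  case (Suc k)
  have eq: "e + 2 * Suc k = (e + 2) + 2 * k" by simp
  have "\<exists>c. \<forall>a\<in>U01. theta_prod k (Mf 0 (p + 2) 0 (e + 2 * Suc k)) a = c * Mf 0 (p + 2) (2 * k) (e + 2) a"
    unfolding eq by (rule Suc.IH)
  then obtain c where c: "\<And>a. a \<in> U01 \<Longrightarrow> theta_prod k (Mf 0 (p + 2) 0 (e + 2 * Suc k)) a = c * Mf 0 (p + 2) (2 * k) (e + 2) a"
    by (elim exE) (rule that, rule bspec)
  have "theta_prod (Suc k) (Mf 0 (p + 2) 0 (e + 2 * Suc k)) a = - c * (real e + 1) * Mf 0 (p + 2) (2 * Suc k) e a"
    if a: "a \<in> U01" for a
  proof -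
    have "theta (theta_prod k (Mf 0 (p + 2) 0 (e + 2 * Suc k))) a = c * theta (Mf 0 (p + 2) (2 * k) (e + 2)) a"
      using theta_cong[OF c a] theta_lincomb[OF smooth_Mf smooth_const[of _ 0] a, of c _ _ _ _ 0] by simp
    also have "theta (Mf 0 (p + 2) (2 * k) (e + 2)) a =
        2 * real k * Mf 0 (p + 2) (2 * k) (e + 2) a - (real e + 1) * Mf 0 (p + 2) (2 * Suc k) e a"
      using theta_Mf_boundary[OF a, of p "2 * k" "e + 1"] by (simp add: algebra_simps)
    finally show ?thesis using c[OF a] by (simp add: algebra_simps)
  qed
  then show ?case by (intro exI ballI)
qed

section \<open>The elliptic integral on a cycle with fixed limits\<close>

section \<open>Transformation of the period integral\<close>

text \<open>The usual antiderivative \<open>arctan (k * tan \<psi>)\<close> breaks down at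
  \<open>pi/2\<close>. It is replaced by \<open>\<psi> + arctan (N \<psi> / D \<psi>)\<close>, where
  \<open>N / D\<close> is the tangent of the difference
  \<open>arctan (k * tan \<psi>) - \<psi>\<close> and \<open>D\<close> has no zeros.\<close>

lemma integral_inverse_sin2:
  assumes A: "A > 0" and AB: "A + B > 0"
  shows "((\<lambda>\<psi>. 1 / (A + B * sin \<psi> ^ 2)) has_integral pi / (2 * sqrt (A * (A + B)))) {0..pi/2}"
proof -
  define k where "k = sqrt ((A + B) / A)"
  have k: "k > 0" "k ^ 2 = (A + B) / A" using A AB by (simp_all add: k_def)
  define N where "N = (\<lambda>\<psi>::real. (k - 1) * sin \<psi> * cos \<psi>)"
  define D where "D = (\<lambda>\<psi>::real. cos \<psi> ^ 2 + k * sin \<psi> ^ 2)"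
  have D: "D \<psi> > 0" for \<psi>
  proof (cases "sin \<psi> = 0")
    case True
    then have "cos \<psi> ^ 2 = 1" using sin_cos_squared_add[of \<psi>] by simp
    then show ?thesis using True by (simp add: D_def)
  next
    case False
    then show ?thesis using k by (auto simp: D_def intro!: add_nonneg_pos)
  qed
  define F where "F = (\<lambda>\<psi>. (\<psi> + arctan (N \<psi> / D \<psi>)) / sqrt (A * (A + B)))"
  have "((\<lambda>\<psi>. 1 / (A + B * sin \<psi> ^ 2)) has_integral F (pi/2) - F 0) {0..pi/2}"
  proof (rule fundamental_theorem_of_calculus)
    fix \<psi> :: real
    define s c where "s = sin \<psi>" and "c = cos \<psi>"
    have sc: "s ^ 2 + c ^ 2 = 1" by (simp add: s_def c_def)
    have dN: "(N has_real_derivative (k - 1) * (c ^ 2 - s ^ 2)) (at \<psi>)"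
      unfolding N_def s_def c_def
      by (auto intro!: derivative_eq_intros simp: power2_eq_square algebra_simps)
    have dD: "(D has_real_derivative 2 * (k - 1) * s * c) (at \<psi>)"
      unfolding D_def s_def c_def by (auto intro!: derivative_eq_intros simp: algebra_simps)
    have "((\<lambda>\<psi>. N \<psi> / D \<psi>) has_real_derivative
        ((k - 1) * (c ^ 2 - s ^ 2) * D \<psi> - N \<psi> * (2 * (k - 1) * s * c)) / (D \<psi> * D \<psi>)) (at \<psi>)"
      using D[of \<psi>] by (intro DERIV_divide dN dD) simp
    then have "((\<lambda>\<psi>. arctan (N \<psi> / D \<psi>)) has_real_derivative
        inverse (1 + (N \<psi> / D \<psi>) ^ 2) *
        (((k - 1) * (c ^ 2 - s ^ 2) * D \<psi> - N \<psi> * (2 * (k - 1) * s * c)) / (D \<psi> * D \<psi>))) (at \<psi>)"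
      by (rule DERIV_chain2[OF DERIV_arctan])
    also have "inverse (1 + (N \<psi> / D \<psi>) ^ 2) *
        (((k - 1) * (c ^ 2 - s ^ 2) * D \<psi> - N \<psi> * (2 * (k - 1) * s * c)) / (D \<psi> * D \<psi>)) =
        ((k - 1) * (c ^ 2 - s ^ 2) * D \<psi> - N \<psi> * (2 * (k - 1) * s * c)) / (D \<psi> ^ 2 + N \<psi> ^ 2)"
    proof -
      have "1 + (N \<psi> / D \<psi>) ^ 2 = (D \<psi> ^ 2 + N \<psi> ^ 2) / D \<psi> ^ 2"
        using D[of \<psi>] by (simp add: field_simps)
      then show ?thesis using D[of \<psi>] by (simp add: power2_eq_square)
    qed
    also have "D \<psi> ^ 2 + N \<psi> ^ 2 = c ^ 2 + k ^ 2 * s ^ 2"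
    proof -
      have "D \<psi> ^ 2 + N \<psi> ^ 2 = (c ^ 2 + k ^ 2 * s ^ 2) * (s ^ 2 + c ^ 2)"
        unfolding D_def N_def s_def[symmetric] c_def[symmetric] by algebra
      then show ?thesis using sc by simp
    qed
    also have "(k - 1) * (c ^ 2 - s ^ 2) * D \<psi> - N \<psi> * (2 * (k - 1) * s * c) = (k - 1) * (c ^ 2 - k * s ^ 2)"
    proof -
      have "(k - 1) * (c ^ 2 - s ^ 2) * D \<psi> - N \<psi> * (2 * (k - 1) * s * c) =
          (k - 1) * (c ^ 2 - k * s ^ 2) * (s ^ 2 + c ^ 2)"
        unfolding D_def N_def s_def[symmetric] c_def[symmetric] by algebra
      then show ?thesis using sc by simp
    qed
    finally have "(F has_real_derivative (1 + (k - 1) * (c ^ 2 - k * s ^ 2) / (c ^ 2 + k ^ 2 * s ^ 2)) / sqrt (A * (A + B))) (at \<psi>)"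
      unfolding F_def by (intro DERIV_cdivide DERIV_add DERIV_ident)
    also have "(1 + (k - 1) * (c ^ 2 - k * s ^ 2) / (c ^ 2 + k ^ 2 * s ^ 2)) / sqrt (A * (A + B)) = 1 / (A + B * sin \<psi> ^ 2)"
    proof -
      have q: "c ^ 2 + k ^ 2 * s ^ 2 = (A + B * s ^ 2) / A"
      proof -
        have "c ^ 2 = 1 - s ^ 2" using sc by simp
        show ?thesis unfolding k(2) \<open>c ^ 2 = 1 - s ^ 2\<close> using A by (simp add: field_simps)
      qed
      have "A + B * s ^ 2 = A * c ^ 2 + (A + B) * s ^ 2"
        using sc by algebra
      moreover have "A * c ^ 2 + (A + B) * s ^ 2 > 0"
        using A AB sc by (cases "s = 0") (auto intro!: add_nonneg_pos)
      ultimately have p: "A + B * s ^ 2 > 0" by simp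
      have "1 + (k - 1) * (c ^ 2 - k * s ^ 2) / (c ^ 2 + k ^ 2 * s ^ 2) =
          (c ^ 2 + k ^ 2 * s ^ 2 + (k - 1) * (c ^ 2 - k * s ^ 2)) / (c ^ 2 + k ^ 2 * s ^ 2)"
      proof -
        have "c ^ 2 + k ^ 2 * s ^ 2 \<noteq> 0" using p A unfolding q by simp
        then show ?thesis by (simp add: add_divide_distrib)
      qed
      also have "c ^ 2 + k ^ 2 * s ^ 2 + (k - 1) * (c ^ 2 - k * s ^ 2) = k * (s ^ 2 + c ^ 2)" by algebra
      also have "\<dots> = k" using sc by simp
      finally have 1: "1 + (k - 1) * (c ^ 2 - k * s ^ 2) / (c ^ 2 + k ^ 2 * s ^ 2) = k * A / (A + B * s ^ 2)"
        unfolding q by simp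
      have "k * A = sqrt (A * (A + B))"
      proof -
        have "A * (A + B) = (A + B) / A * A ^ 2" using A by (simp add: field_simps power2_eq_square)
        then have "sqrt (A * (A + B)) = sqrt ((A + B) / A) * sqrt (A ^ 2)" by (simp only: real_sqrt_mult)
        then show ?thesis using A by (simp add: k_def)
      qed
      then show ?thesis unfolding 1 using A AB by (simp add: s_def)
    qed
    finally show "(F has_vector_derivative 1 / (A + B * sin \<psi> ^ 2)) (at \<psi> within {0..pi/2})"
      using has_real_derivative_iff_has_vector_derivative has_vector_derivative_at_within by blast
  qed (simp add: pi_ge_zero)
  then show ?thesis by (simp add: F_def N_def)
qed

lemma powr_neg_half: "x > 0 \<Longrightarrow> x powr (-1/2) = 1 / sqrt x" for x :: real
proof -
  assume x: "x > 0"
  have "x powr (- (1/2)) = inverse (x powr (1/2))" by (rule powr_minus)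
  also have "x powr (1/2) = sqrt x" using x by (intro powr_half_sqrt) simp
  finally show "x powr (-1/2) = 1 / sqrt x" by (simp only: minus_divide_left inverse_eq_divide)
qed

lemma powr_nat_neg_half: "x > 0 \<Longrightarrow> x powr (real n + (-1/2)) = x ^ n / sqrt x" for x :: real
  unfolding powr_add by (simp only: powr_realpow powr_neg_half times_divide_eq_right mult_1_right)

text \<open>Polynomials in \<open>a\<close> whose coefficients depend on the angles: integrating
  over the angles coefficient by coefficient gives a polynomial in \<open>a\<close> with the same
  bound on the degree.\<close>

definition cont_poly :: "('a::topological_space \<Rightarrow> real poly) \<Rightarrow> bool" where
  "cont_poly P \<longleftrightarrow> (\<forall>i. continuous_on UNIV (\<lambda>x. coeff (P x) i))"

lemma cont_poly_const: "cont_poly (\<lambda>x. p)"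
  by (simp add: cont_poly_def)

lemma cont_poly_pCons: "continuous_on UNIV f \<Longrightarrow> cont_poly P \<Longrightarrow> cont_poly (\<lambda>x. pCons (f x) (P x))"
  unfolding cont_poly_def
proof
  fix i
  assume "continuous_on UNIV f" "\<forall>i. continuous_on UNIV (\<lambda>x. coeff (P x) i)"
  then show "continuous_on UNIV (\<lambda>x. coeff (pCons (f x) (P x)) i)" by (cases i) simp_all
qed

lemma cont_poly_mult: "cont_poly P \<Longrightarrow> cont_poly Q \<Longrightarrow> cont_poly (\<lambda>x. P x * Q x)"
  unfolding cont_poly_def coeff_mult by (intro allI continuous_intros) auto

lemma cont_poly_sum: "(\<And>i. i \<in> A \<Longrightarrow> cont_poly (P i)) \<Longrightarrow> cont_poly (\<lambda>x. \<Sum>i\<in>A. P i x)"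
  unfolding cont_poly_def coeff_sum by (intro allI continuous_intros) auto

lemma cont_poly_power: "cont_poly P \<Longrightarrow> cont_poly (\<lambda>x. P x ^ n)"
  by (induction n) (auto intro: cont_poly_const cont_poly_mult)

lemma integral_cont_poly:
  fixes P :: "'a::euclidean_space \<Rightarrow> real poly"
  assumes "cont_poly P" "\<And>x. degree (P x) \<le> d"
  shows "\<exists>q. degree q \<le> d \<and> (\<forall>a. ((\<lambda>x. poly (P x) a) has_integral poly q a) (cbox l u))"
proof -
  define q where "q = (\<Sum>i\<le>d. monom (integral (cbox l u) (\<lambda>x. coeff (P x) i)) i)"
  have "degree q \<le> d" unfolding q_def
    by (intro degree_sum_le) (auto intro: order.trans[OF degree_monom_le])
  moreover have "((\<lambda>x. poly (P x) a) has_integral poly q a) (cbox l u)" for a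
  proof -
    have "poly (P x) a = (\<Sum>i\<le>d. a ^ i * coeff (P x) i)" for x
      unfolding poly_altdef using assms(2)[of x]
      by (intro sum.mono_neutral_cong_left) (auto simp: coeff_eq_0)
    moreover have "((\<lambda>x. \<Sum>i\<le>d. a ^ i * coeff (P x) i) has_integral
        (\<Sum>i\<le>d. a ^ i * integral (cbox l u) (\<lambda>x. coeff (P x) i))) (cbox l u)"
      using assms(1) unfolding cont_poly_def
      by (intro has_integral_sum has_integral_mult_right integrable_integral integrable_continuous)
         (auto intro: continuous_on_subset)
    moreover have "poly q a = (\<Sum>i\<le>d. a ^ i * integral (cbox l u) (\<lambda>x. coeff (P x) i))"
      by (simp add: q_def poly_sum poly_monom mult.commute)
    ultimately show ?thesis by simp
  qed
  ultimately show ?thesis by blast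
qed

text \<open>With \<open>\<sigma> = a + (1 - a) sin\<^sup>2 \<phi>\<close> and \<open>t = sin\<^sup>2 \<psi>\<close>, the double integral of
  \<open>((\<sigma> - a) \<sigma>)\<^sup>n / (\<sigma> + t)\<close> is evaluated in both orders. It replaces the integral over
  \<open>a < \<sigma> < 1\<close> by one over the other real cycle \<open>-1 < \<sigma> < 0\<close> of the elliptic curve,
  up to a polynomial in \<open>a\<close>, and there the integrand is smooth in \<open>a\<close>.\<close>

lemma period_transform:
  "\<exists>q. degree q \<le> 2 * N + 1 \<and> (\<forall>a\<in>U01. Mf 0 (2 * N + 2) (2 * N + 2) 0 a =
     poly q a + 2 * kint (\<lambda>\<psi>. (sin \<psi> ^ 2) ^ (N + 1) * (1 + sin \<psi> ^ 2) powr (-1/2)) (real N + 1/2) a)"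
proof -
  define n where "n = N + 1"
  define s :: "real \<times> real \<Rightarrow> real" where "s x = sin (fst x) ^ 2" for x
  define t :: "real \<times> real \<Rightarrow> real" where "t x = sin (snd x) ^ 2" for x
  \<comment> \<open>\<open>X\<close> and \<open>Y\<close> are \<open>(\<sigma> - a) \<sigma>\<close>
    and \<open>(t + a) t\<close> as polynomials in \<open>a\<close>. Since
    \<open>X - Y = (\<sigma> + t) (\<sigma> - t - a)\<close>, the denominator
    \<open>\<sigma> + t\<close> divides \<open>X ^ n - Y ^ n\<close>, and \<open>P\<close> is the
    quotient.\<close>
  define X where "X x = [:s x, - s x:] * [:s x, 1 - s x:]" for x
  define Y where "Y x = [:t x ^ 2, t x:]" for x
  define P where "P x = [:s x - t x, - s x:] * (\<Sum>i<n. Y x ^ (n - Suc i) * X x ^ i)" for x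
  have cs: "continuous_on UNIV s" "continuous_on UNIV t"
    unfolding s_def t_def by (intro continuous_intros)+
  have cP: "cont_poly P"
    unfolding P_def X_def Y_def
    by (intro cont_poly_mult cont_poly_sum cont_poly_power cont_poly_pCons cont_poly_const continuous_intros cs)
  have dX: "degree (X x) \<le> 2" for x
    unfolding X_def by (rule order.trans[OF degree_mult_le]) (auto intro!: order.trans[OF add_mono[OF degree_pCons_le degree_pCons_le]])
  have dY: "degree (Y x) \<le> 1" for x
    unfolding Y_def by (rule order.trans[OF degree_pCons_le]) simp
  have dP: "degree (P x) \<le> 2 * N + 1" for x
  proof -
    have "degree (Y x ^ (n - Suc i) * X x ^ i) \<le> 2 * N" if "i \<in> {..<n}" for i
    proof -
      have "degree (Y x ^ (n - Suc i) * X x ^ i) \<le> degree (Y x ^ (n - Suc i)) + degree (X x ^ i)"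
        by (rule degree_mult_le)
      also have "\<dots> \<le> 1 * (n - Suc i) + 2 * i"
        using degree_power_le[of "Y x" "n - Suc i"] degree_power_le[of "X x" i] dX[of x] dY[of x]
        by (intro add_mono) (meson le_trans mult_le_mono1)+
      also have "\<dots> \<le> 2 * N" using that by (simp add: n_def)
      finally show ?thesis .
    qed
    then have "degree (\<Sum>i<n. Y x ^ (n - Suc i) * X x ^ i) \<le> 2 * N" by (intro degree_sum_le) auto
    moreover have "degree [:s x - t x, - s x:] \<le> 1" by (rule order.trans[OF degree_pCons_le]) simp
    ultimately show ?thesis unfolding P_def
      by (intro order.trans[OF degree_mult_le]) linarith
  qed
  obtain q0 where q0: "degree q0 \<le> 2 * N + 1"
    "\<And>a. ((\<lambda>x. poly (P x) a) has_integral poly q0 a) (cbox (0, 0) (pi/2, pi/2))"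
    using integral_cont_poly[OF cP dP] by blast
  have main: "Mf 0 (2 * N + 2) (2 * N + 2) 0 a = poly (smult (4 / pi) q0) a +
      2 * kint (\<lambda>\<psi>. (sin \<psi> ^ 2) ^ (N + 1) * (1 + sin \<psi> ^ 2) powr (-1/2)) (real N + 1/2) a"
    if a: "a \<in> U01" for a
  proof -
    let ?I = "{0..pi/2::real}"
    define x where "x \<phi> = (sg a \<phi> - a) * sg a \<phi>" for \<phi>
    define y where "y \<psi> = (sin \<psi> ^ 2 + a) * sin \<psi> ^ 2" for \<psi> :: real
    have pos: "sg a \<phi> + sin \<psi> ^ 2 > 0" for \<phi> \<psi> using sg_pos[OF a, of \<phi>] by (simp add: add_pos_nonneg)
    have pos': "sg a \<phi> + sin \<psi> ^ 2 \<noteq> 0" for \<phi> \<psi> using pos[of \<phi> \<psi>] by simp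
    define F where "F f = (\<lambda>(\<phi>, \<psi>). f \<phi> \<psi> / (sg a \<phi> + sin \<psi> ^ 2))" for f :: "real \<Rightarrow> real \<Rightarrow> real"
    have cF: "continuous_on A (F f)" if "continuous_on A (\<lambda>z. f (fst z) (snd z))" for f A
      unfolding F_def split_beta using pos' that unfolding sg_def by (intro continuous_intros) auto
    have cx: "continuous_on A (\<lambda>z. x (fst z) ^ n)" "continuous_on A (\<lambda>z. y (snd z) ^ n)"
      for A :: "(real \<times> real) set"
      unfolding x_def y_def sg_def by (intro continuous_intros)+
    have swap: "integral ?I (\<lambda>\<phi>. integral ?I (\<lambda>\<psi>. F f (\<phi>, \<psi>))) = integral (cbox (0, 0) (pi/2, pi/2)) (F f)"
      "integral ?I (\<lambda>\<psi>. integral ?I (\<lambda>\<phi>. F f (\<phi>, \<psi>))) = integral (cbox (0, 0) (pi/2, pi/2)) (F f)"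
      if "continuous_on UNIV (\<lambda>z. f (fst z) (snd z))" for f
    proof -
      have c: "continuous_on (cbox (0, 0) (pi/2, pi/2)) (F f)" by (intro cF continuous_on_subset[OF that]) simp
      show 1: "integral ?I (\<lambda>\<phi>. integral ?I (\<lambda>\<psi>. F f (\<phi>, \<psi>))) = integral (cbox (0, 0) (pi/2, pi/2)) (F f)"
        using integral_integrable_2dim[OF c] integral_prod_continuous[of "(0::real)" "0::real" "pi/2" "pi/2" "F f"] c by simp
      show "integral ?I (\<lambda>\<psi>. integral ?I (\<lambda>\<phi>. F f (\<phi>, \<psi>))) = integral (cbox (0, 0) (pi/2, pi/2)) (F f)"
        using integral_swap_continuous[of "0::real" "0::real" "pi/2" "pi/2" "\<lambda>u v. F f (u, v)"] c 1 by simp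
    qed
    have inner1: "integral ?I (\<lambda>\<psi>. F (\<lambda>\<phi> \<psi>. x \<phi> ^ n) (\<phi>, \<psi>)) =
        pi / 2 * (x \<phi> ^ n / sqrt (sg a \<phi> * (sg a \<phi> + 1)))" for \<phi>
    proof -
      have "((\<lambda>\<psi>. x \<phi> ^ n * (1 / (sg a \<phi> + 1 * sin \<psi> ^ 2))) has_integral
          x \<phi> ^ n * (pi / (2 * sqrt (sg a \<phi> * (sg a \<phi> + 1))))) ?I"
        using sg_pos[OF a, of \<phi>] by (intro has_integral_mult_right integral_inverse_sin2) auto
      then show ?thesis by (simp add: F_def integral_unique mult_ac)
    qed
    \<comment> \<open>As a function of \<open>\<phi>\<close> the denominator is
      \<open>(t + a) + (1 - a) sin\<^sup>2 \<phi>\<close>, so its value \<open>A + B\<close> at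
      \<open>pi/2\<close> is \<open>1 + t\<close>, free of \<open>a\<close>; this produces the
      weight \<open>(1 + t) powr (-1/2)\<close>.\<close>
    have inner2: "integral ?I (\<lambda>\<phi>. F (\<lambda>\<phi> \<psi>. y \<psi> ^ n) (\<phi>, \<psi>)) =
        pi / 2 * (y \<psi> ^ n / sqrt ((sin \<psi> ^ 2 + a) * (1 + sin \<psi> ^ 2)))" for \<psi>
    proof -
      have p: "sin \<psi> ^ 2 + a > 0" using a sin2_pos by auto
      have "((\<lambda>\<phi>. y \<psi> ^ n * (1 / ((sin \<psi> ^ 2 + a) + (1 - a) * sin \<phi> ^ 2))) has_integral
          y \<psi> ^ n * (pi / (2 * sqrt ((sin \<psi> ^ 2 + a) * ((sin \<psi> ^ 2 + a) + (1 - a)))))) ?I"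
        using p by (intro has_integral_mult_right integral_inverse_sin2) (auto intro!: add_nonneg_pos)
      moreover have "(sin \<psi> ^ 2 + a) + (1 - a) = 1 + sin \<psi> ^ 2" by simp
      moreover have "(sin \<psi> ^ 2 + a) + (1 - a) * sin \<phi> ^ 2 = sg a \<phi> + sin \<psi> ^ 2" for \<phi>
        by (simp add: sg_def)
      ultimately show ?thesis by (simp add: F_def integral_unique mult_ac)
    qed
    have split: "F (\<lambda>\<phi> \<psi>. x \<phi> ^ n) z = F (\<lambda>\<phi> \<psi>. y \<psi> ^ n) z + poly (P z) a" for z
    proof -
      obtain \<phi> \<psi> where z: "z = (\<phi>, \<psi>)" by (cases z)
      have "x \<phi> ^ n - y \<psi> ^ n = (x \<phi> - y \<psi>) * (\<Sum>i<n. y \<psi> ^ (n - Suc i) * x \<phi> ^ i)"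
        by (rule power_diff_sumr2)
      also have "x \<phi> - y \<psi> = (sg a \<phi> + sin \<psi> ^ 2) * (sg a \<phi> - sin \<psi> ^ 2 - a)"
        unfolding x_def y_def by algebra
      finally have "(x \<phi> ^ n - y \<psi> ^ n) / (sg a \<phi> + sin \<psi> ^ 2) =
          (sg a \<phi> - sin \<psi> ^ 2 - a) * (\<Sum>i<n. y \<psi> ^ (n - Suc i) * x \<phi> ^ i)"
        using pos'[of \<phi> \<psi>] by simp
      moreover have "poly (X z) a = x \<phi>"
        by (simp add: X_def x_def z s_def sg_def algebra_simps)
      moreover have "poly (Y z) a = y \<psi>"
        by (simp add: Y_def y_def z t_def algebra_simps power2_eq_square)
      moreover have "poly [:s z - t z, - s z:] a = sg a \<phi> - sin \<psi> ^ 2 - a"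
        by (simp add: z s_def t_def sg_def algebra_simps)
      ultimately show ?thesis
        unfolding P_def poly_mult poly_sum poly_power by (simp add: F_def z diff_divide_distrib)
    qed
    have "integral (cbox (0, 0) (pi/2, pi/2)) (F (\<lambda>\<phi> \<psi>. x \<phi> ^ n)) =
        integral (cbox (0, 0) (pi/2, pi/2)) (\<lambda>z. F (\<lambda>\<phi> \<psi>. y \<psi> ^ n) z + poly (P z) a)"
      by (intro integral_cong split)
    also have "\<dots> = integral (cbox (0, 0) (pi/2, pi/2)) (F (\<lambda>\<phi> \<psi>. y \<psi> ^ n)) + poly q0 a"
    proof -
      have i1: "F (\<lambda>\<phi> \<psi>. y \<psi> ^ n) integrable_on cbox (0, 0) (pi/2, pi/2)"
        by (intro integrable_continuous cF cx)
      show ?thesis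
        unfolding Henstock_Kurzweil_Integration.integral_add[OF i1 has_integral_integrable[OF q0(2)]]
          integral_unique[OF q0(2)] ..
    qed
    finally have "integral ?I (\<lambda>\<phi>. pi / 2 * (x \<phi> ^ n / sqrt (sg a \<phi> * (sg a \<phi> + 1)))) =
        integral ?I (\<lambda>\<psi>. pi / 2 * (y \<psi> ^ n / sqrt ((sin \<psi> ^ 2 + a) * (1 + sin \<psi> ^ 2)))) + poly q0 a"
      unfolding swap(1)[of "\<lambda>\<phi> \<psi>. x \<phi> ^ n", OF cx(1), symmetric]
        swap(2)[of "\<lambda>\<phi> \<psi>. y \<psi> ^ n", OF cx(2), symmetric] inner1 inner2 .
    then have pq: "pi / 2 * integral ?I (\<lambda>\<phi>. x \<phi> ^ n / sqrt (sg a \<phi> * (sg a \<phi> + 1))) =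
        pi / 2 * integral ?I (\<lambda>\<psi>. y \<psi> ^ n / sqrt ((sin \<psi> ^ 2 + a) * (1 + sin \<psi> ^ 2))) + poly q0 a"
      by (simp only: integral_mult_right)
    have "pi / 2 * u = pi / 2 * v + w \<Longrightarrow> 2 * u = 2 * v + 4 / pi * w" for u v w :: real
      by (simp add: field_simps)
    from this[OF pq]
    have eq: "2 * integral ?I (\<lambda>\<phi>. x \<phi> ^ n / sqrt (sg a \<phi> * (sg a \<phi> + 1))) =
        2 * integral ?I (\<lambda>\<psi>. y \<psi> ^ n / sqrt ((sin \<psi> ^ 2 + a) * (1 + sin \<psi> ^ 2))) + 4 / pi * poly q0 a" .
    have "Mf 0 (2 * N + 2) (2 * N + 2) 0 a = 2 * integral ?I (\<lambda>\<phi>. x \<phi> ^ n / sqrt (sg a \<phi> * (sg a \<phi> + 1)))"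
    proof -
      have pw: "(1 - a) powr ((real (2 * N + 2) + real 0) / 2) = (1 - a) ^ n"
      proof -
        have "(real (2 * N + 2) + real 0) / 2 = real n" by (simp add: n_def)
        then show ?thesis using a by (simp add: powr_realpow)
      qed
      have "(1 - a) ^ n * (sin \<phi> ^ (2 * N + 2) * cos \<phi> ^ 0 * (sg a \<phi> powr (real (2 * N + 2) - real 0 - (real (2 * N + 2) + 1) / 2) *
          (1 + sg a \<phi>) powr ((real 0 - 1) / 2))) = x \<phi> ^ n / sqrt (sg a \<phi> * (sg a \<phi> + 1))" for \<phi>
      proof -
        have sp: "sg a \<phi> > 0" by (rule sg_pos[OF a])
        have e: "real (2 * N + 2) - real 0 - (real (2 * N + 2) + 1) / 2 = real n + (-1/2)"
          by (simp add: n_def field_simps)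
        have "sg a \<phi> powr (real n + (-1/2)) = sg a \<phi> ^ n / sqrt (sg a \<phi>)"
          by (rule powr_nat_neg_half[OF sp])
        moreover have "(1 + sg a \<phi>) powr ((real 0 - 1) / 2) = 1 / sqrt (1 + sg a \<phi>)"
          using powr_neg_half[of "1 + sg a \<phi>"] sp by simp
        moreover have "sin \<phi> ^ (2 * N + 2) = (sin \<phi> ^ 2) ^ n"
        proof -
          have "2 * N + 2 = 2 * n" by (simp add: n_def)
          then show ?thesis by (simp only: power_mult)
        qed
        moreover have "x \<phi> = (1 - a) * sin \<phi> ^ 2 * sg a \<phi>" by (simp add: x_def sg_def)
        moreover have "sqrt (sg a \<phi> * (sg a \<phi> + 1)) = sqrt (sg a \<phi>) * sqrt (1 + sg a \<phi>)"
          by (simp only: real_sqrt_mult add.commute)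
        ultimately show ?thesis unfolding e
          by (simp only: power_mult_distrib) simp
      qed
      then show ?thesis unfolding Mf_def Fn_def FnI_def pw
        by (simp flip: integral_mult_right)
    qed
    moreover have "kint (\<lambda>\<psi>. (sin \<psi> ^ 2) ^ (N + 1) * (1 + sin \<psi> ^ 2) powr (-1/2)) (real N + 1/2) a =
       integral ?I (\<lambda>\<psi>. y \<psi> ^ n / sqrt ((sin \<psi> ^ 2 + a) * (1 + sin \<psi> ^ 2)))"
      unfolding kint_def
    proof (rule integral_cong)
      fix \<psi> :: real
      have p: "sin \<psi> ^ 2 + a > 0" "1 + sin \<psi> ^ 2 > (0::real)" using a sin2_pos sin2_pos[of 1] by (auto simp: add.commute)
      have e: "real N + 1/2 = real n + (-1/2)" by (simp add: n_def)
      have "(sin \<psi> ^ 2 + a) powr (real N + 1/2) = (sin \<psi> ^ 2 + a) ^ n / sqrt (sin \<psi> ^ 2 + a)"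
        unfolding e by (rule powr_nat_neg_half[OF p(1)])
      moreover have "(1 + sin \<psi> ^ 2) powr (-1/2) = 1 / sqrt (1 + sin \<psi> ^ 2)"
        by (rule powr_neg_half[OF p(2)])
      ultimately show "(sin \<psi> ^ 2) ^ (N + 1) * (1 + sin \<psi> ^ 2) powr (-1/2) * (sin \<psi> ^ 2 + a) powr (real N + 1/2) =
          y \<psi> ^ n / sqrt ((sin \<psi> ^ 2 + a) * (1 + sin \<psi> ^ 2))"
        unfolding y_def n_def by (simp only: power_mult_distrib real_sqrt_mult) (simp add: mult_ac)
    qed
    ultimately show ?thesis using eq by simp
  qed
  show ?thesis
    by (rule exI[of _ "smult (4 / pi) q0"]) (use q0(1) main in \<open>auto intro: order.trans[OF degree_smult_le]\<close>)
qed

section \<open>Killing the elementary terms and bounding the zeros in \<open>a\<close>\<close>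

section \<open>Annihilating operators\<close>

lemma zeros_le_subset: "zeros_le T f k \<Longrightarrow> S \<subseteq> T \<Longrightarrow> zeros_le S f k"
  unfolding zeros_le_def by (meson subset_iff)

lemma theta_pow_cong:
  assumes "\<And>x. x \<in> U01 \<Longrightarrow> f x = g x" "a \<in> U01"
  shows "(theta ^^ k) f a = (theta ^^ k) g a"
  using assms(2)
proof (induction k arbitrary: a)
  case (Suc k)
  then show ?case using theta_cong[OF Suc.IH Suc.prems] by simp
qed (use assms in simp)

lemma theta_span_cong_left:
  assumes "theta_span d F f" "\<And>a. a \<in> U01 \<Longrightarrow> F a = G a"
  shows "theta_span d G f"
proof -
  obtain c where c: "\<And>a. a \<in> U01 \<Longrightarrow> f a = (\<Sum>i\<le>d. c i * (theta ^^ i) F a)"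
    using theta_spanE[OF assms(1)] by blast
  show ?thesis
    by (rule theta_spanI[where c = c]) (simp only: c theta_pow_cong[OF assms(2)])
qed

lemma theta_span_cmult_left:
  assumes "smooth U01 F" "theta_span d (\<lambda>a. c * F a) f"
  shows "theta_span d F f"
proof -
  have "theta_span 0 F (\<lambda>a. c * F a)" by (rule theta_spanI[where c = "\<lambda>_. c"]) simp
  from theta_span_trans[OF assms(1) this assms(2)] show ?thesis by simp
qed

lemma theta_pow_powr_poly:
  "\<exists>P. degree P \<le> i \<and> (\<forall>a\<in>U01. (theta ^^ i) (\<lambda>a. (1 - a) powr b) a = (1 - a) powr (b - real i) * poly P a)"
proof (induction i)
  case 0
  show ?case by (rule exI[of _ 1]) simp
next
  case (Suc i)
  then obtain P where P: "degree P \<le> i"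
    "\<And>a. a \<in> U01 \<Longrightarrow> (theta ^^ i) (\<lambda>a. (1 - a) powr b) a = (1 - a) powr (b - real i) * poly P a" by auto
  define R where "R = [:0, 1:] * (smult (- (b - real i)) P + [:1, -1:] * pderiv P)"
  have "degree (smult (- (b - real i)) P + [:1, -1:] * pderiv P) \<le> i"
  proof (rule degree_add_le)
    show "degree (smult (- (b - real i)) P) \<le> i" using P(1) degree_smult_le order.trans by blast
    show "degree ([:1, -1:] * pderiv P) \<le> i"
    proof (cases "pderiv P = 0")
      case False
      then have "degree P \<noteq> 0" using pderiv_eq_0_iff by blast
      moreover have "degree ([:1, -1:] * pderiv P) \<le> degree [:1, -1::real:] + degree (pderiv P)"
        by (rule degree_mult_le)
      ultimately show ?thesis using P(1) by (simp add: degree_pderiv)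
    qed simp
  qed
  then have dR: "degree R \<le> Suc i" unfolding R_def
    using degree_mult_le[of "[:0, 1::real:]"] order.trans by fastforce
  have "(theta ^^ Suc i) (\<lambda>a. (1 - a) powr b) a = (1 - a) powr (b - real (Suc i)) * poly R a" if a: "a \<in> U01" for a
  proof -
    have "(theta ^^ Suc i) (\<lambda>a. (1 - a) powr b) a = theta (\<lambda>a. (1 - a) powr (b - real i) * poly P a) a"
      using theta_cong[OF P(2) a] by simp
    also have "deriv (\<lambda>a. (1 - a) powr (b - real i) * poly P a) a =
        (- (b - real i) * (1 - a) powr (b - real i - 1)) * poly P a + poly (pderiv P) a * (1 - a) powr (b - real i)"
      using a by (intro DERIV_imp_deriv DERIV_mult poly_DERIV)
        (auto intro!: derivative_eq_intros simp: algebra_simps)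
    then have "theta (\<lambda>a. (1 - a) powr (b - real i) * poly P a) a =
        a * ((- (b - real i) * (1 - a) powr (b - real i - 1)) * poly P a + poly (pderiv P) a * (1 - a) powr (b - real i))"
      by (simp only: theta_def)
    also have "(1 - a) powr (b - real i) = (1 - a) * (1 - a) powr (b - real i - 1)"
      using a by (intro powr_step) auto
    also have "b - real i - 1 = b - real (Suc i)" by simp
    finally show ?thesis by (simp add: R_def algebra_simps)
  qed
  then show ?case using dR by blast
qed

text \<open>The \<open>i\<close>-th iterate has the exponent \<open>b - i\<close> and a polynomial
  of degree \<open>i\<close>; passing to the common exponent \<open>b - d\<close> costs the factor
  \<open>(1 - a) ^ (d - i)\<close>, so all degrees stay within \<open>d\<close>.\<close>

lemma theta_span_powr:
  assumes "theta_span d (\<lambda>a. (1 - a) powr b) g"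
  shows "\<exists>P. degree P \<le> d \<and> (\<forall>a\<in>U01. g a = (1 - a) powr (b - real d) * poly P a)"
proof -
  obtain c where c: "\<And>a. a \<in> U01 \<Longrightarrow> g a = (\<Sum>i\<le>d. c i * (theta ^^ i) (\<lambda>a. (1 - a) powr b) a)"
    using theta_spanE[OF assms] by blast
  have "\<forall>i. \<exists>P. degree P \<le> i \<and> (\<forall>a\<in>U01. (theta ^^ i) (\<lambda>a. (1 - a) powr b) a = (1 - a) powr (b - real i) * poly P a)"
    using theta_pow_powr_poly by blast
  then obtain P where P: "\<And>i. degree (P i) \<le> i"
    "\<And>i a. a \<in> U01 \<Longrightarrow> (theta ^^ i) (\<lambda>a. (1 - a) powr b) a = (1 - a) powr (b - real i) * poly (P i) a"
    by metis
  define Q where "Q = (\<Sum>i\<le>d. smult (c i) ([:1, -1:] ^ (d - i) * P i))"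
  have "degree Q \<le> d" unfolding Q_def
  proof (rule degree_sum_le)
    fix i assume i: "i \<in> {..d}"
    have "degree ([:1, -1::real:] ^ (d - i) * P i) \<le> degree ([:1, -1::real:] ^ (d - i)) + degree (P i)"
      by (rule degree_mult_le)
    also have "\<dots> \<le> (d - i) + i"
      using degree_power_le[of "[:1, -1::real:]" "d - i"] P(1)[of i] by simp
    finally have "degree ([:1, -1::real:] ^ (d - i) * P i) \<le> d" using i by simp
    then show "degree (smult (c i) ([:1, -1:] ^ (d - i) * P i)) \<le> d" using degree_smult_le order.trans by blast
  qed simp
  moreover have "g a = (1 - a) powr (b - real d) * poly Q a" if a: "a \<in> U01" for a
  proof -
    have "(1 - a) powr (b - real i) = (1 - a) powr (b - real d) * (1 - a) ^ (d - i)" if "i \<le> d" for i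
    proof -
      have "(1 - a) powr (b - real i) = (1 - a) powr ((b - real d) + real (d - i))"
        using that by (simp add: of_nat_diff)
      also have "\<dots> = (1 - a) powr (b - real d) * (1 - a) ^ (d - i)"
        unfolding powr_add using a by (simp add: powr_realpow)
      finally show ?thesis .
    qed
    note pw = this
    have "c i * ((1 - a) powr (b - real i) * poly (P i) a) =
        (1 - a) powr (b - real d) * poly (smult (c i) ([:1, -1:] ^ (d - i) * P i)) a" if "i \<in> {..d}" for i
    proof -
      have "poly [:1, -1:] a = 1 - a" by simp
      then show ?thesis using pw[of i] that by (simp only: poly_smult poly_mult poly_power atMost_iff mult_ac)
    qed
    then show ?thesis
      unfolding c[OF a] P(2)[OF a] Q_def poly_sum sum_distrib_left by (intro sum.cong refl)
  qed
  ultimately show ?thesis by blast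
qed

text \<open>\<open>theta\<close> differentiates and multiplies by \<open>a\<close>, so it does not
  raise the degree, whatever \<open>d\<close> is.\<close>

lemma theta_span_poly:
  assumes "theta_span d (poly q) g"
  shows "\<exists>P. degree P \<le> degree q \<and> (\<forall>a\<in>U01. g a = poly P a)"
proof -
  obtain c where c: "\<And>a. a \<in> U01 \<Longrightarrow> g a = (\<Sum>i\<le>d. c i * (theta ^^ i) (poly q) a)"
    using theta_spanE[OF assms] by blast
  define R where "R = (\<lambda>p::real poly. [:0, 1:] * pderiv p)"
  have t: "theta (poly p) = poly (R p)" for p
  proof
    fix x have "deriv (poly p) x = poly (pderiv p) x" by (intro DERIV_imp_deriv poly_DERIV)
    then show "theta (poly p) x = poly (R p) x" by (simp add: theta_def R_def)
  qed
  have dR: "degree (R p) \<le> degree p" for p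
  proof (cases "pderiv p = 0")
    case False
    then have "degree p \<noteq> 0" using pderiv_eq_0_iff by blast
    then show ?thesis unfolding R_def using degree_mult_le[of "[:0, 1::real:]" "pderiv p"] by (simp add: degree_pderiv)
  qed (simp add: R_def)
  have ti: "(theta ^^ i) (poly q) = poly ((R ^^ i) q)" for i by (induction i) (simp_all add: t)
  have di: "degree ((R ^^ i) q) \<le> degree q" for i by (induction i) (auto intro: order.trans[OF dR])
  define P where "P = (\<Sum>i\<le>d. smult (c i) ((R ^^ i) q))"
  have "degree P \<le> degree q" unfolding P_def
    by (intro degree_sum_le) (use di degree_smult_le order.trans in blast)+
  moreover have "g a = poly P a" if "a \<in> U01" for a
    unfolding c[OF that] P_def by (simp add: poly_sum ti)
  ultimately show ?thesis by blast
qed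

lemma theta_span_split:
  assumes "smooth U01 F" "smooth U01 G" "theta_span d (\<lambda>a. \<alpha> * F a + \<beta> * G a) f"
  shows "\<exists>f1 f2. theta_span d F f1 \<and> theta_span d G f2 \<and> (\<forall>a\<in>U01. f a = f1 a + f2 a)"
proof -
  obtain c where c: "\<And>a. a \<in> U01 \<Longrightarrow> f a = (\<Sum>i\<le>d. c i * (theta ^^ i) (\<lambda>a. \<alpha> * F a + \<beta> * G a) a)"
    using theta_spanE[OF assms(3)] by blast
  let ?f1 = "\<lambda>a. \<Sum>i\<le>d. (c i * \<alpha>) * (theta ^^ i) F a"
  let ?f2 = "\<lambda>a. \<Sum>i\<le>d. (c i * \<beta>) * (theta ^^ i) G a"
  have "theta_span d F ?f1" "theta_span d G ?f2" by (rule theta_spanI, rule refl)+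
  moreover have "f a = ?f1 a + ?f2 a" if "a \<in> U01" for a
    unfolding c[OF that] theta_pow_lincomb[OF assms(1,2) that] by (simp add: distrib_left sum.distrib mult.assoc)
  ultimately show ?thesis by blast
qed

definition wgt :: "nat \<Rightarrow> nat \<Rightarrow> real \<Rightarrow> real" where
  "wgt N j \<psi> = (sin \<psi> ^ 2) ^ (N + 1 + j) * (1 + sin \<psi> ^ 2) powr (-1/2)"

lemma sin2_1_neq: "1 + sin \<psi> ^ 2 \<noteq> (0::real)"
  using sin2_pos[of 1 \<psi>] by (simp add: add.commute)

lemma continuous_wgt: "continuous_on A (wgt N j)"
  unfolding wgt_def using sin2_1_neq by (intro continuous_intros) auto

text \<open>The power \<open>t ^ j\<close> in the weight accompanies the exponent lowered by
  \<open>j\<close>, as this is what iterating \<open>theta\<close> produces. It is also the power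
  that \<open>j\<close> integrations by parts consume.\<close>

definition Xf :: "nat \<Rightarrow> nat \<Rightarrow> real \<Rightarrow> real" where
  "Xf N j = kint (wgt N j) ((2 * real N + 1) / 2 - real j)"

lemma smooth_Xf: "smooth U01 (Xf N j)"
  unfolding Xf_def by (rule smooth_subset[OF smooth_kint[OF continuous_wgt]]) auto

text \<open>\<open>a = (t + a) - t\<close> under the integral of the derivative: the first part
  restores the exponent, the second raises the power of \<open>t\<close>.\<close>

lemma theta_Xf:
  assumes "a \<in> U01"
  shows "theta (Xf N j) a = ((2 * real N + 1) / 2 - real j) * (Xf N j a - Xf N (Suc j) a)"
proof -
  define z where "z = (2 * real N + 1) / 2 - real j"
  have a: "a > 0" using assms by simp
  have z1: "(2 * real N + 1) / 2 - real (Suc j) = z - 1" by (simp add: z_def)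
  have "deriv (kint (wgt N j) z) a = z * kint (wgt N j) (z - 1) a"
    by (intro DERIV_imp_deriv kint_has_deriv continuous_wgt a)
  moreover have "a * kint (wgt N j) (z - 1) a = kint (wgt N j) z a - kint (wgt N (Suc j)) (z - 1) a"
  proof -
    have "kint (wgt N j) z a - kint (wgt N (Suc j)) (z - 1) a =
        integral {0..pi/2} (\<lambda>\<psi>. wgt N j \<psi> * (sin \<psi> ^ 2 + a) powr z - wgt N (Suc j) \<psi> * (sin \<psi> ^ 2 + a) powr (z - 1))"
      unfolding kint_def
      by (rule Henstock_Kurzweil_Integration.integral_diff[symmetric]) (intro kint_integrable continuous_wgt a)+
    also have "\<dots> = integral {0..pi/2} (\<lambda>\<psi>. a * (wgt N j \<psi> * (sin \<psi> ^ 2 + a) powr (z - 1)))"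
    proof (rule integral_cong)
      fix \<psi> :: real
      have 1: "(sin \<psi> ^ 2 + a) powr z = (sin \<psi> ^ 2 + a) * (sin \<psi> ^ 2 + a) powr (z - 1)"
        by (rule powr_step[OF sin2_pos[OF a]])
      have 2: "wgt N (Suc j) \<psi> = sin \<psi> ^ 2 * wgt N j \<psi>" by (simp add: wgt_def)
      show "wgt N j \<psi> * (sin \<psi> ^ 2 + a) powr z - wgt N (Suc j) \<psi> * (sin \<psi> ^ 2 + a) powr (z - 1) =
          a * (wgt N j \<psi> * (sin \<psi> ^ 2 + a) powr (z - 1))"
        unfolding 1 2 by algebra
    qed
    also have "\<dots> = a * kint (wgt N j) (z - 1) a"
      unfolding kint_def by (rule integral_mult_right)
    finally show ?thesis ..
  qed
  ultimately show ?thesis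
    unfolding theta_def Xf_def z_def[symmetric] z1 by (simp only: mult.left_commute[of a])
qed

lemma theta_span_Xf:
  assumes "theta_span d (Xf N 0) g"
  shows "\<exists>c. \<forall>a\<in>U01. g a = (\<Sum>j\<le>d. c j * Xf N j a)"
proof -
  define V where "V k f \<longleftrightarrow> (\<exists>c. \<forall>a\<in>U01. f a = (\<Sum>j\<le>k. c j * Xf N j a))" for k f
  have V_mono: "V k' f" if "V k f" "k \<le> k'" for k k' f
  proof -
    obtain c where c: "\<And>a. a \<in> U01 \<Longrightarrow> f a = (\<Sum>j\<le>k. c j * Xf N j a)" using \<open>V k f\<close> unfolding V_def by auto
    have "(\<Sum>j\<le>k. c j * Xf N j a) = (\<Sum>j\<le>k'. (if j \<le> k then c j else 0) * Xf N j a)" for a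
      using \<open>k \<le> k'\<close> by (intro sum.mono_neutral_cong_left) auto
    then show ?thesis unfolding V_def using c by (intro exI[of _ "\<lambda>j. if j \<le> k then c j else 0"]) simp
  qed
  have V_theta: "V (Suc k) (theta f)" if "V k f" for k f
  proof -
    obtain c where c: "\<And>a. a \<in> U01 \<Longrightarrow> f a = (\<Sum>j\<le>k. c j * Xf N j a)" using \<open>V k f\<close> unfolding V_def by auto
    define e where "e j = c j * ((2 * real N + 1) / 2 - real j)" for j
    have "theta f a = (\<Sum>j\<le>Suc k. ((if j \<le> k then e j else 0) - (if j = 0 then 0 else e (j - 1))) * Xf N j a)"
      if a: "a \<in> U01" for a
    proof -
      have "theta f a = (\<Sum>j\<le>k. c j * theta (Xf N j) a)"
        using theta_cong[OF c a] theta_sum[of "{..k}" "Xf N" a c, OF smooth_Xf a] by simp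
      also have "c j * theta (Xf N j) a = e j * Xf N j a - e j * Xf N (Suc j) a" for j
        unfolding theta_Xf[OF a] e_def by algebra
      then have "(\<Sum>j\<le>k. c j * theta (Xf N j) a) = (\<Sum>j\<le>k. e j * Xf N j a) - (\<Sum>j\<le>k. e j * Xf N (Suc j) a)"
        by (simp only: sum_subtractf)
      also have "(\<Sum>j\<le>k. e j * Xf N (Suc j) a) = (\<Sum>j\<le>Suc k. (if j = 0 then 0 else e (j - 1)) * Xf N j a)"
        by (subst sum.atMost_Suc_shift) simp
      also have "(\<Sum>j\<le>k. e j * Xf N j a) = (\<Sum>j\<le>Suc k. (if j \<le> k then e j else 0) * Xf N j a)"
        by simp
      finally show ?thesis by (simp only: left_diff_distrib sum_subtractf)
    qed
    then show ?thesis unfolding V_def by (intro exI ballI)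
  qed
  have "V i ((theta ^^ i) (Xf N 0))" for i
  proof (induction i)
    case 0
    show ?case unfolding V_def by (rule exI[of _ "\<lambda>_. 1"]) simp
  qed (use V_theta in simp)
  then have Vi: "V d ((theta ^^ i) (Xf N 0))" if "i \<le> d" for i using V_mono that by blast
  then obtain e where e: "\<And>i a. i \<le> d \<Longrightarrow> a \<in> U01 \<Longrightarrow> (theta ^^ i) (Xf N 0) a = (\<Sum>j\<le>d. e i j * Xf N j a)"
    unfolding V_def by metis
  obtain c where c: "\<And>a. a \<in> U01 \<Longrightarrow> g a = (\<Sum>i\<le>d. c i * (theta ^^ i) (Xf N 0) a)"
    using theta_spanE[OF assms] by blast
  have "g a = (\<Sum>j\<le>d. (\<Sum>i\<le>d. c i * e i j) * Xf N j a)" if a: "a \<in> U01" for a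
  proof -
    have "g a = (\<Sum>i\<le>d. \<Sum>j\<le>d. c i * e i j * Xf N j a)"
      unfolding c[OF a] by (intro sum.cong) (simp_all add: e[OF _ a] sum_distrib_left mult.assoc)
    also have "\<dots> = (\<Sum>j\<le>d. \<Sum>i\<le>d. c i * e i j * Xf N j a)" by (rule sum.swap)
    finally show ?thesis by (simp add: sum_distrib_right)
  qed
  then show ?thesis by (intro exI ballI)
qed

text \<open>The innermost derivative kills \<open>(1 - a) powr (-D/2) * E(a)\<close>, the middle one kills what is then
  left of \<open>p(a)\<close>, for polynomials \<open>E\<close> and \<open>p\<close> of degree at most \<open>D\<close>. The exponents are such that Bol's
  lemma applies to \<open>(t + a) powr (D/2)\<close> at all three stages.\<close>

definition annih :: "nat \<Rightarrow> (real \<Rightarrow> real) \<Rightarrow> real \<Rightarrow> real" where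
  "annih D f = (deriv ^^ D) (\<lambda>a. (1 + a) powr (5 * real D / 2 + 1) *
     (deriv ^^ (D + 1)) (\<lambda>a. (1 - a) powr (real D / 2 + 1) *
       (deriv ^^ (D + 1)) (\<lambda>a. (1 - a) powr (real D / 2) * f a) a) a)"

lemma smooth_1pm: "smooth U01 (\<lambda>a. (1 + a) powr z)" "smooth U01 (\<lambda>a. (1 - a) powr z)"
  by (intro smooth_intros; simp)+

lemma diff_op_annih: "diff_op U01 (annih D)"
  unfolding annih_def[abs_def]
  by (intro diff_op_higher_deriv diff_op_mult diff_op_ident smooth_1pm) auto

text \<open>Every derivative costs one zero and the powers cost none, which makes
  \<open>D + (D + 1) + (D + 1)\<close>.\<close>

lemma zeros_le_annih:
  assumes f: "smooth U01 f" and "zeros_le U01 (annih D f) k"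
  shows "zeros_le U01 f (k + (3 * D + 2))"
proof -
  let ?f1 = "\<lambda>a. (1 - a) powr (real D / 2) * f a"
  let ?f2 = "\<lambda>a. (1 - a) powr (real D / 2 + 1) * (deriv ^^ (D + 1)) ?f1 a"
  let ?f3 = "\<lambda>a. (1 + a) powr (5 * real D / 2 + 1) * (deriv ^^ (D + 1)) ?f2 a"
  have s1: "smooth U01 ?f1" by (intro smooth_mult smooth_1pm f)
  have d1: "smooth U01 ((deriv ^^ (D + 1)) ?f1)" by (intro smooth_higher_deriv s1) simp
  have s2: "smooth U01 ?f2" by (intro smooth_mult smooth_1pm d1)
  have d2: "smooth U01 ((deriv ^^ (D + 1)) ?f2)" by (intro smooth_higher_deriv s2) simp
  have s3: "smooth U01 ?f3" by (intro smooth_mult smooth_1pm d2)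
  have z3: "zeros_le U01 ?f3 (k + D)"
    using assms(2) unfolding annih_def by (intro zeros_le_higher_deriv s3) auto
  have y2: "zeros_le U01 ((deriv ^^ (D + 1)) ?f2) (k + D)"
    by (rule zeros_le_mult[OF _ d2 smooth_1pm(1) _ z3]) auto
  have z2: "zeros_le U01 ?f2 (k + D + (D + 1))"
    by (rule zeros_le_higher_deriv[OF _ _ s2 y2]) auto
  have y1: "zeros_le U01 ((deriv ^^ (D + 1)) ?f1) (k + D + (D + 1))"
    by (rule zeros_le_mult[OF _ d1 smooth_1pm(2) _ z2]) auto
  have z1: "zeros_le U01 ?f1 (k + D + (D + 1) + (D + 1))"
    by (rule zeros_le_higher_deriv[OF _ _ s1 y1]) auto
  have "zeros_le U01 f (k + D + (D + 1) + (D + 1))"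
    by (rule zeros_le_mult[OF _ f smooth_1pm(2) _ z1]) auto
  then show ?thesis by (rule zeros_le_mono) simp
qed

lemma higher_deriv_eq_0:
  fixes f :: "real \<Rightarrow> real"
  assumes "open S" "\<And>x. x \<in> S \<Longrightarrow> f x = 0" "a \<in> S"
  shows "(deriv ^^ k) f a = 0"
proof -
  have "(deriv ^^ k) (\<lambda>x. 0::real) = (\<lambda>x. 0)" by (induction k) simp_all
  then show ?thesis using higher_deriv_cong_open[of S f "\<lambda>x. 0" a k] assms by simp
qed

text \<open>The pattern common to both elementary terms: whatever the inner stage turns into a
  polynomial of degree at most \<open>D\<close> is killed by the middle derivative. For the term
  with the power of \<open>1 - a\<close> this polynomial is already 0.\<close>

lemma annih_eq_0:
  assumes "\<And>x. x \<in> U01 \<Longrightarrow> (1 - x) powr (real D / 2 + 1) *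
      (deriv ^^ (D + 1)) (\<lambda>a. (1 - a) powr (real D / 2) * f a) x = poly Q x"
    and "degree Q \<le> D" "a \<in> U01"
  shows "annih D f a = 0"
  unfolding annih_def
proof (rule higher_deriv_eq_0[of U01])
  fix x assume x: "x \<in> U01"
  have "(deriv ^^ (D + 1)) (\<lambda>a. (1 - a) powr (real D / 2 + 1) *
      (deriv ^^ (D + 1)) (\<lambda>a. (1 - a) powr (real D / 2) * f a) a) x = (deriv ^^ (D + 1)) (poly Q) x"
    by (rule higher_deriv_cong_open[OF _ assms(1) x]) simp
  also have "\<dots> = 0" using assms(2) by (intro higher_deriv_poly_eq_0) simp
  finally show "(1 + x) powr (5 * real D / 2 + 1) * (deriv ^^ (D + 1)) (\<lambda>a. (1 - a) powr (real D / 2 + 1) *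
      (deriv ^^ (D + 1)) (\<lambda>a. (1 - a) powr (real D / 2) * f a) a) x = 0"
    by (simp only: mult_zero_right)
qed (use assms in auto)

lemma annih_powr_poly:
  assumes "degree P \<le> D" "a \<in> U01"
  shows "annih D (\<lambda>a. (1 - a) powr (- (real D / 2)) * poly P a) a = 0"
proof (rule annih_eq_0[of _ _ 0])
  fix x assume x: "x \<in> U01"
  have 1: "(1 - a) powr (real D / 2) * ((1 - a) powr (- (real D / 2)) * poly P a) = poly P a" if "a \<in> U01" for a
    using that by (simp flip: mult.assoc powr_add)
  have "(deriv ^^ (D + 1)) (\<lambda>a. (1 - a) powr (real D / 2) * ((1 - a) powr (- (real D / 2)) * poly P a)) x
      = (deriv ^^ (D + 1)) (poly P) x"
    by (rule higher_deriv_cong_open[OF _ 1 x]) simp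
  also have "\<dots> = 0" using assms(1) by (intro higher_deriv_poly_eq_0) simp
  finally show "(1 - x) powr (real D / 2 + 1) *
      (deriv ^^ (D + 1)) (\<lambda>a. (1 - a) powr (real D / 2) * ((1 - a) powr (- (real D / 2)) * poly P a)) x = poly 0 x"
    by (simp only: mult_zero_right poly_0)
qed (use assms in auto)

text \<open>The inner derivative leaves \<open>(1 - a) powr (- D/2 - 1)\<close> times a polynomial
  of degree at most \<open>D\<close>; the middle factor \<open>(1 - a) powr (D/2 + 1)\<close> is
  chosen to cancel this power.\<close>

lemma annih_poly:
  assumes "degree P \<le> D" "a \<in> U01"
  shows "annih D (poly P) a = 0"
proof -
  have "\<exists>Q. degree Q \<le> D \<and> (\<forall>a\<in>U01. (deriv ^^ (D + 1)) (\<lambda>x. (1 + (-1) * x) powr (real D / 2) * poly P x) a =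
           (1 + (-1) * a) powr (real D / 2 - real (D + 1)) * poly Q a)"
    using assms(1) by (intro higher_deriv_powr_mult_poly) auto
  then obtain Q where Q: "degree Q \<le> D" "\<forall>a\<in>U01. (deriv ^^ (D + 1)) (\<lambda>x. (1 + (-1) * x) powr (real D / 2) * poly P x) a =
           (1 + (-1) * a) powr (real D / 2 - real (D + 1)) * poly Q a"
    by (elim exE conjE) (rule that)
  show ?thesis
  proof (rule annih_eq_0[OF _ Q(1) assms(2)])
    fix x assume x: "x \<in> U01"
    have e: "1 + (-1) * y = 1 - y" for y :: real by simp
    have "(1 - x) powr (real D / 2 + 1) * ((1 - x) powr (real D / 2 - real (D + 1)) * poly Q x) = poly Q x"
      using x by (simp flip: mult.assoc powr_add)
    then show "(1 - x) powr (real D / 2 + 1) *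
        (deriv ^^ (D + 1)) (\<lambda>a. (1 - a) powr (real D / 2) * poly P a) x = poly Q x"
      using bspec[OF Q(2) x] unfolding e by (simp only:)
  qed
qed

text \<open>The constant \<open>C\<close> must not depend on \<open>t\<close>, since the result is
  later differentiated in \<open>t\<close>. After the inner stage the powers of \<open>1 - a\<close>
  cancel, so the middle derivative acts on a pure power of \<open>t + a\<close>.\<close>

lemma annih_powr:
  "\<exists>C. \<forall>a t. a \<in> U01 \<longrightarrow> t + a > 0 \<longrightarrow> annih D (\<lambda>x. (t + x) powr (real D / 2)) a =
     C * (1 + a) powr (3 * real D / 2 + 1) * ((1 + t) ^ (D + 1) * (t - 1) ^ D * (t + a) powr (- (5 * real D / 2 + 2)))"
proof -
  define c1 where "c1 = ff (real D / 2) (D + 1) * (-1) ^ (D + 1)"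
  define c2 where "c2 = ff (- real D / 2 - 1) (D + 1)"
  define c3 where "c3 = ff (5 * real D / 2 + 1) D"
  have "annih D (\<lambda>x. (t + x) powr (real D / 2)) a =
     (c1 * c2 * c3) * (1 + a) powr (3 * real D / 2 + 1) * ((1 + t) ^ (D + 1) * (t - 1) ^ D * (t + a) powr (- (5 * real D / 2 + 2)))"
    if a: "a \<in> U01" and t: "t + a > 0" for a t
  proof -
    \<comment> \<open>\<open>t\<close> may be negative, since derivatives in \<open>t\<close> need a
      neighbourhood of \<open>{0..1}\<close>; the power of \<open>t + x\<close> is then smooth only
      where \<open>x > - t\<close>.\<close>
    define S where "S = U01 \<inter> {-t<..}"
    have S: "open S" "a \<in> S" using a t by (auto simp: S_def)
    have Sx: "x \<in> U01" "t + x > 0" if "x \<in> S" for x using that by (auto simp: S_def)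
    have 1: "(1 - x) powr (real D / 2 + 1) * (deriv ^^ (D + 1)) (\<lambda>x. (1 - x) powr (real D / 2) * (t + x) powr (real D / 2)) x =
        c1 * (1 + t) ^ (D + 1) * (t + x) powr (- real D / 2 - 1)" if x: "x \<in> S" for x
    proof -
      have e: "1 + (-1) * y = 1 - y" "t + 1 * y = t + y" for y :: real by simp_all
      \<comment> \<open>Here \<open>b = c = D/2\<close> and \<open>K = D + 1\<close>, so
        \<open>b + c = K - 1\<close>; the determinant is \<open>- (1 + t)\<close>.\<close>
      have h1: "(deriv ^^ (D + 1)) (\<lambda>x. (1 + (-1) * x) powr (real D / 2) * (t + 1 * x) powr (real D / 2)) x =
        ff (real D / 2) (D + 1) * (-1 * t - 1 * 1) ^ (D + 1) *
        ((1 + (-1) * x) powr (real D / 2 - real (D + 1)) * (t + 1 * x) powr (real D / 2 - real (D + 1)))"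
      proof (rule higher_deriv_powr_mult_powr[OF S(1) _ _ _ x])
        show "1 + (-1) * y > 0" "t + 1 * y > 0" if "y \<in> S" for y using Sx[OF that] by auto
      qed simp
      have h2: "(-1 * t - 1 * 1) ^ (D + 1) = (-1) ^ (D + 1) * (1 + t) ^ (D + 1)"
      proof -
        have "-1 * t - 1 * 1 = -1 * (1 + t)" by simp
        then show ?thesis by (simp only: power_mult_distrib)
      qed
      have h3: "(1 - x) powr (real D / 2 + 1) * (1 - x) powr (real D / 2 - real (D + 1)) = 1"
        using Sx(1)[OF x] by (simp flip: powr_add)
      have h4: "real D / 2 - real (D + 1) = - real D / 2 - 1" by (simp add: field_simps)
      have gen: "u * (f * (s * T) * (v * w)) = f * s * T * w" if "u * v = 1" for u v w f s T :: real
        using that by algebra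
      show ?thesis unfolding h1[unfolded e] h2 c1_def
        using gen[OF h3] unfolding h4 .
    qed
    have 2: "(1 + x) powr (5 * real D / 2 + 1) * (deriv ^^ (D + 1)) (\<lambda>x. (1 - x) powr (real D / 2 + 1) *
        (deriv ^^ (D + 1)) (\<lambda>x. (1 - x) powr (real D / 2) * (t + x) powr (real D / 2)) x) x =
        c1 * c2 * (1 + t) ^ (D + 1) * ((1 + 1 * x) powr (5 * real D / 2 + 1) * (t + 1 * x) powr (- 3 * real D / 2 - 2))" if x: "x \<in> S" for x
    proof -
      have sm: "smooth S (\<lambda>x. (t + x) powr y)" for y using Sx by (intro smooth_intros) auto
      have "(deriv ^^ (D + 1)) (\<lambda>x. (1 - x) powr (real D / 2 + 1) *
        (deriv ^^ (D + 1)) (\<lambda>x. (1 - x) powr (real D / 2) * (t + x) powr (real D / 2)) x) x =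
        (deriv ^^ (D + 1)) (\<lambda>x. c1 * (1 + t) ^ (D + 1) * (t + x) powr (- real D / 2 - 1)) x"
        by (rule higher_deriv_cong_open[OF S(1) 1 x])
      also have "\<dots> = c1 * (1 + t) ^ (D + 1) * (deriv ^^ (D + 1)) (\<lambda>x. (t + x) powr (- real D / 2 - 1)) x"
        by (rule higher_deriv_cmult[OF S(1) sm x])
      also have "(deriv ^^ (D + 1)) (\<lambda>x. (t + x) powr (- real D / 2 - 1)) x =
          c2 * (t + x) powr (- real D / 2 - 1 - real (D + 1))"
        unfolding c2_def by (rule higher_deriv_powr[OF Sx(2)[OF x]])
      also have "- real D / 2 - 1 - real (D + 1) = - 3 * real D / 2 - 2" by (simp add: field_simps)
      finally show ?thesis by (simp add: mult_ac)
    qed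
    have sm: "smooth S (\<lambda>x. (1 + 1 * x) powr y * (t + 1 * x) powr z)" for y z
      using Sx by (intro smooth_intros) (auto simp: S_def)
    have "annih D (\<lambda>x. (t + x) powr (real D / 2)) a = (deriv ^^ D) (\<lambda>x. c1 * c2 * (1 + t) ^ (D + 1) *
        ((1 + 1 * x) powr (5 * real D / 2 + 1) * (t + 1 * x) powr (- 3 * real D / 2 - 2))) a"
      unfolding annih_def by (rule higher_deriv_cong_open[OF S(1) 2 S(2)])
    also have "\<dots> = c1 * c2 * (1 + t) ^ (D + 1) * (deriv ^^ D) (\<lambda>x.
        (1 + 1 * x) powr (5 * real D / 2 + 1) * (t + 1 * x) powr (- 3 * real D / 2 - 2)) a"
      by (rule higher_deriv_cmult[OF S(1) sm S(2)])
    \<comment> \<open>Here \<open>b + c = (5 * D/2 + 1) - (3 * D/2 + 2) = D - 1\<close>, which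
      explains the exponent of \<open>1 + a\<close>; the determinant \<open>t - 1\<close> completes
      the \<open>1 + t\<close> from before to \<open>1 - t\<^sup>2\<close> up to sign.\<close>
    also have "(deriv ^^ D) (\<lambda>x. (1 + 1 * x) powr (5 * real D / 2 + 1) * (t + 1 * x) powr (- 3 * real D / 2 - 2)) a =
        c3 * (1 * t - 1 * 1) ^ D * ((1 + 1 * a) powr (5 * real D / 2 + 1 - real D) * (t + 1 * a) powr (- 3 * real D / 2 - 2 - real D))"
      unfolding c3_def
    proof (rule higher_deriv_powr_mult_powr[OF S(1) _ _ _ S(2)])
      show "1 + 1 * y > 0" "t + 1 * y > 0" if "y \<in> S" for y using Sx[OF that] by auto
    qed (simp add: field_simps)
    also have "5 * real D / 2 + 1 - real D = 3 * real D / 2 + 1" by (simp add: field_simps)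
    also have "- 3 * real D / 2 - 2 - real D = - (5 * real D / 2 + 2)" by (simp add: field_simps)
    finally show ?thesis by (simp add: mult_ac)
  qed
  then show ?thesis by (intro exI[of _ "c1 * c2 * c3"] allI impI)
qed

section \<open>Zeros of the analytic family\<close>

text \<open>\<open>D/2\<close> is not an integer. This permits division by \<open>ff\<close> when a
  lowered exponent is traded for derivatives in \<open>t\<close>.\<close>

lemma ff_half_neq_0: "odd D \<Longrightarrow> ff (real D / 2) j \<noteq> 0"
proof -
  assume D: "odd D"
  have "real D / 2 - real i \<noteq> 0" for i
  proof
    assume "real D / 2 - real i = 0"
    then have "real D = real (2 * i)" by simp
    then have "D = 2 * i" by (simp only: of_nat_eq_iff)
    then show False using D by simp
  qed
  then show "ff (real D / 2) j \<noteq> 0" by (simp add: ff_def)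
qed

text \<open>Up to a constant, \<open>(t + a) powr (D/2 - j)\<close> is the \<open>j\<close>-th
  derivative in \<open>t\<close> of \<open>(t + a) powr (D/2)\<close>, and this commutes with
  \<open>annih\<close>. The result for \<open>j = 0\<close> contains
  \<open>(1 - t\<^sup>2) ^ D\<close>, so the \<open>j\<close> derivatives can be moved to the
  weight; the factors left over and the degree gained add up to
  \<open>2 * (D - j) + 2 * j\<close>.\<close>

lemma annih_Xf:
  assumes D: "D = 2 * N + 1" and j: "j \<le> D"
    and C: "\<And>a t. a \<in> U01 \<Longrightarrow> t + a > 0 \<Longrightarrow> annih D (\<lambda>x. (t + x) powr (real D / 2)) a =
     C * (1 + a) powr (3 * real D / 2 + 1) * ((1 + t) ^ (D + 1) * (t - 1) ^ D * (t + a) powr (- (5 * real D / 2 + 2)))"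
  shows "\<exists>P. degree P \<le> 2 * D \<and> (\<forall>a\<in>U01. annih D (Xf N j) a = C * (1 + a) powr (3 * real D / 2 + 1) *
     kint (\<lambda>\<psi>. (sin \<psi> ^ 2) ^ (N + 1) * (1 + sin \<psi> ^ 2) powr (1/2) * poly P (sin \<psi> ^ 2)) (- (5 * real D / 2 + 2)) a)"
proof -
  define E where "E = 5 * real D / 2 + 2"
  obtain V where V: "degree V \<le> 2 * j"
    "\<forall>U G. open U \<longrightarrow> {0..1} \<subseteq> U \<longrightarrow> U \<subseteq> {-1<..} \<longrightarrow> smooth U G \<longrightarrow>
      integral {0..pi/2} (\<lambda>\<psi>. (deriv ^^ j) (\<lambda>t. (1 - t ^ 2) ^ (D - j + j) * G t) (sin \<psi> ^ 2) *
         ((sin \<psi> ^ 2) ^ (N + 1 + j) * (1 + sin \<psi> ^ 2) powr (-1/2) * poly 1 (sin \<psi> ^ 2))) =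
      integral {0..pi/2} (\<lambda>\<psi>. (1 - (sin \<psi> ^ 2) ^ 2) ^ (D - j) * G (sin \<psi> ^ 2) *
         ((sin \<psi> ^ 2) ^ (N + 1) * (1 + sin \<psi> ^ 2) powr (-1/2) * poly V (sin \<psi> ^ 2)))"
  proof -
    have "degree (1 :: real poly) + 2 * j = 2 * j" by simp
    from integral_higher_deriv_parts[of 1 j "D - j" "N + 1", unfolded this]
    show ?thesis by (elim exE conjE) (rule that)
  qed
  define P where "P = smult (- 1 / ff (real D / 2) j) ([:1, 0, -1:] ^ (D - j) * V)"
  have "degree P \<le> 2 * D"
  proof -
    have "degree ([:1, 0, -1::real:] ^ (D - j)) \<le> 2 * (D - j)"
      using degree_power_le[of "[:1, 0, -1::real:]" "D - j"] by simp
    then have "degree ([:1, 0, -1::real:] ^ (D - j) * V) \<le> 2 * (D - j) + 2 * j"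
      using degree_mult_le[of "[:1, 0, -1::real:] ^ (D - j)" V] V(1) by linarith
    then show ?thesis using j degree_smult_le[of "- 1 / ff (real D / 2) j"] unfolding P_def
      by (intro order.trans[OF degree_smult_le]) simp
  qed
  moreover have "annih D (Xf N j) a = C * (1 + a) powr (3 * real D / 2 + 1) *
     kint (\<lambda>\<psi>. (sin \<psi> ^ 2) ^ (N + 1) * (1 + sin \<psi> ^ 2) powr (1/2) * poly P (sin \<psi> ^ 2)) (- E) a"
    if a: "a \<in> U01" for a
  proof -
    define f where "f = ff (real D / 2) j"
    have f0: "f \<noteq> 0" unfolding f_def using D by (intro ff_half_neq_0) simp
    define K where "K = C * (1 + a) powr (3 * real D / 2 + 1)"
    define G where "G t = - K * (1 + t) * (t + a) powr (- E)" for t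
    have oU: "open {-a<..}" "{0..1} \<subseteq> {-a<..}" "{-a<..} \<subseteq> {-1<..}" using a by auto
    have smG: "smooth {-a<..} G" unfolding G_def by (intro smooth_intros) auto
    have Dj: "(2 * real N + 1) / 2 - real j = real D / 2 - real j" using D by simp
    have shift: "annih D (\<lambda>x. (sin \<psi> ^ 2 + x) powr (real D / 2 - real j)) a =
       1 / f * (deriv ^^ j) (\<lambda>t. (1 - t ^ 2) ^ (D - j + j) * G t) (sin \<psi> ^ 2)" for \<psi> :: real
    proof -
      have p: "sin \<psi> ^ 2 + a > 0" using sin2_pos a by simp
      have "(deriv ^^ j) (\<lambda>t. annih D (\<lambda>x. (t + x) powr (real D / 2)) a) (sin \<psi> ^ 2) =
          f * annih D (\<lambda>x. (sin \<psi> ^ 2 + x) powr (real D / 2 - real j)) a"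
        unfolding f_def by (rule diff_op_powr_shift[OF _ diff_op_annih a p]) simp
      moreover have "(deriv ^^ j) (\<lambda>t. annih D (\<lambda>x. (t + x) powr (real D / 2)) a) (sin \<psi> ^ 2) =
          (deriv ^^ j) (\<lambda>t. (1 - t ^ 2) ^ (D - j + j) * G t) (sin \<psi> ^ 2)"
      proof (rule higher_deriv_cong_open[OF oU(1)])
        fix t assume t: "t \<in> {-a<..}"
        \<comment> \<open>One of the \<open>D + 1\<close> factors \<open>1 + t\<close> is left over;
          it goes into \<open>G\<close> together with the sign, which is negative because
          \<open>D\<close> is odd.\<close>
        have "(1 + t) ^ (D + 1) * (t - 1) ^ D = - ((1 - t ^ 2) ^ D * (1 + t))"
        proof -
          have "(t - 1) ^ D = - ((1 - t) ^ D)"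
          proof -
            have "odd D" using D by simp
            have "(t - 1) ^ D = (- (1 - t)) ^ D" by simp
            also have "\<dots> = - ((1 - t) ^ D)" by (rule power_minus_odd[OF \<open>odd D\<close>])
            finally show ?thesis .
          qed
          moreover have "(1 - t ^ 2) ^ D = (1 - t) ^ D * (1 + t) ^ D"
            by (simp flip: power_mult_distrib add: algebra_simps power2_eq_square)
          ultimately show ?thesis by simp
        qed
        moreover have "annih D (\<lambda>x. (t + x) powr (real D / 2)) a = K * ((1 + t) ^ (D + 1) * (t - 1) ^ D * (t + a) powr (- E))"
          unfolding K_def E_def using t a by (intro C) auto
        moreover have "D - j + j = D" using j by simp
        ultimately show "annih D (\<lambda>x. (t + x) powr (real D / 2)) a = (1 - t ^ 2) ^ (D - j + j) * G t"
          by (simp add: G_def)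
      qed (use p in auto)
      ultimately show ?thesis using f0 by simp
    qed
    have "annih D (Xf N j) a = integral {0..pi/2} (\<lambda>\<psi>. wgt N j \<psi> * annih D (\<lambda>x. (sin \<psi> ^ 2 + x) powr (real D / 2 - real j)) a)"
      unfolding Xf_def Dj by (rule diff_op_kint[OF _ diff_op_annih _ a continuous_wgt]) auto
    also have "\<dots> = integral {0..pi/2} (\<lambda>\<psi>. 1 / f * ((deriv ^^ j) (\<lambda>t. (1 - t ^ 2) ^ (D - j + j) * G t) (sin \<psi> ^ 2) *
         ((sin \<psi> ^ 2) ^ (N + 1 + j) * (1 + sin \<psi> ^ 2) powr (-1/2) * poly 1 (sin \<psi> ^ 2))))"
      unfolding shift wgt_def poly_1 mult_1_right by (simp only: mult_ac)
    also have "\<dots> = 1 / f * integral {0..pi/2} (\<lambda>\<psi>. (deriv ^^ j) (\<lambda>t. (1 - t ^ 2) ^ (D - j + j) * G t) (sin \<psi> ^ 2) *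
         ((sin \<psi> ^ 2) ^ (N + 1 + j) * (1 + sin \<psi> ^ 2) powr (-1/2) * poly 1 (sin \<psi> ^ 2)))"
      by (rule integral_mult_right)
    also have "\<dots> = 1 / f * integral {0..pi/2} (\<lambda>\<psi>. (1 - (sin \<psi> ^ 2) ^ 2) ^ (D - j) * G (sin \<psi> ^ 2) *
         ((sin \<psi> ^ 2) ^ (N + 1) * (1 + sin \<psi> ^ 2) powr (-1/2) * poly V (sin \<psi> ^ 2)))"
      using V(2)[rule_format, OF oU smG] by (simp only:)
    also have "\<dots> = integral {0..pi/2} (\<lambda>\<psi>. 1 / f * ((1 - (sin \<psi> ^ 2) ^ 2) ^ (D - j) * G (sin \<psi> ^ 2) *
         ((sin \<psi> ^ 2) ^ (N + 1) * (1 + sin \<psi> ^ 2) powr (-1/2) * poly V (sin \<psi> ^ 2))))"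
      by (rule integral_mult_right[symmetric])
    also have "\<dots> = integral {0..pi/2} (\<lambda>\<psi>. K * ((sin \<psi> ^ 2) ^ (N + 1) * (1 + sin \<psi> ^ 2) powr (1/2) * poly P (sin \<psi> ^ 2) *
        (sin \<psi> ^ 2 + a) powr (- E)))"
    proof (rule integral_cong)
      fix \<psi> :: real
      define t where "t = sin \<psi> ^ 2"
      have "1 + t > 0" using sin2_pos[of 1 \<psi>] by (simp add: t_def add.commute)
      \<comment> \<open>The spare factor \<open>1 + t\<close> of \<open>G\<close> turns the weight
        \<open>(1 + t) powr (-1/2)\<close> into \<open>(1 + t) powr (1/2)\<close>.\<close>
      then have s: "(1 + t) powr (1/2) = (1 + t) * (1 + t) powr (-1/2)" using powr_step[of "1 + t" "1/2"] by simp
      have P: "poly P t = - 1 / f * ((1 - t ^ 2) ^ (D - j) * poly V t)"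
      proof -
        have "poly [:1, 0, -1:] t = 1 - t ^ 2" by (simp add: power2_eq_square)
        then show ?thesis unfolding P_def f_def by (simp only: poly_smult poly_mult poly_power)
      qed
      show "1 / f * ((1 - (sin \<psi> ^ 2) ^ 2) ^ (D - j) * G (sin \<psi> ^ 2) *
         ((sin \<psi> ^ 2) ^ (N + 1) * (1 + sin \<psi> ^ 2) powr (-1/2) * poly V (sin \<psi> ^ 2))) =
        K * ((sin \<psi> ^ 2) ^ (N + 1) * (1 + sin \<psi> ^ 2) powr (1/2) * poly P (sin \<psi> ^ 2) * (sin \<psi> ^ 2 + a) powr (- E))"
        unfolding t_def[symmetric] P s G_def by simp
    qed
    also have "\<dots> = K * kint (\<lambda>\<psi>. (sin \<psi> ^ 2) ^ (N + 1) * (1 + sin \<psi> ^ 2) powr (1/2) * poly P (sin \<psi> ^ 2)) (- E) a"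
      unfolding kint_def by (rule integral_mult_right)
    finally show ?thesis by (simp only: K_def)
  qed
  ultimately show ?thesis unfolding E_def by blast
qed

text \<open>After \<open>annih\<close> all the \<open>Xf N j\<close> have the same weight, the same
  exponent and the same factor in \<open>1 + a\<close>, so the whole sum is one integral with a
  single polynomial \<open>Q\<close>.\<close>

lemma zeros_le_annih_Xf_sum:
  assumes D: "D = 2 * N + 1"
  shows "zeros_le U01 (\<lambda>a. \<Sum>j\<le>D. c j * annih D (Xf N j) a) (2 * D)"
proof -
  define E where "E = - (5 * real D / 2 + 2)"
  obtain C where C: "\<And>a t. a \<in> U01 \<Longrightarrow> t + a > 0 \<Longrightarrow> annih D (\<lambda>x. (t + x) powr (real D / 2)) a =
     C * (1 + a) powr (3 * real D / 2 + 1) * ((1 + t) ^ (D + 1) * (t - 1) ^ D * (t + a) powr (- (5 * real D / 2 + 2)))"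
    using annih_powr by metis
  define w where "w \<psi> = (sin \<psi> ^ 2) ^ (N + 1) * (1 + sin \<psi> ^ 2) powr (1/2)" for \<psi> :: real
  have w: "continuous_on {0..pi/2} w"
    unfolding w_def using sin2_1_neq by (intro continuous_intros) auto
  have "\<forall>j\<in>{..D}. \<exists>P. degree P \<le> 2 * D \<and> (\<forall>a\<in>U01. annih D (Xf N j) a = C * (1 + a) powr (3 * real D / 2 + 1) *
     kint (\<lambda>\<psi>. w \<psi> * poly P (sin \<psi> ^ 2)) E a)"
    unfolding w_def E_def using annih_Xf[OF D _ C] by simp
  from bchoice[OF this] obtain P where P0: "\<forall>j\<in>{..D}. degree (P j) \<le> 2 * D \<and> (\<forall>a\<in>U01. annih D (Xf N j) a =
     C * (1 + a) powr (3 * real D / 2 + 1) * kint (\<lambda>\<psi>. w \<psi> * poly (P j) (sin \<psi> ^ 2)) E a)"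
    by (elim exE) (rule that)
  have P: "\<And>j. j \<le> D \<Longrightarrow> degree (P j) \<le> 2 * D"
    "\<And>j a. j \<le> D \<Longrightarrow> a \<in> U01 \<Longrightarrow> annih D (Xf N j) a = C * (1 + a) powr (3 * real D / 2 + 1) *
       kint (\<lambda>\<psi>. w \<psi> * poly (P j) (sin \<psi> ^ 2)) E a"
    using P0 unfolding atMost_iff Ball_def by blast+
  define Q where "Q = (\<Sum>j\<le>D. smult (C * c j) (P j))"
  have dQ: "degree Q \<le> 2 * D" unfolding Q_def
    by (intro degree_sum_le) (auto intro: order.trans[OF degree_smult_le] P)
  have cont: "continuous_on {0..pi/2} (\<lambda>\<psi>. w \<psi> * poly R (sin \<psi> ^ 2))" for R
    using w by (intro continuous_intros)
  have eq: "(\<Sum>j\<le>D. c j * annih D (Xf N j) a) = (1 + a) powr (3 * real D / 2 + 1) * kint (\<lambda>\<psi>. w \<psi> * poly Q (sin \<psi> ^ 2)) E a"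
    if a: "a \<in> U01" for a
  proof -
    have a0: "a > 0" using a by simp
    have "kint (\<lambda>\<psi>. w \<psi> * poly Q (sin \<psi> ^ 2)) E a =
        integral {0..pi/2} (\<lambda>\<psi>. \<Sum>j\<le>D. (C * c j) * (w \<psi> * poly (P j) (sin \<psi> ^ 2) * (sin \<psi> ^ 2 + a) powr E))"
      unfolding kint_def Q_def poly_sum poly_smult sum_distrib_left sum_distrib_right by (simp only: mult_ac)
    also have "\<dots> = (\<Sum>j\<le>D. integral {0..pi/2} (\<lambda>\<psi>. (C * c j) * (w \<psi> * poly (P j) (sin \<psi> ^ 2) * (sin \<psi> ^ 2 + a) powr E)))"
      by (rule integral_sum) (simp, intro integrable_on_mult_right kint_integrable cont a0)
    also have "\<dots> = (\<Sum>j\<le>D. (C * c j) * kint (\<lambda>\<psi>. w \<psi> * poly (P j) (sin \<psi> ^ 2)) E a)"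
      unfolding kint_def by (simp only: integral_mult_right)
    finally show ?thesis
      using P(2)[OF _ a] by (simp add: sum_distrib_left mult_ac)
  qed
  have z0: "zeros_le {0<..} (kint (\<lambda>\<psi>. w \<psi> * poly Q (sin \<psi> ^ 2)) E) (degree Q)"
  proof (rule kint_zeros_le[OF w])
    show "w \<psi> \<ge> 0" for \<psi> by (simp add: w_def)
    have "{\<psi>\<in>{0..pi/2}. w \<psi> = 0} \<subseteq> {0}"
    proof
      fix \<psi> assume \<psi>: "\<psi> \<in> {\<psi>\<in>{0..pi/2}. w \<psi> = 0}"
      then have "sin \<psi> = 0" using sin2_1_neq[of \<psi>] by (auto simp: w_def)
      then show "\<psi> \<in> {0}" using \<psi> sin_gt_zero[of \<psi>] pi_half_less_two pi_gt_zero
        by (cases "\<psi> = 0") (auto simp: field_simps)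
    qed
    then show "finite {\<psi>\<in>{0..pi/2}. w \<psi> = 0}" by (rule finite_subset) simp
  qed (simp add: E_def)
  have z: "zeros_le U01 (kint (\<lambda>\<psi>. w \<psi> * poly Q (sin \<psi> ^ 2)) E) (2 * D)"
    by (rule zeros_le_mono[OF zeros_le_subset[OF z0] dQ]) auto
  let ?k = "kint (\<lambda>\<psi>. w \<psi> * poly Q (sin \<psi> ^ 2)) E"
  have smk: "smooth U01 ?k" by (rule smooth_subset[OF smooth_kint[OF cont]]) auto
  have "zeros_le U01 (\<lambda>a. (1 + a) powr (- (3 * real D / 2 + 1)) * (\<Sum>j\<le>D. c j * annih D (Xf N j) a)) (2 * D)"
  proof (subst zeros_le_cong[of U01 _ ?k])
    fix a assume a: "a \<in> U01"
    show "(1 + a) powr (- (3 * real D / 2 + 1)) * (\<Sum>j\<le>D. c j * annih D (Xf N j) a) = ?k a"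
      unfolding eq[OF a] using a by (simp flip: mult.assoc powr_add)
  qed (use z in simp_all)
  then show ?thesis
  proof (rule zeros_le_mult[rotated -1])
    show "smooth U01 (\<lambda>a. \<Sum>j\<le>D. c j * annih D (Xf N j) a)"
      by (intro smooth_sum smooth_cmult diff_op_smooth[OF _ diff_op_annih] smooth_Xf) simp
  qed (auto intro: smooth_1pm)
qed

lemma zeros_le_structure:
  assumes D: "D = 2 * N + 1" and f: "smooth U01 f" and "degree E \<le> D" "degree p \<le> D"
    and eq: "\<And>a. a \<in> U01 \<Longrightarrow> f a = (1 - a) powr (- (real D / 2)) * poly E a + poly p a + (\<Sum>j\<le>D. c j * Xf N j a)"
  shows "zeros_le U01 f (2 * D + (3 * D + 2))"
proof (rule zeros_le_annih[OF f])
  have o: "open U01" by simp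
  let ?g1 = "\<lambda>a. (1 - a) powr (- (real D / 2)) * poly E a"
  let ?g2 = "\<lambda>a. \<Sum>j\<le>D. c j * Xf N j a"
  have s1: "smooth U01 ?g1" by (intro smooth_mult smooth_1pm smooth_poly)
  have s2: "smooth U01 ?g2" by (intro smooth_sum smooth_cmult smooth_Xf)
  have "annih D f a = (\<Sum>j\<le>D. c j * annih D (Xf N j) a)" if a: "a \<in> U01" for a
  proof -
    have "annih D f a = annih D (\<lambda>a. ?g1 a + poly p a + ?g2 a) a"
      by (rule diff_op_cong[OF o diff_op_annih f eq a])
    also have "\<dots> = annih D (\<lambda>a. ?g1 a + poly p a) a + annih D ?g2 a"
      by (rule diff_op_add[OF o diff_op_annih smooth_add[OF s1 smooth_poly] s2 a])
    also have "annih D (\<lambda>a. ?g1 a + poly p a) a = annih D ?g1 a + annih D (poly p) a"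
      by (rule diff_op_add[OF o diff_op_annih s1 smooth_poly a])
    also have "annih D ?g1 a = 0" by (rule annih_powr_poly) (use assms a in auto)
    also have "annih D (poly p) a = 0" by (rule annih_poly) (use assms a in auto)
    also have "annih D ?g2 a = (\<Sum>j\<le>D. annih D (\<lambda>a. c j * Xf N j a) a)"
      by (rule diff_op_sum[OF o diff_op_annih smooth_cmult[OF smooth_Xf] a]) simp
    also have "\<dots> = (\<Sum>j\<le>D. c j * annih D (Xf N j) a)"
      by (intro sum.cong refl diff_op_cmult[OF o diff_op_annih smooth_Xf a])
    finally show ?thesis by simp
  qed
  then show "zeros_le U01 (annih D f) (2 * D)"
    using zeros_le_annih_Xf_sum[OF D, of c] zeros_le_cong[OF o, of "annih D f"] by auto
qed

lemma zeros_le_Mf_sum: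
  assumes n: "N = n div 2"
    and f: "\<And>a. a \<in> U01 \<Longrightarrow> f a = (\<Sum>m\<le>N. \<Sum>j\<le>n. c m j * Mf (m + 1) 0 0 (j + 1) a)"
  shows "zeros_le U01 f (11 * N + 8)" "smooth U01 f"
proof -
  define D where "D = 2 * N + 1"
  define Me where "Me = Mf 0 (2 * N + 2) 0 (2 * N + 1)"
  define Mo where "Mo = Mf 0 (2 * N + 2) 0 (2 * N + 2)"
  have smM: "smooth U01 Me" "smooth U01 Mo" unfolding Me_def Mo_def by (rule smooth_Mf)+
  \<comment> \<open>\<open>N + 1\<close> steps in \<open>p\<close> and \<open>N - i\<close> steps in
    \<open>e\<close> add up to at most \<open>D = 2 * N + 1\<close>.\<close>
  have span: "theta_span D (Mf 0 (2 * N + 2) 0 (j + 1 + 2 * (N - i))) (Mf (m + 1) 0 0 (j + 1))"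
    if "m \<le> N" "i \<le> N" for m i j
  proof -
    have 1: "theta_span (N + 1) (Mf 0 (2 * N + 2) 0 (j + 1)) (Mf (m + 1) 0 0 (j + 1))"
      using theta_span_Mf[of "m + 1" "N + 1" 0 0 "j + 1"] that by (simp add: numeral_2_eq_2)
    have 2: "theta_span (N - i) (Mf 0 (2 * N + 2) 0 (j + 1 + 2 * (N - i))) (Mf 0 (2 * N + 2) 0 (j + 1))"
      by (rule theta_span_Mf_e)
    show ?thesis by (rule theta_span_mono[OF theta_span_trans[OF smooth_Mf 2 1]]) (simp add: D_def)
  qed
  \<comment> \<open>The exponent \<open>j + 1\<close> changes in steps of 2: the even
    \<open>j\<close> meet at \<open>2 * N + 1\<close>, the odd ones at
    \<open>2 * N + 2\<close>.\<close>
  define Je where "Je = {j. j \<le> n \<and> even j}"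
  define Jo where "Jo = {j. j \<le> n \<and> odd j}"
  have J: "finite Je" "finite Jo" "Je \<inter> Jo = {}" "{..n} = Je \<union> Jo" by (auto simp: Je_def Jo_def)
  define fe where "fe a = (\<Sum>m\<le>N. 1 * (\<Sum>j\<in>Je. c m j * Mf (m + 1) 0 0 (j + 1) a))" for a
  define fo where "fo a = (\<Sum>m\<le>N. 1 * (\<Sum>j\<in>Jo. c m j * Mf (m + 1) 0 0 (j + 1) a))" for a
  have f': "f a = fe a + fo a" if "a \<in> U01" for a
    unfolding f[OF that] fe_def fo_def J(4) by (simp add: sum.union_disjoint[OF J(1-3)] sum.distrib)
  have spe: "theta_span D Me fe" unfolding fe_def
  proof (intro theta_span_sum)
    fix m j assume mj: "m \<in> {..N}" "j \<in> Je"
    then obtain i where i: "j = 2 * i" "i \<le> N" using n by (auto simp: Je_def elim!: evenE)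
    have "j + 1 + 2 * (N - i) = 2 * N + 1" using i by simp
    then show "theta_span D Me (Mf (m + 1) 0 0 (j + 1))"
      using span[of m i j] mj i unfolding Me_def by simp
  qed
  have spo: "theta_span D Mo fo" unfolding fo_def
  proof (intro theta_span_sum)
    fix m j assume mj: "m \<in> {..N}" "j \<in> Jo"
    then obtain i where i: "j = 2 * i + 1" "i \<le> N" using n by (auto simp: Jo_def elim!: oddE)
    have "j + 1 + 2 * (N - i) = 2 * N + 2" using i by simp
    then show "theta_span D Mo (Mf (m + 1) 0 0 (j + 1))"
      using span[of m i j] mj i unfolding Mo_def by simp
  qed
  have sme: "smooth U01 fe" by (rule theta_span_smooth[OF smM(1) spe])
  have smo: "smooth U01 fo" by (rule theta_span_smooth[OF smM(2) spo])
  show smf: "smooth U01 f" using smooth_cong[of U01 f] smooth_add[OF sme smo] f' by simp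
  \<comment> \<open>\<open>N\<close> factors bring \<open>e\<close> from \<open>2 * N + 1\<close>
    down to 1; the last factor leaves only the boundary term, a multiple of
    \<open>(1 - a) powr (D/2)\<close>.\<close>
  have Te: "\<exists>P. degree P \<le> D \<and> (\<forall>a\<in>U01. theta_prod (N + 1) fe a = (1 - a) powr (- (real D / 2)) * poly P a)"
  proof -
    have "1 + 2 * N = 2 * N + 1" by simp
    from theta_prod_Mf[of N "2 * N" 1, unfolded this, folded Me_def]
    obtain k where "\<forall>a\<in>U01. theta_prod N Me a = k * Mf 0 (2 * N + 2) (2 * N) 1 a"
      by (elim exE) (rule that)
    then have k: "\<And>a. a \<in> U01 \<Longrightarrow> theta_prod N Me a = k * Mf 0 (2 * N + 2) (2 * N) 1 a" by (rule bspec)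
    have "theta_prod (N + 1) Me a = - k * (1 - a) powr (real D / 2)" if a: "a \<in> U01" for a
    proof -
      have 1: "theta (theta_prod N Me) a = k * theta (Mf 0 (2 * N + 2) (2 * N) 1) a"
        using theta_cong[OF k a] theta_lincomb[OF smooth_Mf smooth_const[of _ 0] a, of k _ _ _ _ 0] by simp
      have 2: "theta (Mf 0 (2 * N + 2) (2 * N) 1) a = 2 * real N * Mf 0 (2 * N + 2) (2 * N) 1 a - (1 - a) powr (real D / 2)"
        using theta_Mf_boundary[OF a, of "2 * N" "2 * N" 0] by (simp add: D_def add.commute)
      have 3: "theta_prod (N + 1) Me a = theta (theta_prod N Me) a - 2 * real N * theta_prod N Me a" by simp
      show ?thesis unfolding 3 1 2 k[OF a] by algebra
    qed
    then have "theta_span D (\<lambda>a. - k * (1 - a) powr (real D / 2)) (theta_prod (N + 1) fe)"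
      by (rule theta_span_cong_left[OF theta_span_theta_prod[OF smM(1) spe]])
    then have "theta_span D (\<lambda>a. (1 - a) powr (real D / 2)) (theta_prod (N + 1) fe)"
      by (rule theta_span_cmult_left[OF smooth_1pm(2)])
    from theta_span_powr[OF this] show ?thesis by (simp add: field_simps)
  qed
  \<comment> \<open>\<open>N + 1\<close> factors bring \<open>e\<close> from
    \<open>2 * N + 2\<close> down to 0, which is the elliptic integral that can be moved to the
    other cycle.\<close>
  have To: "\<exists>P d. degree P \<le> D \<and> (\<forall>a\<in>U01. theta_prod (N + 1) fo a = poly P a + (\<Sum>j\<le>D. d j * Xf N j a))"
  proof -
    have "2 * (N + 1) = 2 * N + 2" by simp
    from theta_prod_Mf[of "N + 1" "2 * N" 0, unfolded this add_0, folded Mo_def]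
    obtain k where "\<forall>a\<in>U01. theta_prod (N + 1) Mo a = k * Mf 0 (2 * N + 2) (2 * N + 2) 0 a"
      by (elim exE) (rule that)
    then have k: "\<And>a. a \<in> U01 \<Longrightarrow> theta_prod (N + 1) Mo a = k * Mf 0 (2 * N + 2) (2 * N + 2) 0 a" by (rule bspec)
    obtain q where q: "degree q \<le> D" "\<And>a. a \<in> U01 \<Longrightarrow> Mf 0 (2 * N + 2) (2 * N + 2) 0 a = poly q a + 2 * Xf N 0 a"
    proof -
      have "Xf N 0 = kint (\<lambda>\<psi>. (sin \<psi> ^ 2) ^ (N + 1) * (1 + sin \<psi> ^ 2) powr (-1/2)) (real N + 1/2)"
        unfolding Xf_def wgt_def[abs_def] by (simp add: add_divide_distrib)
      then show ?thesis using period_transform[of N] that unfolding D_def by auto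
    qed
    have "theta_span D (\<lambda>a. k * poly q a + (2 * k) * Xf N 0 a) (theta_prod (N + 1) fo)"
    proof (rule theta_span_cong_left[OF theta_span_theta_prod[OF smM(2) spo]])
      fix a assume a: "a \<in> U01"
      show "theta_prod (N + 1) Mo a = k * poly q a + (2 * k) * Xf N 0 a"
        unfolding k[OF a] q(2)[OF a] by algebra
    qed
    from theta_span_split[OF smooth_poly smooth_Xf this]
    obtain g1 g2 where g: "theta_span D (poly q) g1" "theta_span D (Xf N 0) g2"
      "\<And>a. a \<in> U01 \<Longrightarrow> theta_prod (N + 1) fo a = g1 a + g2 a" by auto
    obtain P where "degree P \<le> degree q" "\<forall>a\<in>U01. g1 a = poly P a" using theta_span_poly[OF g(1)] by auto
    moreover obtain d where "\<forall>a\<in>U01. g2 a = (\<Sum>j\<le>D. d j * Xf N j a)" using theta_span_Xf[OF g(2)] by auto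
    ultimately show ?thesis using q(1) g(3) by (intro exI[of _ P] exI[of _ d]) auto
  qed
  obtain E where E: "degree E \<le> D" "\<And>a. a \<in> U01 \<Longrightarrow> theta_prod (N + 1) fe a = (1 - a) powr (- (real D / 2)) * poly E a"
    using Te by auto
  obtain P d where P: "degree P \<le> D" "\<And>a. a \<in> U01 \<Longrightarrow> theta_prod (N + 1) fo a = poly P a + (\<Sum>j\<le>D. d j * Xf N j a)"
    using To by auto
  have "theta_prod (N + 1) f a = (1 - a) powr (- (real D / 2)) * poly E a + poly P a + (\<Sum>j\<le>D. d j * Xf N j a)"
    if a: "a \<in> U01" for a
  proof -
    have "theta_prod (N + 1) f a = theta_prod (N + 1) (\<lambda>a. 1 * fe a + 1 * fo a) a"
      by (rule theta_prod_cong) (use f' a in auto)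
    also have "\<dots> = theta_prod (N + 1) fe a + theta_prod (N + 1) fo a"
      using theta_prod_lincomb[OF sme smo a, of "N + 1" 1 1] by simp
    finally show ?thesis using E(2)[OF a] P(2)[OF a] by simp
  qed
  then have "zeros_le U01 (theta_prod (N + 1) f) (2 * D + (3 * D + 2))"
    by (intro zeros_le_structure[OF D_def smooth_theta_prod[OF smf] E(1) P(1)])
  then have "zeros_le U01 f (2 * D + (3 * D + 2) + (N + 1))"
    by (rule zeros_le_theta_prod[OF smf])
  then show "zeros_le U01 f (11 * N + 8)" by (rule zeros_le_mono) (simp add: D_def)
qed

section \<open>Geometry of the oval and reduction of the line integrals\<close>

section \<open>The oval as a union of two graphs\<close>

text \<open>The oval consists of the points over the interval \<open>base h\<close> whose vertical distance from the
  switching line is \<open>offset h x\<close>.\<close>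

definition radius :: "real \<Rightarrow> real" where
  "radius h = sqrt (1/4 - 2 * sqrt h)"

definition offset :: "real \<Rightarrow> real \<Rightarrow> real" where
  "offset h x = sqrt (x^2 * (1 - x)^2 / 4 - h) / x"

definition height :: "real \<Rightarrow> real \<Rightarrow> real \<Rightarrow> real" where
  "height e h x = (1 - x) / 2 + e * offset h x"

definition base :: "real \<Rightarrow> real set" where
  "base h = {1/2 - radius h..1/2 + radius h}"

definition graph :: "real \<Rightarrow> real \<Rightarrow> (real \<times> real) set" where
  "graph e h = (\<lambda>x. (x, height e h x)) ` base h"

lemma sqrt_h: "0 < h \<Longrightarrow> h < 1/64 \<Longrightarrow> 0 < sqrt h \<and> sqrt h < 1/8"
  using real_sqrt_less_mono[of h "1/64"] by (simp add: real_sqrt_divide)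

lemma radius_bounds:
  assumes "0 < h" "h < 1/64"
  shows "0 < radius h" "radius h < 1/2" "(radius h)^2 = 1/4 - 2 * sqrt h"
proof -
  have s: "0 < sqrt h" "sqrt h < 1/8" using sqrt_h[OF assms] by auto
  then show "0 < radius h" "(radius h)^2 = 1/4 - 2 * sqrt h" by (simp_all add: radius_def)
  have "radius h < sqrt (1/4)" unfolding radius_def using s by (intro real_sqrt_less_mono) simp
  then show "radius h < 1/2" by (simp add: real_sqrt_divide)
qed

text \<open>A difference of squares: \<open>x * (1 - x) / 2 - sqrt h\<close> vanishes exactly at
  \<open>1/2 \<plusminus> radius h\<close>, while \<open>x * (1 - x) / 2 + sqrt h\<close> is
  positive over the base.\<close>

lemma radicand_factor:
  assumes "0 < h" "h < 1/64"
  shows "x^2 * (1 - x)^2 / 4 - h = ((radius h)^2 - (x - 1/2)^2) * (x * (1 - x) + 2 * sqrt h) / 4"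
proof -
  have "sqrt h * sqrt h = h" using assms by simp
  then have "h = (sqrt h)^2" by (simp add: power2_eq_square)
  moreover have "x^2 * (1 - x)^2 / 4 - s^2 = (1/4 - 2 * s - (x - 1/2)^2) * (x * (1 - x) + 2 * s) / 4" for s
    by (simp add: power2_eq_square field_simps)
  ultimately show ?thesis unfolding radius_bounds(3)[OF assms] by metis
qed

lemma base_iff:
  assumes "0 < h" "h < 1/64"
  shows "x \<in> base h \<longleftrightarrow> (x - 1/2)^2 \<le> (radius h)^2"
proof -
  have "(x - 1/2)^2 \<le> (radius h)^2 \<longleftrightarrow> \<bar>x - 1/2\<bar> \<le> radius h"
    using radius_bounds(1)[OF assms] abs_le_square_iff[of "x - 1/2" "radius h"] by simp
  then show ?thesis by (auto simp: base_def)
qed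

lemma base_pos:
  assumes "0 < h" "h < 1/64" "x \<in> base h"
  shows "0 < x" "x < 1" "x * (1 - x) + 2 * sqrt h > 0"
proof -
  show x: "0 < x" "x < 1" using radius_bounds[OF assms(1,2)] assms(3) by (auto simp: base_def)
  have "x * (1 - x) > 0" using x by simp
  then show "x * (1 - x) + 2 * sqrt h > 0" using sqrt_h[OF assms(1,2)] by linarith
qed

lemma radicand_nonneg:
  assumes "0 < h" "h < 1/64" "x \<in> base h"
  shows "x^2 * (1 - x)^2 / 4 - h \<ge> 0"
proof -
  have "(radius h)^2 - (x - 1/2)^2 \<ge> 0" using base_iff[OF assms(1,2)] assms(3) by simp
  then show ?thesis
    unfolding radicand_factor[OF assms(1,2)] using base_pos(3)[OF assms] by simp
qed

lemma radicand_pos: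
  assumes "0 < h" "h < 1/64" "x \<in> {1/2 - radius h<..<1/2 + radius h}"
  shows "x^2 * (1 - x)^2 / 4 - h > 0"
proof -
  have "\<bar>x - 1/2\<bar> < radius h" using assms(3) by auto
  then have "(x - 1/2)^2 < (radius h)^2"
    using power_strict_mono[of "\<bar>x - 1/2\<bar>" "radius h" 2] by simp
  moreover have "x \<in> base h" using assms(3) by (auto simp: base_def)
  ultimately show ?thesis
    unfolding radicand_factor[OF assms(1,2)] using base_pos(3)[OF assms(1,2)] by simp
qed

lemma offset_nonneg:
  assumes "0 < h" "h < 1/64" "x \<in> base h"
  shows "offset h x \<ge> 0"
  using radicand_nonneg[OF assms] base_pos[OF assms] by (simp add: offset_def)

lemma offset_pos:
  assumes "0 < h" "h < 1/64" "x \<in> {1/2 - radius h<..<1/2 + radius h}"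
  shows "offset h x > 0"
proof -
  have "x \<in> base h" using assms(3) by (auto simp: base_def)
  then show ?thesis using radicand_pos[OF assms] base_pos[OF assms(1,2)] by (simp add: offset_def)
qed

lemma offset_end:
  assumes "0 < h" "h < 1/64"
  shows "offset h (1/2 - radius h) = 0" "offset h (1/2 + radius h) = 0"
  unfolding offset_def radicand_factor[OF assms] by simp_all

lemma offset_sq:
  assumes "0 < h" "h < 1/64" "x \<in> base h"
  shows "x^2 * (offset h x)^2 = x^2 * (1 - x)^2 / 4 - h"
  using radicand_nonneg[OF assms] base_pos[OF assms] by (simp add: offset_def power_divide)

lemma continuous_offset:
  assumes "0 < h" "h < 1/64"
  shows "continuous_on (base h) (offset h)"
proof -
  have "\<forall>x\<in>base h. x \<noteq> 0" using base_pos(1)[OF assms] by (metis less_irrefl)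
  then show ?thesis unfolding offset_def by (intro continuous_intros) simp_all
qed

text \<open>Completing the square in \<open>y\<close>: \<open>x\<^sup>2 (y - (1 - x)/2)\<^sup>2 =
  x\<^sup>2 (1 - x)\<^sup>2 / 4 - H x y\<close>.\<close>

lemma oval_iff:
  assumes h: "0 < h" "h < 1/64"
  shows "(x, y) \<in> oval h \<longleftrightarrow> x \<in> base h \<and> (y - (1 - x) / 2)^2 = (offset h x)^2"
proof
  assume "(x, y) \<in> oval h"
  then have *: "x > 0" "y > 0" "x + y < 1" "x^2 * y * (1 - x - y) = h" by (auto simp: oval_def H_def)
  have eq: "x^2 * (y - (1 - x) / 2)^2 = x^2 * (1 - x)^2 / 4 - h"
    unfolding *(4)[symmetric] by (simp add: power2_eq_square field_simps)
  have x1: "x * (1 - x) + 2 * sqrt h > 0" using * sqrt_h[OF h] by (simp add: add_pos_pos)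
  have "0 \<le> x^2 * (y - (1 - x) / 2)^2" by simp
  then have "(radius h)^2 - (x - 1/2)^2 \<ge> 0"
    unfolding eq radicand_factor[OF h] using x1 by (simp add: zero_le_mult_iff)
  then have x: "x \<in> base h" by (simp add: base_iff[OF h])
  have "x^2 * (y - (1 - x) / 2)^2 = x^2 * (offset h x)^2" unfolding eq offset_sq[OF h x] ..
  then show "x \<in> base h \<and> (y - (1 - x) / 2)^2 = (offset h x)^2" using x *(1) by simp
next
  assume "x \<in> base h \<and> (y - (1 - x) / 2)^2 = (offset h x)^2"
  then have x: "x \<in> base h" and y: "(y - (1 - x) / 2)^2 = (offset h x)^2" by auto
  note xp = base_pos[OF h x]
  have eq: "x^2 * (y - (1 - x) / 2)^2 = x^2 * (1 - x)^2 / 4 - h"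
    unfolding y by (rule offset_sq[OF h x])
  \<comment> \<open>Positivity of \<open>h\<close> makes the inequality strict and keeps
    \<open>y\<close> off the sides \<open>y = 0\<close> and \<open>x + y = 1\<close> of the
    triangle.\<close>
  have "x^2 * (y - (1 - x) / 2)^2 < x^2 * ((1 - x) / 2)^2"
    unfolding eq using h(1) by (simp add: power_divide)
  then have "(y - (1 - x) / 2)^2 < ((1 - x) / 2)^2" using xp(1) by simp
  then have "\<bar>y - (1 - x) / 2\<bar>^2 < \<bar>(1 - x) / 2\<bar>^2" by (simp only: power2_abs)
  then have "\<bar>y - (1 - x) / 2\<bar> < \<bar>(1 - x) / 2\<bar>" by (rule power2_less_imp_less) simp
  then have "\<bar>y - (1 - x) / 2\<bar> < (1 - x) / 2" using xp by (simp add: abs_of_pos)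
  then have y1: "y > 0" "x + y < 1" by (simp_all add: abs_less_iff field_simps)
  have "x^2 * (y - (1 - x) / 2)^2 = x^2 * (1 - x)^2 / 4 - x^2 * y * (1 - x - y)"
    by (simp add: power2_eq_square field_simps)
  then have "x^2 * y * (1 - x - y) = h" using eq by linarith
  then show "(x, y) \<in> oval h" using xp y1 by (simp add: oval_def H_def)
qed

lemma graph_subset_oval:
  assumes h: "0 < h" "h < 1/64" and "e = 1 \<or> e = -1" "p \<in> graph e h"
  shows "p \<in> oval h"
proof -
  obtain x where x: "x \<in> base h" "p = (x, height e h x)" using assms(4) by (auto simp: graph_def)
  have "(height e h x - (1 - x) / 2)^2 = (offset h x)^2" using assms(3) by (auto simp: height_def)
  then show ?thesis unfolding x(2) oval_iff[OF h] using x(1) by simp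
qed

lemma compact_graph:
  assumes "0 < h" "h < 1/64"
  shows "compact (graph e h)"
  unfolding graph_def
proof (rule compact_continuous_image)
  show "continuous_on (base h) (\<lambda>x. (x, height e h x))"
    unfolding height_def by (intro continuous_intros continuous_offset assms) auto
qed (simp add: base_def)

lemma closure_upper_arc:
  assumes h: "0 < h" "h < 1/64"
  shows "closure (upper_arc h) = graph 1 h"
proof -
  have "upper_arc h = graph 1 h"
  proof (intro set_eqI iffI)
    fix p assume p: "p \<in> upper_arc h"
    obtain x y where xy: "p = (x, y)" by (cases p)
    have x: "x \<in> base h" "(y - (1 - x) / 2)^2 = (offset h x)^2" "y - (1 - x) / 2 \<ge> 0"
      using p oval_iff[OF h, of x y] by (auto simp: upper_arc_def xy field_simps)
    then have "y - (1 - x) / 2 = offset h x" using offset_nonneg[OF h x(1)] by (simp add: power2_eq_iff_nonneg)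
    then show "p \<in> graph 1 h" using x(1) by (auto simp: graph_def height_def xy)
  next
    fix p assume p: "p \<in> graph 1 h"
    then obtain x where x: "x \<in> base h" "p = (x, height 1 h x)" by (auto simp: graph_def)
    show "p \<in> upper_arc h"
      using graph_subset_oval[OF h _ p] offset_nonneg[OF h x(1)] by (simp add: upper_arc_def x(2) height_def field_simps)
  qed
  then show ?thesis using compact_graph[OF h] compact_imp_closed closure_closed by metis
qed

text \<open>The end points lie on the switching line and belong to the upper arc, so the lower arc
  is a graph over the open interval; the closure restores them.\<close>

lemma closure_lower_arc:
  assumes h: "0 < h" "h < 1/64"
  shows "closure (lower_arc h) = graph (-1) h"
proof -
  define f where "f x = (x, height (-1) h x)" for x
  let ?J = "{1/2 - radius h<..<1/2 + radius h}"
  have J: "?J \<subseteq> base h" "closure ?J = base h" using radius_bounds(1)[OF h] by (auto simp: base_def)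
  have eq: "lower_arc h = f ` ?J"
  proof (intro set_eqI iffI)
    fix p assume p: "p \<in> lower_arc h"
    obtain x y where xy: "p = (x, y)" by (cases p)
    have x: "x \<in> base h" "(y - (1 - x) / 2)^2 = (offset h x)^2" "(1 - x) / 2 - y > 0"
      using p oval_iff[OF h, of x y] by (auto simp: lower_arc_def xy field_simps)
    then have "((1 - x) / 2 - y)^2 = (offset h x)^2" by (simp add: power2_commute)
    then have u: "(1 - x) / 2 - y = offset h x" using x(3) offset_nonneg[OF h x(1)] by (simp add: power2_eq_iff_nonneg)
    then have "x \<noteq> 1/2 - radius h" "x \<noteq> 1/2 + radius h" using offset_end[OF h] x(3) by auto
    then have "x \<in> ?J" using x(1) by (auto simp: base_def)
    then show "p \<in> f ` ?J" using u by (force simp: f_def height_def xy)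
  next
    fix p assume "p \<in> f ` ?J"
    then obtain x where x: "x \<in> ?J" "p = (x, height (-1) h x)" by (auto simp: f_def)
    then have "p \<in> graph (-1) h" using J(1) by (auto simp: graph_def)
    then show "p \<in> lower_arc h"
      using graph_subset_oval[OF h, of "-1" p] offset_pos[OF h x(1)] by (simp add: lower_arc_def x(2) height_def field_simps)
  qed
  have cont: "continuous_on (closure ?J) f"
    unfolding f_def height_def J(2) by (intro continuous_intros continuous_offset h) auto
  have "graph (-1) h \<subseteq> closure (lower_arc h)"
    using image_closure_subset[OF cont closed_closure closure_subset]
    unfolding eq graph_def J(2) f_def by simp
  moreover have "closure (lower_arc h) \<subseteq> graph (-1) h"
    using J(1) compact_imp_closed[OF compact_graph[OF h, of "-1"]]
    by (intro closure_minimal) (auto simp: eq graph_def f_def)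
  ultimately show ?thesis by blast
qed

section \<open>Parametrizations of the arcs\<close>

abbreviation unperturbed :: "real \<times> real \<Rightarrow> real \<times> real" where
  "unperturbed \<equiv> \<lambda>(x, y). (x^2 * (1 - x - 2*y), x * y * (-2 + 3*x + 2*y))"

lemma perturbed_field_0: "perturbed_field 0 fp gp fm gm = unperturbed"
  by (auto simp: perturbed_field_def fun_eq_iff)

text \<open>In the angle \<open>pi * t\<close> the square root that vanishes at the ends becomes
  \<open>r * sin (pi * t)\<close> times the smooth factor \<open>w\<close>, so the curve is C1 up to
  its ends although the graph has vertical tangents there. Passing from \<open>e = 1\<close> to
  \<open>e = -1\<close> shifts the angle by \<open>pi\<close>.\<close>

lemma flow_parametrization_exists:
  assumes h: "0 < h" "h < 1/64" and e: "e = 1 \<or> e = -1" and A: "closure A = graph e h"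
  shows "\<exists>\<gamma>. flow_parametrization unperturbed A \<gamma>"
proof -
  define r where "r = radius h"
  note r = radius_bounds[OF h, folded r_def]
  have e2: "e * e = 1" "e^2 = 1" using e by auto
  define X where "X t = 1/2 + e * r * cos (pi * t)" for t
  define R where "R x = x * (1 - x) + 2 * sqrt h" for x
  define w where "w x = sqrt (R x) / (2 * x)" for x
  define Y where "Y t = (1 - X t) / 2 + e * r * sin (pi * t) * w (X t)" for t
  define \<gamma> where "\<gamma> t = (X t, Y t)" for t
  have XI: "X t \<in> base h" for t
    unfolding base_iff[OF h] X_def r_def[symmetric]
    by (simp add: power_mult_distrib e2 mult_left_le abs_square_le_1)
  note Xp = base_pos[OF h XI, folded R_def]
  define X' where "X' t = - e * r * pi * sin (pi * t)" for t
  define w' where "w' x = ((1 - 2 * x) / (2 * sqrt (R x)) * (2 * x) - sqrt (R x) * 2) / ((2 * x) * (2 * x))" for x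
  define Y' where "Y' t = - X' t / 2 + ((e * r * pi * cos (pi * t)) * w (X t) + (w' (X t) * X' t) * (e * r * sin (pi * t)))" for t
  have dX: "(X has_real_derivative X' t) (at t)" for t
    unfolding X_def X'_def by (auto intro!: derivative_eq_intros)
  have dw: "(w has_real_derivative w' x) (at x)" if "x > 0" "R x > 0" for x
  proof -
    have "(R has_real_derivative 1 - 2 * x) (at x)"
      unfolding R_def by (auto intro!: derivative_eq_intros)
    note d = DERIV_chain2[OF DERIV_real_sqrt[OF that(2)] this]
    have 1: "((\<lambda>x. sqrt (R x)) has_real_derivative (1 - 2 * x) / (2 * sqrt (R x))) (at x)"
      by (rule DERIV_cong[OF d]) (simp add: inverse_eq_divide)
    have 2: "((\<lambda>x. 2 * x) has_real_derivative 2) (at x)" by (auto intro!: derivative_eq_intros)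
    have 3: "2 * x \<noteq> 0" using that(1) by simp
    show ?thesis unfolding w_def w'_def by (rule DERIV_divide[OF 1 2 3])
  qed
  have dY: "(Y has_real_derivative Y' t) (at t)" for t
  proof -
    have 1: "((\<lambda>t. w (X t)) has_real_derivative w' (X t) * X' t) (at t)"
      by (rule DERIV_chain2[OF dw dX]) (use Xp in auto)
    have 2: "((\<lambda>t. e * r * sin (pi * t)) has_real_derivative e * r * pi * cos (pi * t)) (at t)"
      by (auto intro!: derivative_eq_intros)
    have 3: "((\<lambda>t. (1 - X t) / 2) has_real_derivative - X' t / 2) (at t)"
      by (auto intro!: derivative_eq_intros dX)
    show ?thesis unfolding Y_def Y'_def by (rule DERIV_add[OF 3 DERIV_mult[OF 2 1]])
  qed
  have d\<gamma>: "(\<gamma> has_vector_derivative (X' t, Y' t)) (at t)" for t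
    unfolding \<gamma>_def
    using dX dY by (intro has_vector_derivative_Pair) (simp_all flip: has_real_derivative_iff_has_vector_derivative)
  have contX: "continuous_on UNIV X" unfolding X_def by (intro continuous_intros)
  have contX': "continuous_on UNIV X'" unfolding X'_def by (intro continuous_intros)
  have contR: "continuous_on UNIV (\<lambda>t. R (X t))" unfolding R_def by (intro continuous_intros contX)
  have contY': "continuous_on UNIV Y'"
    unfolding Y'_def w'_def w_def
    by (intro continuous_intros contX contX' contR) (use Xp in \<open>auto simp: less_imp_neq[symmetric]\<close>)
  have "\<gamma> C1_differentiable_on {0..1}"
    unfolding C1_differentiable_on_def
    by (intro exI[of _ "\<lambda>t. (X' t, Y' t)"] conjI ballI d\<gamma> continuous_on_Pair
        continuous_on_subset[OF contX'] continuous_on_subset[OF contY']) auto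
  then have valid: "valid_path \<gamma>"
    unfolding valid_path_def by (rule C1_differentiable_imp_piecewise)
  have Yt: "Y t = height e h (X t)" if t: "t \<in> {0..1}" for t
  proof -
    have "0 \<le> sin (pi * t)" using t by (intro sin_ge_zero) (auto simp: mult_left_le)
    have "(radius h)^2 - (X t - 1/2)^2 = (r * sin (pi * t))^2"
      unfolding X_def r_def[symmetric] by (simp add: power_mult_distrib e2 sin_squared_eq algebra_simps)
    then have "X t^2 * (1 - X t)^2 / 4 - h = (r * sin (pi * t))^2 * R (X t) / 4"
      unfolding radicand_factor[OF h] R_def by simp
    then have "sqrt (X t^2 * (1 - X t)^2 / 4 - h) = sqrt ((r * sin (pi * t))^2) * sqrt (R (X t)) / sqrt 4"
      by (simp only: real_sqrt_mult real_sqrt_divide)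
    then have s: "sqrt (X t^2 * (1 - X t)^2 / 4 - h) = r * sin (pi * t) * sqrt (R (X t)) / 2"
      using r(1) \<open>0 \<le> sin (pi * t)\<close> by (simp add: real_sqrt_abs abs_mult)
    have "offset h (X t) = r * sin (pi * t) * w (X t)"
      unfolding offset_def w_def s by simp
    then show ?thesis by (simp add: Y_def height_def)
  qed
  have inj: "inj_on \<gamma> {0..1}"
  proof (rule inj_onI)
    fix s t assume st: "s \<in> {0..1}" "t \<in> {0..1}" "\<gamma> s = \<gamma> t"
    then have "X s = X t" by (simp add: \<gamma>_def)
    then have "(e * r) * cos (pi * s) = (e * r) * cos (pi * t)" unfolding X_def by linarith
    moreover have "e * r \<noteq> 0" using e r(1) by auto
    ultimately have c: "cos (pi * s) = cos (pi * t)" by (metis mult_left_cancel)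
    have b: "0 \<le> pi * u" "pi * u \<le> pi" if "u \<in> {0..1}" for u using that by (simp_all add: mult_left_le)
    have "pi * s = pi * t" by (rule cos_inj_pi[OF b[OF st(1)] b[OF st(2)] c])
    then show "s = t" by simp
  qed
  have arc: "arc \<gamma>"
    unfolding arc_def path_def using inj valid valid_path_imp_path path_def by blast
  have img: "path_image \<gamma> = graph e h"
  proof (intro set_eqI iffI)
    fix p assume "p \<in> path_image \<gamma>"
    then show "p \<in> graph e h" using Yt XI by (auto simp: path_image_def \<gamma>_def graph_def)
  next
    fix p assume "p \<in> graph e h"
    then obtain x where x: "x \<in> base h" "p = (x, height e h x)" by (auto simp: graph_def)
    define c where "c = e * (x - 1/2) / r"
    have "\<bar>x - 1/2\<bar> \<le> r" using x(1) by (auto simp: base_def r_def)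
    then have c: "-1 \<le> c" "c \<le> 1" using r e by (auto simp: c_def field_simps abs_if split: if_splits)
    define t where "t = arccos c / pi"
    have t: "t \<in> {0..1}" using arccos_bounded[OF c] by (simp add: t_def)
    have "X t = 1/2 + (e * e) * (x - 1/2)" using c r by (simp add: X_def t_def c_def)
    then have "X t = x" by (simp add: e2)
    then show "p \<in> path_image \<gamma>" using Yt[OF t] t by (auto simp: path_image_def \<gamma>_def x(2) intro!: image_eqI[of _ _ t])
  qed
  have dir: "\<exists>c\<ge>0. vector_derivative \<gamma> (at t) = c *\<^sub>R unperturbed (\<gamma> t)" if t: "t \<in> {0<..<1}" for t
  proof -
    \<comment> \<open>Dictated by the first component: on the curve,
      \<open>1 - X t - 2 * Y t\<close> is
      \<open>- e * r * sin (pi * t) * sqrt (R (X t)) / X t\<close>.\<close>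
    define c where "c = pi / (X t * sqrt (R (X t)))"
    have c0: "c \<ge> 0" using Xp[of t] by (simp add: c_def)
    define v1 where "v1 = X t^2 * (1 - X t - 2 * Y t)"
    define v2 where "v2 = X t * Y t * (-2 + 3 * X t + 2 * Y t)"
    have sp: "sin (pi * t) > 0" using t by (intro sin_gt_zero) auto
    have v1: "v1 = - e * r * sin (pi * t) * (X t * sqrt (R (X t)))"
      using Xp[of t] by (simp add: v1_def Y_def w_def power2_eq_square field_simps)
    have 1: "X' t = c * v1" unfolding v1 c_def X'_def using Xp[of t] by simp
    have v1n: "v1 \<noteq> 0" unfolding v1 using Xp[of t] r sp e by auto
    have H0: "X t^2 * Y t * (1 - X t - Y t) = h" if "t \<in> {0<..<1}" for t
    proof -
      have "\<gamma> t \<in> path_image \<gamma>" unfolding path_image_def using that by (intro imageI) simp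
      then have "\<gamma> t \<in> oval h" unfolding img by (rule graph_subset_oval[OF h e])
      then show ?thesis by (simp add: oval_def H_def \<gamma>_def)
    qed
    have "((\<lambda>t. X t^2 * Y t * (1 - X t - Y t)) has_real_derivative
        ((2 * X t * X' t) * Y t + Y' t * X t^2) * (1 - X t - Y t) + (- X' t - Y' t) * (X t^2 * Y t)) (at t)"
      by (intro DERIV_mult) (auto intro!: derivative_eq_intros dX dY)
    moreover have "((\<lambda>t. X t^2 * Y t * (1 - X t - Y t)) has_real_derivative 0) (at t)"
      using DERIV_cong_open[of "{0<..<1}" t "\<lambda>t. X t^2 * Y t * (1 - X t - Y t)" "\<lambda>_. h" 0] t H0 by simp
    ultimately have "((2 * X t * X' t) * Y t + Y' t * X t^2) * (1 - X t - Y t) + (- X' t - Y' t) * (X t^2 * Y t) = 0"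
      by (rule DERIV_unique)
    \<comment> \<open>Constancy of \<open>H\<close> along the curve makes its velocity parallel to
      the Hamiltonian field, which gives the second component without expanding
      \<open>Y'\<close>.\<close>
    then have "v1 * Y' t = v2 * X' t" unfolding v1_def v2_def by algebra
    then have "v1 * Y' t = v1 * (c * v2)" unfolding 1 by algebra
    then have 2: "Y' t = c * v2" using v1n by simp
    have "vector_derivative \<gamma> (at t) = (X' t, Y' t)" by (rule vector_derivative_at[OF d\<gamma>])
    then show ?thesis using c0 1 2 by (intro exI[of _ c]) (simp add: \<gamma>_def v1_def v2_def)
  qed
  show ?thesis
    by (rule exI[of _ \<gamma>]) (unfold flow_parametrization_def A, use valid arc img dir in blast)
qed

section \<open>Evaluation of the line integrals\<close>

text \<open>For any admissible parametrization the abscissa is monotone, because the first component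
  of the field on the graph is \<open>- 2 * e * x\<^sup>2 * offset h x\<close>. So the arc runs from
  \<open>1/2 + e * radius h\<close> to \<open>1/2 - e * radius h\<close>, and \<open>S\<close> is an
  antiderivative of the form pulled back to \<open>x\<close>.\<close>

lemma line_integral_eq:
  assumes h: "0 < h" "h < 1/64" and e: "e = 1 \<or> e = -1" and A: "closure A = graph e h"
    and \<gamma>: "flow_parametrization unperturbed A \<gamma>"
    and S: "continuous_on (base h) S"
    and dY: "\<And>x. x \<in> {1/2 - radius h<..<1/2 + radius h} \<Longrightarrow> (height e h has_real_derivative Y' x) (at x)"
    and dS: "\<And>x. x \<in> {1/2 - radius h<..<1/2 + radius h} \<Longrightarrow>
       (S has_real_derivative P x (height e h x) + Q x (height e h x) * Y' x) (at x)"
  shows "line_integral P Q \<gamma> = e * (S (1/2 - radius h) - S (1/2 + radius h))"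
proof -
  define X where "X t = fst (\<gamma> t)" for t
  define r where "r = radius h"
  note r = radius_bounds[OF h, folded r_def]
  have valid: "valid_path \<gamma>" and arc: "arc \<gamma>" and img: "path_image \<gamma> = graph e h"
    and dir: "\<And>t. t \<in> {0<..<1} \<Longrightarrow> \<gamma> differentiable at t \<Longrightarrow> \<exists>c\<ge>0. vector_derivative \<gamma> (at t) = c *\<^sub>R unperturbed (\<gamma> t)"
    using \<gamma> by (auto simp: flow_parametrization_def A)
  have G: "X t \<in> base h" "\<gamma> t = (X t, height e h (X t))" if "t \<in> {0..1}" for t
  proof -
    have "\<gamma> t \<in> graph e h" using img that by (auto simp: path_image_def)
    then show "X t \<in> base h" "\<gamma> t = (X t, height e h (X t))" by (auto simp: graph_def X_def)
  qed
  have cont: "continuous_on {0..1} \<gamma>" using valid valid_path_imp_path path_def by blast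
  have contX: "continuous_on {0..1} X" unfolding X_def by (intro continuous_intros cont)
  obtain K where K: "finite K" "\<gamma> C1_differentiable_on ({0..1} - K)"
    using valid unfolding valid_path_def piecewise_C1_differentiable_on_def by blast
  define v where "v t = vector_derivative \<gamma> (at t)" for t
  have dg: "\<gamma> differentiable at t" "(\<gamma> has_vector_derivative v t) (at t)" if "t \<in> {0<..<1} - K" for t
    using K(2) that unfolding C1_differentiable_on_eq v_def by (auto simp: vector_derivative_works)
  have dX: "(X has_vector_derivative fst (v t)) (at t)" if "t \<in> {0<..<1} - K" for t
    unfolding X_def using bounded_linear.has_vector_derivative[OF bounded_linear_fst dg(2)[OF that]] .
  have sgn: "e * fst (v t) \<le> 0" if t: "t \<in> {0<..<1} - K" for t
  proof -
    have tt: "t \<in> {0<..<1}" "t \<in> {0..1}" using t by auto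
    obtain c where c: "c \<ge> 0" "v t = c *\<^sub>R unperturbed (\<gamma> t)"
      using dir[OF tt(1) dg(1)[OF t]] unfolding v_def by blast
    have "e * fst (v t) = - (c * (X t^2 * (2 * (e * e) * offset h (X t))))"
      unfolding c(2) G(2)[OF tt(2)] by (simp add: height_def power2_eq_square field_simps)
    moreover have "c * (X t^2 * (2 * (e * e) * offset h (X t))) \<ge> 0"
      by (intro mult_nonneg_nonneg c(1) offset_nonneg[OF h G(1)[OF tt(2)]] zero_le_power2 zero_le_square) simp
    ultimately show ?thesis by linarith
  qed
  have mono: "e * X t \<le> e * X s" if st: "0 \<le> s" "s \<le> t" "t \<le> 1" for s t
  proof -
    define f where "f u = (if u \<in> {0<..<1} - K then - e * fst (v u) else 0)" for u
    have "(f has_integral (- e * X t) - (- e * X s)) {s..t}"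
    proof (rule fundamental_theorem_of_calculus_interior_strong[OF K(1) st(2)])
      show "continuous_on {s..t} (\<lambda>u. - e * X u)"
        using st by (intro continuous_intros continuous_on_subset[OF contX]) auto
      fix u assume "u \<in> {s<..<t} - K"
      then have u: "u \<in> {0<..<1} - K" using st by auto
      then show "((\<lambda>u. - e * X u) has_vector_derivative f u) (at u)"
        unfolding f_def using has_vector_derivative_mult_right[OF dX[OF u], of "- e"] by simp
    qed
    then have "0 \<le> (- e * X t) - (- e * X s)"
      by (rule has_integral_nonneg) (use sgn in \<open>auto simp: f_def\<close>)
    then show ?thesis by simp
  qed
  \<comment> \<open>The image is the whole graph, so both extreme abscissae are attained; by
    monotonicity this happens at the ends of the parameter interval.\<close>
  have ends: "X 0 = 1/2 + e * r" "X 1 = 1/2 - e * r"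
  proof -
    have m: "1/2 + e * r \<in> base h" "1/2 - e * r \<in> base h" using e r by (auto simp: base_def r_def)
    have ex: "\<exists>t\<in>{0..1}. X t = x" if x: "x \<in> base h" for x
    proof -
      have "(x, height e h x) \<in> \<gamma> ` {0..1}" using img x unfolding path_image_def graph_def by simp
      then obtain t where "(x, height e h x) = \<gamma> t" "t \<in> {0..1}" by (rule imageE)
      then show ?thesis unfolding X_def by (intro bexI[of _ t]) (metis fst_conv)
    qed
    obtain t1 where t1: "t1 \<in> {0..1}" "X t1 = 1/2 + e * r" using ex[OF m(1)] by (rule bexE)
    obtain t2 where t2: "t2 \<in> {0..1}" "X t2 = 1/2 - e * r" using ex[OF m(2)] by (rule bexE)
    note t = t1 t2
    have "e * X t1 \<le> e * X 0" using mono[of 0 t1] t by auto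
    moreover have "e * X 1 \<le> e * X t2" using mono[of t2 1] t by auto
    moreover have "X 0 \<in> base h" "X 1 \<in> base h" using G by auto
    ultimately show "X 0 = 1/2 + e * r" "X 1 = 1/2 - e * r" using t e by (auto simp: base_def r_def)
  qed
  \<comment> \<open>Over the end points of the base \<open>height\<close> has no finite slope. The
    corresponding times are excluded as well; injectivity makes them finitely many.\<close>
  define L where "L = K \<union> ({0..1} \<inter> \<gamma> -` {(1/2 - r, height e h (1/2 - r)), (1/2 + r, height e h (1/2 + r))})"
  have "finite ({0..1} \<inter> \<gamma> -` {(1/2 - r, height e h (1/2 - r)), (1/2 + r, height e h (1/2 + r))})"
    using arc unfolding arc_def by (intro finite_vimage_IntI[of _ \<gamma> "{0..1}", unfolded Int_commute[of _ "{0..1}"]]) auto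
  then have L: "finite L" using K(1) by (simp add: L_def)
  have inner: "X t \<in> {1/2 - radius h<..<1/2 + radius h}" "t \<in> {0<..<1} - K" if "t \<in> {0<..<1} - L" for t
  proof -
    have t: "t \<in> {0..1}" using that by auto
    have "X t \<noteq> 1/2 - r" "X t \<noteq> 1/2 + r" using that t G(2)[OF t] by (auto simp: L_def)
    then show "X t \<in> {1/2 - radius h<..<1/2 + radius h}" using G(1)[OF t] by (auto simp: base_def r_def)
    show "t \<in> {0<..<1} - K" using that by (auto simp: L_def)
  qed
  have "((\<lambda>t. P (fst (\<gamma> t)) (snd (\<gamma> t)) * fst (vector_derivative \<gamma> (at t within {0..1})) +
     Q (fst (\<gamma> t)) (snd (\<gamma> t)) * snd (vector_derivative \<gamma> (at t within {0..1}))) has_integral (S (X 1) - S (X 0))) {0..1}"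
  proof (rule fundamental_theorem_of_calculus_interior_strong[OF L, of 0 1 "\<lambda>t. S (X t)"])
    show "continuous_on {0..1} (\<lambda>t. S (X t))"
      by (rule continuous_on_compose2[OF S contX]) (use G in auto)
    fix t assume t: "t \<in> {0<..<1} - L"
    note i = inner[OF t]
    have tt: "t \<in> {0<..<1}" "t \<in> {0..1}" using t by auto
    have dx: "(X has_real_derivative fst (v t)) (at t)"
      using dX[OF i(2)] by (simp add: has_real_derivative_iff_has_vector_derivative)
    have "((\<lambda>t. snd (\<gamma> t)) has_vector_derivative snd (v t)) (at t)"
      using bounded_linear.has_vector_derivative[OF bounded_linear_snd dg(2)[OF i(2)]] .
    then have "((\<lambda>t. snd (\<gamma> t)) has_real_derivative snd (v t)) (at t)"
      by (simp add: has_real_derivative_iff_has_vector_derivative)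
    moreover have "((\<lambda>t. snd (\<gamma> t)) has_real_derivative Y' (X t) * fst (v t)) (at t)"
    proof (subst DERIV_cong_open[of "{0<..<1}" t _ "\<lambda>t. height e h (X t)"])
      show "((\<lambda>t. height e h (X t)) has_real_derivative Y' (X t) * fst (v t)) (at t)"
        by (rule DERIV_chain2[OF dY[OF i(1)] dx])
      show "snd (\<gamma> y) = height e h (X y)" if "y \<in> {0<..<1}" for y using G(2)[of y] that by simp
    qed (use tt in auto)
    ultimately have s: "snd (v t) = Y' (X t) * fst (v t)" by (rule DERIV_unique)
    have "((\<lambda>t. S (X t)) has_real_derivative (P (X t) (height e h (X t)) + Q (X t) (height e h (X t)) * Y' (X t)) * fst (v t)) (at t)"
      by (rule DERIV_chain2[OF dS[OF i(1)] dx])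
    moreover have "vector_derivative \<gamma> (at t within {0..1}) = v t"
      unfolding v_def using tt(1) by (simp add: at_within_Icc_at)
    ultimately show "((\<lambda>t. S (X t)) has_vector_derivative P (fst (\<gamma> t)) (snd (\<gamma> t)) * fst (vector_derivative \<gamma> (at t within {0..1})) +
     Q (fst (\<gamma> t)) (snd (\<gamma> t)) * snd (vector_derivative \<gamma> (at t within {0..1}))) (at t)"
      unfolding has_real_derivative_iff_has_vector_derivative[symmetric] G(2)[OF tt(2)] by (simp add: s algebra_simps)
  qed simp
  then have "line_integral P Q \<gamma> = S (X 1) - S (X 0)" unfolding line_integral_def by (rule integral_unique)
  also have "\<dots> = e * (S (1/2 - radius h) - S (1/2 + radius h))" unfolding ends using e by (auto simp: r_def)
  finally show ?thesis .
qed

section \<open>Polynomial integrands\<close>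

text \<open>Polynomials of total degree at most \<open>n\<close>, as the span of monomials. Later
  properties are all linear, so checking them on generators replaces any handling of
  coefficients.\<close>

inductive poly_le :: "nat \<Rightarrow> (real \<Rightarrow> real \<Rightarrow> real) \<Rightarrow> bool" for n where
  poly_le_monomial: "i + j \<le> n \<Longrightarrow> poly_le n (\<lambda>x u. x ^ i * u ^ j)"
| poly_le_add: "poly_le n f \<Longrightarrow> poly_le n g \<Longrightarrow> poly_le n (\<lambda>x u. f x u + g x u)"
| poly_le_cmult: "poly_le n f \<Longrightarrow> poly_le n (\<lambda>x u. k * f x u)"

lemma poly_le_zero: "poly_le n (\<lambda>x u. 0)"
  using poly_le_cmult[OF poly_le_monomial[of 0 0 n], of 0] by simp

lemma poly_le_sum:
  assumes "finite A" "\<And>i. i \<in> A \<Longrightarrow> poly_le n (f i)"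
  shows "poly_le n (\<lambda>x u. \<Sum>i\<in>A. f i x u)"
  using assms
proof (induction A rule: finite_induct)
  case empty
  show ?case by (simp add: poly_le_zero)
next
  case (insert i A)
  have "poly_le n (\<lambda>x u. f i x u + (\<Sum>i\<in>A. f i x u))"
    by (rule poly_le_add) (use insert in simp_all)
  then show ?case using insert by simp
qed

lemma poly_le_poly2: "poly_le n (poly2 n c)"
proof -
  have "poly_le n (\<lambda>x u. \<Sum>i\<le>n. \<Sum>j\<le>n - i. c i j * (x ^ i * u ^ j))"
    by (intro poly_le_sum poly_le_cmult poly_le_monomial) auto
  moreover have "poly2 n c = (\<lambda>x u. \<Sum>i\<le>n. \<Sum>j\<le>n - i. c i j * (x ^ i * u ^ j))"
    by (simp add: poly2_def fun_eq_iff mult.assoc)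
  ultimately show ?thesis by simp
qed

lemma poly_le_le: "poly_le m f \<Longrightarrow> m \<le> n \<Longrightarrow> poly_le n f"
  by (induction rule: poly_le.induct) (auto intro: poly_le_monomial poly_le_add poly_le_cmult)

lemma poly_le_times_x: "poly_le n f \<Longrightarrow> poly_le (Suc n) (\<lambda>x u. x * f x u)"
proof (induction rule: poly_le.induct)
  case (poly_le_monomial i j)
  then have "poly_le (Suc n) (\<lambda>x u. x ^ Suc i * u ^ j)" by (intro poly_le.poly_le_monomial) simp
  then show ?case by (simp add: mult.assoc)
next
  case (poly_le_add f g)
  from poly_le.poly_le_add[OF poly_le_add.IH] show ?case by (simp add: distrib_left)
next
  case (poly_le_cmult f k)
  from poly_le.poly_le_cmult[OF poly_le_cmult.IH, of k] show ?case by (simp add: mult.left_commute)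
qed

lemma poly_le_times_u: "poly_le n f \<Longrightarrow> poly_le (Suc n) (\<lambda>x u. u * f x u)"
proof (induction rule: poly_le.induct)
  case (poly_le_monomial i j)
  then have "poly_le (Suc n) (\<lambda>x u. x ^ i * u ^ Suc j)" by (intro poly_le.poly_le_monomial) simp
  then show ?case by (simp add: mult.left_commute)
next
  case (poly_le_add f g)
  from poly_le.poly_le_add[OF poly_le_add.IH] show ?case by (simp add: distrib_left)
next
  case (poly_le_cmult f k)
  from poly_le.poly_le_cmult[OF poly_le_cmult.IH, of k] show ?case by (simp add: mult.left_commute)
qed

lemma poly_le_subst: "poly_le n f \<Longrightarrow> poly_le n (\<lambda>x u. f x ((1 - x) / 2 + e * u))"
proof (induction rule: poly_le.induct)
  case (poly_le_monomial i j)
  have "poly_le (i + j) (\<lambda>x u. x ^ i * ((1 - x) / 2 + e * u) ^ j)"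
  proof (induction j)
    case 0
    show ?case using poly_le.poly_le_monomial[of i 0 i] by simp
  next
    case (Suc j)
    let ?f = "\<lambda>x u. x ^ i * ((1 - x) / 2 + e * u) ^ j"
    have 1: "poly_le (Suc (i + j)) ?f" by (rule poly_le_le[OF Suc.IH]) simp
    have "poly_le (Suc (i + j)) (\<lambda>x u. (1/2 * ?f x u + (-1/2) * (x * ?f x u)) + e * (u * ?f x u))"
      by (intro poly_le_add poly_le_cmult 1 poly_le_times_x poly_le_times_u Suc.IH)
    moreover have "(\<lambda>x u. (1/2 * ?f x u + (-1/2) * (x * ?f x u)) + e * (u * ?f x u)) =
        (\<lambda>x u. x ^ i * ((1 - x) / 2 + e * u) ^ Suc j)"
      by (simp add: fun_eq_iff field_simps)
    ultimately show ?case by simp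
  qed
  then show ?case using poly_le_monomial poly_le_le by blast
next
  case (poly_le_add f g)
  show ?case by (rule poly_le.poly_le_add[OF poly_le_add.IH])
next
  case (poly_le_cmult f k)
  show ?case by (rule poly_le.poly_le_cmult[OF poly_le_cmult.IH])
qed

lemma poly_le_continuous:
  assumes "poly_le n f" "continuous_on S u"
  shows "continuous_on S (\<lambda>x. f x (u x))"
  using assms(1) by induction (intro continuous_intros assms(2); assumption)+

text \<open>\<open>E\<close> is the antiderivative of \<open>q\<close> in \<open>u\<close> that
  vanishes at \<open>u = 0\<close>, and \<open>R\<close> is its partial derivative in
  \<open>x\<close>. \<open>E\<close> may have degree \<open>n + 1\<close>, but \<open>R\<close>
  loses a power of \<open>x\<close> for the power of \<open>u\<close> gained.\<close>

lemma poly_le_antideriv: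
  assumes "poly_le n q"
  obtains E R where "poly_le n R" "\<And>x. E x 0 = 0"
    "\<And>S u. continuous_on S u \<Longrightarrow> continuous_on S (\<lambda>x. E x (u x))"
    "\<And>u u' x. (u has_real_derivative u') (at x) \<Longrightarrow>
       ((\<lambda>x. E x (u x)) has_real_derivative R x (u x) + q x (u x) * u') (at x)"
  using assms
proof (induction arbitrary: thesis)
  case (poly_le_monomial i j)
  define R where "R x u = (if i = 0 then 0 else (real i / real (Suc j)) * (x ^ (i - 1) * u ^ Suc j))" for x u :: real
  have R: "poly_le n R"
  proof (cases "i = 0")
    case True
    then have "R = (\<lambda>x u. 0)" by (simp add: R_def fun_eq_iff)
    then show ?thesis using poly_le_zero[of n] by simp
  next
    case False
    then have "poly_le n (\<lambda>x u. (real i / real (Suc j)) * (x ^ (i - 1) * u ^ Suc j))"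
      using poly_le_monomial(1) by (intro poly_le_cmult poly_le.poly_le_monomial) simp
    moreover have "R = (\<lambda>x u. (real i / real (Suc j)) * (x ^ (i - 1) * u ^ Suc j))"
      using False by (simp add: R_def fun_eq_iff)
    ultimately show ?thesis by (simp only:)
  qed
  have D: "((\<lambda>x. x ^ i * (u x ^ Suc j / real (Suc j))) has_real_derivative R x (u x) + x ^ i * u x ^ j * u') (at x)"
    if u: "(u has_real_derivative u') (at x)" for u :: "real \<Rightarrow> real" and u' x
  proof -
    have 1: "((\<lambda>x. x ^ i) has_real_derivative real i * x ^ (i - 1)) (at x)"
      using DERIV_pow[of i x] by simp
    have "((\<lambda>x. u x ^ Suc j / real (Suc j)) has_real_derivative u x ^ j * u') (at x)"
      using DERIV_cdivide[OF DERIV_power[OF u, of "Suc j"], of "real (Suc j)"] by (simp add: mult.commute)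
    note 2 = DERIV_mult[OF 1 this]
    show ?thesis by (rule DERIV_cong[OF 2]) (simp add: R_def algebra_simps del: of_nat_Suc power_Suc)
  qed
  show ?case
  proof (rule poly_le_monomial.prems[of R "\<lambda>x u. x ^ i * (u ^ Suc j / real (Suc j))", OF R _ _ D])
    fix S and u :: "real \<Rightarrow> real" assume u: "continuous_on S u"
    have "real (Suc j) \<noteq> 0" by simp
    then show "continuous_on S (\<lambda>x. x ^ i * (u x ^ Suc j / real (Suc j)))"
      by (intro continuous_on_mult continuous_on_divide continuous_on_power continuous_on_id continuous_on_const u) simp
  qed simp_all
next
  case (poly_le_add f g)
  obtain E1 R1 where 1: "poly_le n R1" "\<And>x. E1 x 0 = 0"
    "\<And>S u. continuous_on S u \<Longrightarrow> continuous_on S (\<lambda>x. E1 x (u x))"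
    "\<And>u u' x. (u has_real_derivative u') (at x) \<Longrightarrow>
       ((\<lambda>x. E1 x (u x)) has_real_derivative R1 x (u x) + f x (u x) * u') (at x)"
    by (rule poly_le_add.IH(1)) (rule that)
  obtain E2 R2 where 2: "poly_le n R2" "\<And>x. E2 x 0 = 0"
    "\<And>S u. continuous_on S u \<Longrightarrow> continuous_on S (\<lambda>x. E2 x (u x))"
    "\<And>u u' x. (u has_real_derivative u') (at x) \<Longrightarrow>
       ((\<lambda>x. E2 x (u x)) has_real_derivative R2 x (u x) + g x (u x) * u') (at x)"
    by (rule poly_le_add.IH(2)) (rule that)
  have D: "((\<lambda>x. E1 x (u x) + E2 x (u x)) has_real_derivative
      (R1 x (u x) + R2 x (u x)) + (f x (u x) + g x (u x)) * u') (at x)"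
    if u: "(u has_real_derivative u') (at x)" for u u' x
    by (rule DERIV_cong[OF DERIV_add[OF 1(4)[OF u] 2(4)[OF u]]]) (simp add: algebra_simps)
  show ?case
    by (rule poly_le_add.prems[OF poly_le.poly_le_add[OF 1(1) 2(1)] _ continuous_on_add[OF 1(3) 2(3)] D])
      (simp_all add: 1(2) 2(2))
next
  case (poly_le_cmult f k)
  obtain E1 R1 where 1: "poly_le n R1" "\<And>x. E1 x 0 = 0"
    "\<And>S u. continuous_on S u \<Longrightarrow> continuous_on S (\<lambda>x. E1 x (u x))"
    "\<And>u u' x. (u has_real_derivative u') (at x) \<Longrightarrow>
       ((\<lambda>x. E1 x (u x)) has_real_derivative R1 x (u x) + f x (u x) * u') (at x)"
    by (rule poly_le_cmult.IH) (rule that)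
  have D: "((\<lambda>x. k * E1 x (u x)) has_real_derivative k * R1 x (u x) + k * f x (u x) * u') (at x)"
    if u: "(u has_real_derivative u') (at x)" for u u' x
    by (rule DERIV_cong[OF DERIV_cmult[OF 1(4)[OF u]]]) (simp add: algebra_simps)
  show ?case
    by (rule poly_le_cmult.prems[OF poly_le.poly_le_cmult[OF 1(1)] _ continuous_on_mult[OF continuous_on_const 1(3)] D])
      (simp_all add: 1(2))
qed

lemma offset_differentiable:
  assumes h: "0 < h" "h < 1/64" and x: "x \<in> {1/2 - radius h<..<1/2 + radius h}"
  shows "(offset h has_real_derivative deriv (offset h) x) (at x)"
proof -
  have xx: "x \<in> base h" using x by (auto simp: base_def)
  have "((\<lambda>x. x^2 * (1 - x)^2 / 4 - h) has_real_derivative (2 * x * (1 - x)^2 - 2 * (1 - x) * x^2) / 4) (at x)"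
    by (auto intro!: derivative_eq_intros simp: power2_eq_square field_simps)
  note 1 = DERIV_chain2[OF DERIV_real_sqrt[OF radicand_pos[OF h x]] this]
  have "x \<noteq> 0" using base_pos(1)[OF h xx] by simp
  note 2 = DERIV_divide[OF 1 DERIV_ident this]
  then have "(\<lambda>x. sqrt (x^2 * (1 - x)^2 / 4 - h) / x) differentiable (at x)"
    unfolding real_differentiable_def by (rule exI)
  then show ?thesis unfolding offset_def[abs_def] by (rule DERIV_deriv_iff_real_differentiable[THEN iffD2])
qed

text \<open>On the graph \<open>y = (1 - x)/2 + e * u\<close>, so
  \<open>dy = (- 1/2 + e * u') dx\<close>. Only the part with \<open>u'\<close> is integrated by
  parts, and its boundary terms vanish because \<open>u\<close> is 0 at both ends.\<close>

lemma line_integral_poly_le: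
  assumes e: "e = 1 \<or> e = -1" and P: "poly_le n P" and Q: "poly_le n Q"
  obtains \<psi> where "poly_le n \<psi>"
    "\<And>h A \<gamma>. 0 < h \<Longrightarrow> h < 1/64 \<Longrightarrow> closure A = graph e h \<Longrightarrow> flow_parametrization unperturbed A \<gamma> \<Longrightarrow>
     line_integral P Q \<gamma> = integral (base h) (\<lambda>x. \<psi> x (offset h x))"
proof -
  define p where "p x u = P x ((1 - x) / 2 + e * u)" for x u
  define q where "q x u = Q x ((1 - x) / 2 + e * u)" for x u
  have p: "poly_le n p" unfolding p_def by (rule poly_le_subst[OF P])
  have q: "poly_le n q" unfolding q_def by (rule poly_le_subst[OF Q])
  obtain E R where R: "poly_le n R" and E: "\<And>x. E x 0 = 0"
    "\<And>S u. continuous_on S u \<Longrightarrow> continuous_on S (\<lambda>x. E x (u x))"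
    "\<And>u u' x. (u has_real_derivative u') (at x) \<Longrightarrow>
       ((\<lambda>x. E x (u x)) has_real_derivative R x (u x) + q x (u x) * u') (at x)"
    by (rule poly_le_antideriv[OF q]) (rule that)
  \<comment> \<open>Determined by the demand that \<open>e * E x u\<close> plus an antiderivative of
    this function differentiate to the integrand; the factor \<open>- e\<close> applied afterwards
    is the orientation of the arc.\<close>
  define \<psi> where "\<psi> x u = (p x u + (-1/2) * q x u) + (- e) * R x u" for x u
  have \<psi>: "poly_le n \<psi>" unfolding \<psi>_def by (intro poly_le_add poly_le_cmult p q R)
  have *: "line_integral P Q \<gamma> = integral (base h) (\<lambda>x. (- e) * \<psi> x (offset h x))"
    if h: "0 < h" "h < 1/64" and A: "closure A = graph e h" and g: "flow_parametrization unperturbed A \<gamma>" for h A \<gamma>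
  proof -
    define g where "g x = \<psi> x (offset h x)" for x
    have cg: "continuous_on (base h) g"
      unfolding g_def by (rule poly_le_continuous[OF \<psi> continuous_offset[OF h]])
    define S where "S x = e * E x (offset h x) + integral {1/2 - radius h..x} g" for x
    have cS: "continuous_on (base h) S"
      unfolding S_def using cg unfolding base_def
      by (intro continuous_intros E(2) continuous_offset[OF h, unfolded base_def] indefinite_integral_continuous_1
          integrable_continuous_real)
    have dY: "(height e h has_real_derivative - 1/2 + e * deriv (offset h) x) (at x)"
      if x: "x \<in> {1/2 - radius h<..<1/2 + radius h}" for x
      unfolding height_def[abs_def] by (auto intro!: derivative_eq_intros offset_differentiable[OF h x])
    have dS: "(S has_real_derivative P x (height e h x) + Q x (height e h x) * (- 1/2 + e * deriv (offset h) x)) (at x)"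
      if x: "x \<in> {1/2 - radius h<..<1/2 + radius h}" for x
    proof -
      have "((\<lambda>x. integral {1/2 - radius h..x} g) has_real_derivative g x) (at x within {1/2 - radius h..1/2 + radius h})"
        by (rule integral_has_real_derivative) (use cg x in \<open>auto simp: base_def\<close>)
      then have 1: "((\<lambda>x. integral {1/2 - radius h..x} g) has_real_derivative g x) (at x)"
        using x by (simp add: at_within_Icc_at)
      have eq: "e * (R x (offset h x) + q x (offset h x) * deriv (offset h) x) + g x =
          P x (height e h x) + Q x (height e h x) * (- 1/2 + e * deriv (offset h) x)"
        by (simp add: g_def \<psi>_def p_def q_def height_def algebra_simps)
      show ?thesis unfolding S_def[abs_def]
        by (rule DERIV_cong[OF DERIV_add[OF DERIV_cmult[OF E(3)[OF offset_differentiable[OF h x]]] 1] eq])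
    qed
    have "line_integral P Q \<gamma> = e * (S (1/2 - radius h) - S (1/2 + radius h))"
      by (rule line_integral_eq[where S = S and Y' = "\<lambda>x. - 1/2 + e * deriv (offset h) x" and P = P and Q = Q,
            OF h e A g cS dY dS])
    also have "\<dots> = (- e) * integral (base h) g"
      unfolding S_def offset_end[OF h] E(1) base_def by simp
    finally show ?thesis unfolding g_def by simp
  qed
  show ?thesis by (rule that[OF poly_le_cmult[OF \<psi>] *])
qed

lemma melnikov_eq_integral:
  obtains \<psi> where "poly_le n \<psi>" "\<And>h. 0 < h \<Longrightarrow> h < 1/64 \<Longrightarrow>
     melnikov (poly2 n ap) (poly2 n bp) (poly2 n am) (poly2 n bm) h = integral (base h) (\<lambda>x. \<psi> x (offset h x))"
proof -
  have neg: "poly_le n (\<lambda>x y. - poly2 n c x y)" for c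
    using poly_le_cmult[OF poly_le_poly2[of n c], of "-1"] by simp
  obtain \<psi>1 where 1: "poly_le n \<psi>1" "\<And>h A \<gamma>. 0 < h \<Longrightarrow> h < 1/64 \<Longrightarrow> closure A = graph 1 h \<Longrightarrow> flow_parametrization unperturbed A \<gamma> \<Longrightarrow>
     line_integral (poly2 n bp) (\<lambda>x y. - poly2 n ap x y) \<gamma> = integral (base h) (\<lambda>x. \<psi>1 x (offset h x))"
    by (rule line_integral_poly_le[OF disjI1[OF refl] poly_le_poly2[of n bp] neg[of ap]]) (rule that)
  obtain \<psi>2 where 2: "poly_le n \<psi>2" "\<And>h A \<gamma>. 0 < h \<Longrightarrow> h < 1/64 \<Longrightarrow> closure A = graph (-1) h \<Longrightarrow> flow_parametrization unperturbed A \<gamma> \<Longrightarrow>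
     line_integral (poly2 n bm) (\<lambda>x y. - poly2 n am x y) \<gamma> = integral (base h) (\<lambda>x. \<psi>2 x (offset h x))"
    by (rule line_integral_poly_le[OF disjI2[OF refl] poly_le_poly2[of n bm] neg[of am]]) (rule that)
  have *: "melnikov (poly2 n ap) (poly2 n bp) (poly2 n am) (poly2 n bm) h =
      integral (base h) (\<lambda>x. \<psi>1 x (offset h x) + \<psi>2 x (offset h x))" if h: "0 < h" "h < 1/64" for h
  proof -
    \<comment> \<open>The choice made in \<open>arc_integral\<close> is harmless: a parametrization
      exists, and the evaluation holds for every one of them.\<close>
    have up: "flow_parametrization unperturbed (upper_arc h) (SOME \<gamma>. flow_parametrization unperturbed (upper_arc h) \<gamma>)"
      by (rule someI_ex[OF flow_parametrization_exists[OF h _ closure_upper_arc[OF h]]]) simp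
    have lo: "flow_parametrization unperturbed (lower_arc h) (SOME \<gamma>. flow_parametrization unperturbed (lower_arc h) \<gamma>)"
      by (rule someI_ex[OF flow_parametrization_exists[OF h _ closure_lower_arc[OF h]]]) simp
    have i: "(\<lambda>x. \<psi> x (offset h x)) integrable_on base h" if "poly_le n \<psi>" for \<psi>
      using poly_le_continuous[OF that continuous_offset[OF h]] unfolding base_def by (rule integrable_continuous_real)
    show ?thesis
      unfolding melnikov_def arc_integral_def perturbed_field_0
        1(2)[OF h closure_upper_arc[OF h] up] 2(2)[OF h closure_lower_arc[OF h] lo]
      by (rule integral_add[OF i[OF 1(1)] i[OF 2(1)], symmetric])
  qed
  show ?thesis by (rule that[OF poly_le_add[OF 1(1) 2(1)] *])
qed

section \<open>From integrals over the base to the Mellin convolutions\<close>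

section \<open>Integrals of monomials over the oval\<close>

text \<open>The recursion for power sums of the roots of \<open>z\<^sup>2 - z + X * Y\<close>: two
  steps in \<open>k\<close> multiply by \<open>X * Y\<close> once, hence the degree
  \<open>k div 2\<close>.\<close>

lemma symmetric_power_sum:
  "\<exists>p :: real poly. degree p \<le> k div 2 \<and> (\<forall>X Y. X + Y = 1 \<longrightarrow> X ^ k + Y ^ k = poly p (X * Y))"
proof (induction k rule: induct_nat_012)
  case 0
  show ?case by (intro exI[of _ "[:2:]"]) simp
next
  case 1
  show ?case by (intro exI[of _ "[:1:]"]) simp
next
  case (ge2 k)
  obtain p :: "real poly" where p: "degree p \<le> k div 2" "\<forall>X Y. X + Y = 1 \<longrightarrow> X ^ k + Y ^ k = poly p (X * Y)"
    using ge2(1) by (elim exE conjE)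
  obtain q :: "real poly" where q: "degree q \<le> Suc k div 2" "\<forall>X Y. X + Y = 1 \<longrightarrow> X ^ Suc k + Y ^ Suc k = poly q (X * Y)"
    using ge2(2) by (elim exE conjE)
  have "degree (q - pCons 0 p) \<le> Suc (Suc k) div 2"
    using p(1) q(1) degree_pCons_le[of 0 p] by (intro degree_diff_le) linarith+
  moreover have "X ^ Suc (Suc k) + Y ^ Suc (Suc k) = poly (q - pCons 0 p) (X * Y)" if XY: "X + Y = 1" for X Y :: real
  proof -
    have "X ^ Suc (Suc k) + Y ^ Suc (Suc k) = (X + Y) * (X ^ Suc k + Y ^ Suc k) - X * Y * (X ^ k + Y ^ k)"
      by (simp add: algebra_simps)
    also have "\<dots> = poly (q - pCons 0 p) (X * Y)"
      using p(2) q(2) XY by simp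
    finally show ?thesis .
  qed
  ultimately show ?case by (intro exI[of _ "q - pCons 0 p"] conjI allI impI)
qed

text \<open>The common power \<open>(X * Y) ^ min i j\<close> is split off; a power sum with
  exponent \<open>k = max i j - min i j\<close> remains, and
  \<open>min i j + k div 2 = (i + j) div 2\<close>.\<close>

lemma symmetric_monomials:
  assumes "(i + j) div 2 \<le> N"
  obtains d :: "nat \<Rightarrow> real" where
    "\<And>X Y. X + Y = 1 \<Longrightarrow> X ^ i * Y ^ j + Y ^ i * X ^ j = (\<Sum>m\<le>N. d m * (X * Y) ^ m)"
proof -
  define l where "l = min i j"
  define k where "k = max i j - l"
  obtain p :: "real poly" where p: "degree p \<le> k div 2" "\<forall>X Y. X + Y = 1 \<longrightarrow> X ^ k + Y ^ k = poly p (X * Y)"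
    using symmetric_power_sum[of k] by (elim exE conjE)
  define q where "q = monom 1 l * p"
  have "degree q \<le> l + k div 2"
    using degree_mult_le[of "monom 1 l" p] degree_monom_le[of "1::real" l] p(1) unfolding q_def by linarith
  moreover have "l + k div 2 \<le> (i + j) div 2" by (auto simp: l_def k_def min_def max_def)
  ultimately have dq: "degree q \<le> N" using assms by linarith
  have "X ^ i * Y ^ j + Y ^ i * X ^ j = (\<Sum>m\<le>N. coeff q m * (X * Y) ^ m)" if XY: "X + Y = 1" for X Y :: real
  proof -
    have "X ^ i * Y ^ j + Y ^ i * X ^ j = (X * Y) ^ l * (X ^ k + Y ^ k)"
    proof (cases "i \<le> j")
      case True
      then have e: "l = i" "j = i + k" by (simp_all add: l_def k_def)
      show ?thesis unfolding e by (simp add: power_add power_mult_distrib algebra_simps)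
    next
      case False
      then have e: "l = j" "i = j + k" by (simp_all add: l_def k_def)
      show ?thesis unfolding e by (simp add: power_add power_mult_distrib algebra_simps)
    qed
    also have "\<dots> = poly q (X * Y)" using p(2) XY by (simp add: q_def poly_monom)
    also have "\<dots> = (\<Sum>m\<le>N. coeff q m * (X * Y) ^ m)"
      unfolding poly_altdef using dq by (intro sum.mono_neutral_left) (auto simp: coeff_eq_0)
    finally show ?thesis .
  qed
  then show ?thesis by (rule that)
qed

lemma powr_half: "x > 0 \<Longrightarrow> x powr (real k / 2) = sqrt x ^ k"
proof -
  assume x: "x > 0"
  have "x powr (real k / 2) = (x powr (1/2)) powr real k" by (simp add: powr_powr)
  also have "\<dots> = sqrt x ^ k" using x by (simp add: powr_half_sqrt powr_realpow)
  finally show ?thesis .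
qed

text \<open>With \<open>x = 1/2 \<plusminus> tsub a \<phi>\<close> the quantity \<open>a/(4 x (1 - x))\<close> becomes \<open>sg a \<phi>\<close>, and \<open>wsub a \<phi>\<close> is
  the factor \<open>sqrt (1 - (sg a \<phi>)\<^sup>2)\<close> in \<open>u = (1 - x)/2 * sqrt (1 - (sg a \<phi>)\<^sup>2)\<close>.\<close>

definition tsub :: "real \<Rightarrow> real \<Rightarrow> real" where
  "tsub a \<phi> = sqrt (1 - a) / 2 * sin \<phi> / sqrt (sg a \<phi>)"

definition wsub :: "real \<Rightarrow> real \<Rightarrow> real" where
  "wsub a \<phi> = sqrt (1 - a) * cos \<phi> * sqrt (1 + sg a \<phi>)"

context
  fixes a :: real
  assumes a: "a \<in> U01"
begin

lemma U01_bounds: "0 < a" "a < 1" using a by auto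

lemma level_bounds: "0 < a^2 / 64" "a^2 / 64 < 1 / 64"
  using U01_bounds power_strict_mono[of a 1 2] by simp_all

lemma radius_eq: "radius (a^2 / 64) = sqrt (1 - a) / 2"
proof -
  have "1/4 - 2 * sqrt (a^2 / 64) = (1 - a) / 4"
    using U01_bounds by (simp add: real_sqrt_divide field_simps)
  then show ?thesis unfolding radius_def by (simp only: real_sqrt_divide) simp
qed

lemma tsub_mult: "(1/2 + tsub a \<phi>) * (1/2 - tsub a \<phi>) = a / (4 * sg a \<phi>)"
proof -
  define s where "s = sg a \<phi>"
  have s: "s > 0" "s = a + (1 - a) * sin \<phi>^2" using sg_pos[OF a] by (simp_all add: s_def sg_def)
  have "tsub a \<phi> ^ 2 = (1 - a) * sin \<phi>^2 / (4 * s)"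
    using s(1) U01_bounds by (simp add: tsub_def s_def[symmetric] power_mult_distrib power_divide)
  also have "\<dots> = 1/4 - a / (4 * s)" using s by (simp add: field_simps)
  finally have "tsub a \<phi> ^ 2 = 1/4 - a / (4 * s)" .
  then show ?thesis unfolding s_def by (simp add: power2_eq_square algebra_simps)
qed

lemma tsub_bounds:
  assumes "\<phi> \<in> {0..pi/2}"
  shows "0 \<le> tsub a \<phi>" "tsub a \<phi> \<le> sqrt (1 - a) / 2"
proof -
  have s0: "0 \<le> sin \<phi>" using assms by (intro sin_ge_zero) auto
  show "0 \<le> tsub a \<phi>" using s0 sg_pos[OF a, of \<phi>] U01_bounds by (simp add: tsub_def)
  have "sin \<phi>^2 \<le> sg a \<phi>"
  proof -
    have "a * sin \<phi>^2 \<le> a * 1" using U01_bounds by (intro mult_left_mono) (auto simp: abs_square_le_1)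
    then show ?thesis by (simp add: sg_def algebra_simps)
  qed
  then have "sin \<phi> \<le> sqrt (sg a \<phi>)" by (rule real_le_rsqrt)
  then have "sin \<phi> / sqrt (sg a \<phi>) \<le> 1" using sg_pos[OF a, of \<phi>] by (simp add: divide_le_eq)
  then have "sqrt (1 - a) / 2 * (sin \<phi> / sqrt (sg a \<phi>)) \<le> sqrt (1 - a) / 2 * 1"
    using U01_bounds by (intro mult_left_mono) auto
  then show "tsub a \<phi> \<le> sqrt (1 - a) / 2" by (simp add: tsub_def)
qed

lemma tsub_ends: "tsub a 0 = 0" "tsub a (pi/2) = sqrt (1 - a) / 2"
  by (simp_all add: tsub_def sg_def)

lemma tsub_in_base:
  assumes "\<phi> \<in> {0..pi/2}" "s = 1 \<or> s = -1"
  shows "1/2 + s * tsub a \<phi> \<in> base (a^2 / 64)"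
  using tsub_bounds[OF assms(1)] assms(2) unfolding base_def radius_eq by auto

lemma tsub_deriv:
  "(tsub a has_real_derivative sqrt (1 - a) / 2 * cos \<phi> * a / (sg a \<phi> * sqrt (sg a \<phi>))) (at \<phi>)"
proof -
  define s where "s = sg a \<phi>"
  define q where "q = sqrt s"
  have s: "s > 0" "s = a + (1 - a) * sin \<phi>^2" using sg_pos[OF a] by (simp_all add: s_def sg_def)
  have q: "q > 0" "s = q * q" using s(1) by (simp_all add: q_def)
  have "(sg a has_real_derivative 2 * (1 - a) * sin \<phi> * cos \<phi>) (at \<phi>)"
    unfolding sg_def[abs_def] by (auto intro!: derivative_eq_intros)
  note 1 = DERIV_chain2[OF DERIV_real_sqrt[OF sg_pos[OF a]] this]
  have 2: "((\<lambda>\<phi>. sqrt (1 - a) / 2 * sin \<phi>) has_real_derivative sqrt (1 - a) / 2 * cos \<phi>) (at \<phi>)"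
    by (auto intro!: derivative_eq_intros)
  have 3: "sqrt (sg a \<phi>) \<noteq> 0" using sg_pos[OF a, of \<phi>] by simp
  have "(K * c * q - K * S * (inverse q / 2 * (2 * (1 - a) * S * c))) / (q * q) = K * c * a / (s * q)"
    if "S = sin \<phi>" for K c S
  proof -
    have "q * (inverse q) = 1" using q by simp
    have "K * c * q - K * S * (inverse q / 2 * (2 * (1 - a) * S * c)) = K * c * (q - inverse q * ((1 - a) * S^2))"
      by (simp add: power2_eq_square algebra_simps)
    also have "(1 - a) * S^2 = q * q - a" using s(2) q(2) that by simp
    also have "q - inverse q * (q * q - a) = a / q" using q(1) by (simp add: field_simps)
    finally show ?thesis unfolding q(2) using q(1) by (simp add: field_simps)
  qed
  note eq = this[OF refl, of "sqrt (1 - a) / 2" "cos \<phi>", unfolded q_def s_def]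
  show ?thesis unfolding tsub_def[abs_def] by (rule DERIV_cong[OF DERIV_divide[OF 2 1 3] eq])
qed

lemma wsub_sq: "wsub a \<phi> ^ 2 = 1 - sg a \<phi> ^ 2"
proof -
  have c: "(1 - a) * cos \<phi>^2 = 1 - sg a \<phi>" by (simp add: sg_def cos_squared_eq algebra_simps)
  have "wsub a \<phi> ^ 2 = ((1 - a) * cos \<phi>^2) * (1 + sg a \<phi>)"
    using U01_bounds sg_pos[OF a, of \<phi>] by (simp add: wsub_def power_mult_distrib)
  also have "\<dots> = 1 - sg a \<phi> ^ 2" unfolding c by (simp add: power2_eq_square algebra_simps)
  finally show ?thesis .
qed

lemma wsub_nonneg: "\<phi> \<in> {0..pi/2} \<Longrightarrow> wsub a \<phi> \<ge> 0"
  unfolding wsub_def using U01_bounds sg_pos[OF a, of \<phi>] cos_ge_zero[of \<phi>] by (intro mult_nonneg_nonneg) auto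

text \<open>With \<open>X = 1/2 + s * tsub a \<phi>\<close> and \<open>z = sg a \<phi>\<close> one
  has \<open>a = 4 * z * X * (1 - X)\<close>, so the radicand is
  \<open>(X * (1 - X) / 2)\<^sup>2 * (1 - z\<^sup>2)\<close>. Division by \<open>X\<close> leaves
  the mirror point \<open>1 - X\<close> as a factor, which makes the symmetrized monomials mix the
  powers \<open>i\<close> and \<open>j\<close>.\<close>

lemma offset_tsub:
  assumes \<phi>: "\<phi> \<in> {0..pi/2}" and s: "s = 1 \<or> s = -1"
  shows "offset (a^2 / 64) (1/2 + s * tsub a \<phi>) = (1/2 - s * tsub a \<phi>) * (wsub a \<phi> / 2)"
proof -
  define X where "X = 1/2 + s * tsub a \<phi>"
  define z where "z = sg a \<phi>"
  have X: "0 < X" "X < 1" using base_pos(1,2)[OF level_bounds tsub_in_base[OF \<phi> s]] by (simp_all add: X_def)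
  have "X * (1 - X) = a / (4 * z)" using tsub_mult[of \<phi>] s by (auto simp: X_def z_def algebra_simps)
  then have az: "a = 4 * z * (X * (1 - X))" using sg_pos[OF a, of \<phi>] by (simp add: z_def field_simps)
  have "X^2 * (1 - X)^2 / 4 - a^2 / 64 = (X * (1 - X) / 2)^2 * (1 - z^2)"
    unfolding az by (simp add: power2_eq_square field_simps)
  also have "\<dots> = (X * (1 - X) / 2 * wsub a \<phi>)^2" unfolding z_def wsub_sq[symmetric] by (simp only: power_mult_distrib)
  finally have "sqrt (X^2 * (1 - X)^2 / 4 - a^2 / 64) = X * (1 - X) / 2 * wsub a \<phi>"
    using X wsub_nonneg[OF \<phi>] by simp
  then have "offset (a^2 / 64) X = (1 - X) * (wsub a \<phi> / 2)" using X(1) by (simp add: offset_def)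
  then show ?thesis by (simp add: X_def)
qed

text \<open>The halves of the base on either side of \<open>1/2\<close> are substituted separately;
  their Jacobians agree up to sign, and this yields the symmetrization in \<open>x\<close> and
  \<open>1 - x\<close>.\<close>

lemma integral_base:
  assumes f: "continuous_on (base (a^2 / 64)) f"
  shows "((\<lambda>\<phi>. sqrt (1 - a) / 2 * cos \<phi> * a / (sg a \<phi> * sqrt (sg a \<phi>)) *
      (f (1/2 + tsub a \<phi>) + f (1/2 - tsub a \<phi>))) has_integral integral (base (a^2 / 64)) f) {0..pi/2}"
proof -
  define r where "r = sqrt (1 - a) / 2"
  define D where "D \<phi> = sqrt (1 - a) / 2 * cos \<phi> * a / (sg a \<phi> * sqrt (sg a \<phi>))" for \<phi>
  have base: "base (a^2 / 64) = {1/2 - r..1/2 + r}" unfolding base_def radius_eq r_def ..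
  have r: "r \<ge> 0" using U01_bounds by (simp add: r_def)
  have ct: "continuous_on {0..pi/2} (tsub a)"
    by (rule DERIV_continuous_on) (rule has_field_derivative_at_within[OF tsub_deriv])
  have 1: "((\<lambda>\<phi>. D \<phi> *\<^sub>R f (1/2 + tsub a \<phi>)) has_integral
      (integral {1/2 + tsub a 0..1/2 + tsub a (pi/2)} f - integral {1/2 + tsub a (pi/2)..1/2 + tsub a 0} f)) {0..pi/2}"
  proof (rule has_integral_substitution_general[of "{}" 0 "pi/2" "\<lambda>\<phi>. 1/2 + tsub a \<phi>" "1/2 - r" "1/2 + r" f D])
    show "(\<lambda>\<phi>. 1/2 + tsub a \<phi>) ` {0..pi/2} \<subseteq> {1/2 - r..1/2 + r}"
      using tsub_in_base[of _ 1] unfolding base by auto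
    fix x assume "x \<in> {0..pi/2} - {}"
    show "((\<lambda>\<phi>. 1/2 + tsub a \<phi>) has_real_derivative D x) (at x within {0..pi/2})"
      unfolding D_def by (rule has_field_derivative_at_within) (auto intro!: derivative_eq_intros tsub_deriv)
  qed (use f ct in \<open>auto simp: base intro!: continuous_intros\<close>)
  have 2: "((\<lambda>\<phi>. (- D \<phi>) *\<^sub>R f (1/2 - tsub a \<phi>)) has_integral
      (integral {1/2 - tsub a 0..1/2 - tsub a (pi/2)} f - integral {1/2 - tsub a (pi/2)..1/2 - tsub a 0} f)) {0..pi/2}"
  proof (rule has_integral_substitution_general[of "{}" 0 "pi/2" "\<lambda>\<phi>. 1/2 - tsub a \<phi>" "1/2 - r" "1/2 + r" f "\<lambda>\<phi>. - D \<phi>"])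
    show "(\<lambda>\<phi>. 1/2 - tsub a \<phi>) ` {0..pi/2} \<subseteq> {1/2 - r..1/2 + r}"
      using tsub_in_base[of _ "-1"] unfolding base by auto
    fix x assume "x \<in> {0..pi/2} - {}"
    show "((\<lambda>\<phi>. 1/2 - tsub a \<phi>) has_real_derivative - D x) (at x within {0..pi/2})"
      unfolding D_def by (rule has_field_derivative_at_within) (auto intro!: derivative_eq_intros tsub_deriv)
  qed (use f ct in \<open>auto simp: base intro!: continuous_intros\<close>)
  have te: "tsub a 0 = 0" "tsub a (pi/2) = r" using tsub_ends by (simp_all add: r_def)
  \<comment> \<open>The substitution rule subtracts integrals over reversed intervals, which are
    empty or a single point.\<close>
  have z: "integral {1/2 + r..1/2} f = 0" "integral {r + 1/2..1/2} f = 0" "integral {1/2..1/2 - r} f = 0"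
    using r by (cases "r = 0"; simp)+
  have c: "integral {1/2 - r..1/2} f + integral {1/2..1/2 + r} f = integral {1/2 - r..1/2 + r} f"
    by (rule Henstock_Kurzweil_Integration.integral_combine)
      (use r f in \<open>auto simp: base intro!: integrable_continuous_real\<close>)
  have "((\<lambda>\<phi>. D \<phi> *\<^sub>R f (1/2 + tsub a \<phi>) - (- D \<phi>) *\<^sub>R f (1/2 - tsub a \<phi>)) has_integral integral (base (a^2 / 64)) f) {0..pi/2}"
    using has_integral_diff[OF 1 2] unfolding te base c[symmetric] by (simp add: z add.commute)
  then show ?thesis unfolding D_def[symmetric] by (simp add: distrib_left)
qed

end

lemma monomial_integral:
  assumes ij: "(i + j) div 2 \<le> N"
  obtains d where "\<And>a. a \<in> U01 \<Longrightarrow>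
    integral (base (a^2 / 64)) (\<lambda>x. x ^ i * offset (a^2 / 64) x ^ j) = (\<Sum>m\<le>N. d m * Mf (m + 1) 0 0 (j + 1) a)"
proof -
  obtain c where c: "\<And>X Y :: real. X + Y = 1 \<Longrightarrow> X ^ i * Y ^ j + Y ^ i * X ^ j = (\<Sum>m\<le>N. c m * (X * Y) ^ m)"
    by (rule symmetric_monomials[OF ij]) (rule that)
  \<comment> \<open>\<open>(1/2) ^ j\<close> comes from \<open>u = (1 - x) * wsub / 2\<close>,
    \<open>(1/4) ^ m\<close> from \<open>X * Y = a / (4 * z)\<close>, and the last
    \<open>1/4\<close> from the \<open>1/2\<close> in the Jacobian and the factor 2 in
    \<open>Mf\<close>.\<close>
  define d where "d m = c m * (1/2) ^ j * (1/4) ^ m / 4" for m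
  have "integral (base (a^2 / 64)) (\<lambda>x. x ^ i * offset (a^2 / 64) x ^ j) = (\<Sum>m\<le>N. d m * Mf (m + 1) 0 0 (j + 1) a)"
    if a: "a \<in> U01" for a
  proof -
    let ?h = "a^2 / 64"
    let ?y = "\<lambda>m. real 0 - real (m + 1) - (real 0 + 1) / 2"
    let ?z = "(real (j + 1) - 1) / 2"
    note U01_bounds = U01_bounds[OF a] and level_bounds = level_bounds[OF a]
    have f: "continuous_on (base ?h) (\<lambda>x. x ^ i * offset ?h x ^ j)"
      by (intro continuous_intros continuous_offset level_bounds)
    define K where "K = (1 - a) powr ((real 0 + real (j + 1)) / 2)"
    define G where "G m \<phi> = sin \<phi> ^ 0 * cos \<phi> ^ (j + 1) * (sg a \<phi> powr ?y m * (1 + sg a \<phi>) powr ?z)" for m \<phi>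
    have eq: "sqrt (1 - a) / 2 * cos \<phi> * a / (sg a \<phi> * sqrt (sg a \<phi>)) *
        ((1/2 + tsub a \<phi>) ^ i * offset ?h (1/2 + tsub a \<phi>) ^ j + (1/2 - tsub a \<phi>) ^ i * offset ?h (1/2 - tsub a \<phi>) ^ j)
      = (\<Sum>m\<le>N. d m * (2 * a ^ (m + 1) * K) * G m \<phi>)" if \<phi>: "\<phi> \<in> {0..pi/2}" for \<phi>
    proof -
      define X Y where "X = 1/2 + tsub a \<phi>" and "Y = 1/2 - tsub a \<phi>"
      define z where "z = sg a \<phi>"
      define w where "w = wsub a \<phi> / 2"
      define b where "b = sqrt (1 - a)"
      have z: "z > 0" using sg_pos[OF a] by (simp add: z_def)
      have XY: "X * Y = a / (4 * z)" "X + Y = 1"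
        using tsub_mult[OF a, of \<phi>] by (simp_all add: X_def Y_def z_def)
      have u: "offset ?h X = Y * w" "offset ?h Y = X * w"
        using offset_tsub[OF a \<phi>, of 1] offset_tsub[OF a \<phi>, of "-1"] by (simp_all add: X_def Y_def w_def)
      have K: "K = b ^ (j + 1)" unfolding K_def b_def using powr_half[of "1 - a" "j + 1"] U01_bounds by simp
      have w: "w ^ j = (1/2) ^ j * b ^ j * cos \<phi> ^ j * sqrt (1 + z) ^ j"
        unfolding w_def wsub_def b_def[symmetric] z_def[symmetric] by (simp add: power_mult_distrib power_divide)
      have Gm: "G m \<phi> = cos \<phi> ^ (j + 1) * (sqrt (1 + z) ^ j / (z ^ m * (z * sqrt z)))" for m
      proof -
        have "z powr ?y m = z powr - (real (2 * m + 3) / 2)" by (rule arg_cong[where f = "\<lambda>t. z powr t"]) (simp add: field_simps)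
        also have "\<dots> = 1 / sqrt z ^ (2 * m + 3)" using powr_half[OF z, of "2 * m + 3"] by (simp only: powr_minus_divide)
        also have "sqrt z ^ (2 * m + 3) = (sqrt z ^ 2) ^ m * (sqrt z ^ 2 * sqrt z)"
          by (simp only: power_add power_mult[symmetric]) (simp add: power3_eq_cube power2_eq_square)
        also have "sqrt z ^ 2 = z" using z by simp
        finally have 1: "z powr ?y m = 1 / (z ^ m * (z * sqrt z))" .
        have 2: "(1 + z) powr ?z = sqrt (1 + z) ^ j" using powr_half[of "1 + z" j] z by simp
        show ?thesis unfolding G_def z_def[symmetric] 1 2 by simp
      qed
      have "b / 2 * cos \<phi> * a / (z * sqrt z) * (X ^ i * (Y * w) ^ j + Y ^ i * (X * w) ^ j) =
          b / 2 * cos \<phi> * a / (z * sqrt z) * (w ^ j * (X ^ i * Y ^ j + Y ^ i * X ^ j))"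
        by (simp add: power_mult_distrib algebra_simps)
      also have "\<dots> = (\<Sum>m\<le>N. b / 2 * cos \<phi> * a / (z * sqrt z) * (w ^ j * (c m * (a / (4 * z)) ^ m)))"
        unfolding c[OF XY(2)] XY(1) by (simp only: sum_distrib_left)
      also have "\<dots> = (\<Sum>m\<le>N. d m * (2 * a ^ (m + 1) * K) * G m \<phi>)"
        unfolding Gm w K d_def by (intro sum.cong refl) (simp add: power_mult_distrib power_divide field_simps)
      finally show ?thesis unfolding X_def[symmetric] Y_def[symmetric] u b_def z_def .
    qed
    have G: "(G m has_integral FnI 0 (j + 1) (?y m) ?z a) {0..pi/2}" for m
      unfolding FnI_def G_def by (rule integrable_integral[OF FnI_integrable[OF a]])
    have "((\<lambda>\<phi>. \<Sum>m\<le>N. d m * (2 * a ^ (m + 1) * K) * G m \<phi>) has_integral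
        (\<Sum>m\<le>N. d m * (2 * a ^ (m + 1) * K) * FnI 0 (j + 1) (?y m) ?z a)) {0..pi/2}"
      by (intro has_integral_sum finite_atMost has_integral_mult_right G)
    moreover have "((\<lambda>\<phi>. \<Sum>m\<le>N. d m * (2 * a ^ (m + 1) * K) * G m \<phi>) has_integral
        integral (base ?h) (\<lambda>x. x ^ i * offset ?h x ^ j)) {0..pi/2}"
      by (rule has_integral_eq[OF eq integral_base[OF a f]])
    ultimately have "integral (base ?h) (\<lambda>x. x ^ i * offset ?h x ^ j) =
        (\<Sum>m\<le>N. d m * (2 * a ^ (m + 1) * K) * FnI 0 (j + 1) (?y m) ?z a)"
      by (rule has_integral_unique[rotated])
    also have "\<dots> = (\<Sum>m\<le>N. d m * Mf (m + 1) 0 0 (j + 1) a)"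
      unfolding Mf_def Fn_def K_def by (simp only: mult.assoc)
    finally show ?thesis .
  qed
  then show ?thesis by (rule that)
qed

lemma poly_le_integral:
  assumes "poly_le n f" and N: "N = n div 2"
  obtains c where "\<And>a. a \<in> U01 \<Longrightarrow> integral (base (a^2 / 64)) (\<lambda>x. f x (offset (a^2 / 64) x)) =
    (\<Sum>m\<le>N. \<Sum>j\<le>n. c m j * Mf (m + 1) 0 0 (j + 1) a)"
  using assms(1)
proof (induction arbitrary: thesis)
  case (poly_le_monomial i j)
  have "(i + j) div 2 \<le> N" unfolding N by (rule div_le_mono[OF poly_le_monomial.hyps])
  then obtain d where d: "\<And>a. a \<in> U01 \<Longrightarrow>
    integral (base (a^2 / 64)) (\<lambda>x. x ^ i * offset (a^2 / 64) x ^ j) = (\<Sum>m\<le>N. d m * Mf (m + 1) 0 0 (j + 1) a)"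
    by (rule monomial_integral) (rule that)
  have j: "j \<le> n" using poly_le_monomial.hyps by simp
  have "(\<Sum>l\<le>n. (if l = j then d m else 0) * Mf (m + 1) 0 0 (l + 1) a) = d m * Mf (m + 1) 0 0 (j + 1) a" for m a
  proof -
    have "(\<Sum>l\<le>n. (if l = j then d m else 0) * Mf (m + 1) 0 0 (l + 1) a) =
        (\<Sum>l\<le>n. if l = j then d m * Mf (m + 1) 0 0 (l + 1) a else 0)"
      by (intro sum.cong refl) simp
    also have "\<dots> = d m * Mf (m + 1) 0 0 (j + 1) a" by (subst sum.delta) (use j in simp_all)
    finally show ?thesis .
  qed
  then show ?case by (intro poly_le_monomial.prems[of "\<lambda>m l. if l = j then d m else 0"]) (simp only: d)
next
  case (poly_le_add f g)
  obtain c1 where 1: "\<And>a. a \<in> U01 \<Longrightarrow> integral (base (a^2 / 64)) (\<lambda>x. f x (offset (a^2 / 64) x)) =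
    (\<Sum>m\<le>N. \<Sum>j\<le>n. c1 m j * Mf (m + 1) 0 0 (j + 1) a)" by (rule poly_le_add.IH(1)) (rule that)
  obtain c2 where 2: "\<And>a. a \<in> U01 \<Longrightarrow> integral (base (a^2 / 64)) (\<lambda>x. g x (offset (a^2 / 64) x)) =
    (\<Sum>m\<le>N. \<Sum>j\<le>n. c2 m j * Mf (m + 1) 0 0 (j + 1) a)" by (rule poly_le_add.IH(2)) (rule that)
  show ?case
  proof (rule poly_le_add.prems[of "\<lambda>m j. c1 m j + c2 m j"])
    fix a assume a: "a \<in> U01"
    have i: "(\<lambda>x. \<psi> x (offset (a^2 / 64) x)) integrable_on base (a^2 / 64)" if "poly_le n \<psi>" for \<psi>
      using poly_le_continuous[OF that continuous_offset[OF level_bounds[OF a]]] unfolding base_def by (rule integrable_continuous_real)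
    show "integral (base (a^2 / 64)) (\<lambda>x. f x (offset (a^2 / 64) x) + g x (offset (a^2 / 64) x)) =
        (\<Sum>m\<le>N. \<Sum>j\<le>n. (c1 m j + c2 m j) * Mf (m + 1) 0 0 (j + 1) a)"
      unfolding integral_add[OF i[OF poly_le_add.hyps(1)] i[OF poly_le_add.hyps(2)]] 1[OF a] 2[OF a]
      by (simp only: distrib_right sum.distrib)
  qed
next
  case (poly_le_cmult f k)
  obtain c1 where 1: "\<And>a. a \<in> U01 \<Longrightarrow> integral (base (a^2 / 64)) (\<lambda>x. f x (offset (a^2 / 64) x)) =
    (\<Sum>m\<le>N. \<Sum>j\<le>n. c1 m j * Mf (m + 1) 0 0 (j + 1) a)" by (rule poly_le_cmult.IH) (rule that)
  show ?case
  proof (rule poly_le_cmult.prems[of "\<lambda>m j. k * c1 m j"])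
    fix a assume a: "a \<in> U01"
    show "integral (base (a^2 / 64)) (\<lambda>x. k * f x (offset (a^2 / 64) x)) =
        (\<Sum>m\<le>N. \<Sum>j\<le>n. (k * c1 m j) * Mf (m + 1) 0 0 (j + 1) a)"
      by (simp only: integral_mult_right 1[OF a] sum_distrib_left mult.assoc)
  qed
qed

theorem theorem1p5:
  fixes n :: nat
    and ap am bp bm :: "nat \<Rightarrow> nat \<Rightarrow> real"
    and I :: "real \<Rightarrow> real"
  defines "I \<equiv> melnikov (poly2 n ap) (poly2 n bp) (poly2 n am) (poly2 n bm)"
  shows "finite (isolated_zeros I {0<..<1/64}) \<and>
         (\<Sum>h\<in>isolated_zeros I {0<..<1/64}. zero_multiplicity I h) \<le> enat (11 * n div 2 + 43)"
proof -
  let ?T = "{0<..<1/64} :: real set"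
  obtain \<psi> where \<psi>: "poly_le n \<psi>" "\<And>h. 0 < h \<Longrightarrow> h < 1/64 \<Longrightarrow> I h = integral (base h) (\<lambda>x. \<psi> x (offset h x))"
    by (rule melnikov_eq_integral[of n ap bp am bm, folded I_def]) (rule that)
  obtain c where c: "\<And>a. a \<in> U01 \<Longrightarrow> integral (base (a^2 / 64)) (\<lambda>x. \<psi> x (offset (a^2 / 64) x)) =
    (\<Sum>m\<le>n div 2. \<Sum>j\<le>n. c m j * Mf (m + 1) 0 0 (j + 1) a)"
    by (rule poly_le_integral[OF \<psi>(1) refl]) (rule that)
  have I: "I (a^2 / 64) = (\<Sum>m\<le>n div 2. \<Sum>j\<le>n. c m j * Mf (m + 1) 0 0 (j + 1) a)" if "a \<in> U01" for a
    using \<psi>(2)[OF level_bounds[OF that]] c[OF that] by simp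
  have Z: "zeros_le U01 (\<lambda>a. I (a^2 / 64)) (11 * (n div 2) + 8)"
    and sm: "smooth U01 (\<lambda>a. I (a^2 / 64))"
    using zeros_le_Mf_sum[OF refl I] by blast+
  have g: "smooth U01 (\<lambda>a. a^2 / 64)"
    using smooth_cmult[OF smooth_power[OF smooth_ident], of U01 "1/64" 2] by simp
  have img: "(\<lambda>a. a^2 / 64) ` U01 = ?T"
  proof (intro set_eqI iffI)
    fix h assume h: "h \<in> ?T"
    then have "8 * sqrt h \<in> U01" using sqrt_h[of h] by simp
    moreover have "h = (8 * sqrt h)^2 / 64" using h by (simp add: power_mult_distrib)
    ultimately show "h \<in> (\<lambda>a. a^2 / 64) ` U01" by (rule rev_image_eqI)
  qed (use level_bounds in auto)
  have inj: "inj_on (\<lambda>a. a^2 / 64) U01"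
    by (rule inj_onI) (simp add: power2_eq_iff_nonneg)
  \<comment> \<open>Smoothness in \<open>h\<close> is pulled back through the inverse substitution
    \<open>a = 8 * h powr (1/2)\<close>, smooth for positive \<open>h\<close>.\<close>
  have smI: "smooth ?T I"
  proof -
    have "smooth ?T (\<lambda>h. 8 * h powr (1/2))" by (auto intro!: smooth_intros)
    then have "smooth ?T (\<lambda>h. I ((8 * h powr (1/2))^2 / 64))"
      by (rule smooth_compose[OF _ sm]) (use sqrt_h in \<open>simp add: powr_half_sqrt mult.commute\<close>)
    moreover have "smooth ?T (\<lambda>h. I ((8 * h powr (1/2))^2 / 64)) \<longleftrightarrow> smooth ?T I"
      by (rule smooth_cong) (simp_all add: power_mult_distrib powr_half_sqrt)
    ultimately show ?thesis by (simp only:)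
  qed
  have "zeros_le ?T I (11 * (n div 2) + 8)"
    by (rule zeros_le_compose[OF _ g img inj _ smI Z]) (simp_all)
  \<comment> \<open>\<open>11 * (n div 2)\<close> is at most \<open>11 * n div 2\<close>, for either
    parity of \<open>n\<close>.\<close>
  then have "zeros_le ?T I (11 * n div 2 + 43)" by (rule zeros_le_mono) presburger
  then show ?thesis by (intro zero_multiplicity_bound) simp_all
qed

end
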